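(* Let $M\ge 2$ and consider the real compound MISO broadcast channel with $M$ antennas at the transmitter and $2$ single-antenna users having $J_1\ge 1$ and $J_2\ge 1$ possible channel states respectively, where either $J_1<M$ and $J_2\ge M$, or $J_2<M$ and $J_1\ge M$. Then, almost surely (with respect to the draw of the channel states), the exact total number of degrees of freedom is $d=1+\frac{M-1}{M}$.
   Context: Real compound MISO broadcast channel. A transmitter with $M>1$ antennas communicates with $K$ single-antenna receivers (here $K=2$). For each user $k\in\{1,\dots,K\}$ there is a finite set of $J_k$ possible channel vectors (states) $\mathbf{h}^{[k]}_{1},\dots,\mathbf{h}^{[k]}_{J_k}\in\mathbb{R}^{1\times M}$. If user $k$ is in state $j_k\in\{1,\dots,J_k\}$, its received signal at time $t$ is $$y^{[k]}_{j_k}(t)=\mathbf{h}^{[k]}_{j_k}\mathbf{x}(t)+z^{[k]}_{j_k}(t),$$ where $\mathbf{x}(t)\in\mathbb{R}^{M\times 1}$ is the transmitted vector, subject to the average power constraint $E(\|\mathbf{x}\|^2)\le P$ (averaged over the codeword), and the noise $z^{[k]}_{j_k}(t)$ is i.i.d. zero-mean unit-variance real Gaussian. The state of each user is fixed throughout the duration of communication. The sets of possible states are known to all nodes and do not depend on $P$; the transmitter does not know which states are realized, while the receivers have perfect channel knowledge. Generic states / almost surely. All the coefficients of all possible states are drawn from a continuous distribution (absolutely continuous with respect to Lebesgue measure), so that almost surely they are algebraically independent over the rationals; "almost surely" refers to this draw. Achievable rates. The transmitter sends independent messages $W^{[k]}$ of rate $R^{[k]}$ to receiver $k$, $k=1,\dots,K$.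 A rate tuple $(R^{[1]},\dots,R^{[K]})$ is achievable at power $P$ if there are codes (encoder not depending on the realized states) of growing block length such that every receiver $k$ decodes $W^{[k]}$ with arbitrarily small error probability, regardless of which state is realized. Degrees of freedom. The total number of degrees of freedom is $$d=\lim_{P\to\infty}\frac{C_\Sigma(P)}{\frac12\log P},$$ where $C_\Sigma(P)$ is the supremum of $R^{[1]}+\cdots+R^{[K]}$ over all rate tuples achievable at power $P$. *)

theory Defs
  imports "HOL-Probability.Probability"
begin

text \<open>
  The compound MISO broadcast channel with \<open>K\<close> users and \<open>CARD('m)\<close> transmit antennas. Users are
  \<open>k \<in> {1..K}\<close>; the possible states of user \<open>k\<close> are \<open>j \<in> {1..J k}\<close>, and \<open>h (k, j)\<close> is the
  channel vector of user \<open>k\<close> in state \<open>j\<close>. Only these index pairs are ever looked at.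
\<close>

definition states :: "nat \<Rightarrow> (nat \<Rightarrow> nat) \<Rightarrow> (nat \<times> nat) set" where
  "states K J = (SIGMA k:{1..K}. {1..J k})"

definition lebesgue_states ::
    "nat \<Rightarrow> (nat \<Rightarrow> nat) \<Rightarrow> (nat \<times> nat \<Rightarrow> real ^ 'm::finite) measure" where
  "lebesgue_states K J = (\<Pi>\<^sub>M s\<in>states K J. lborel)"

definition continuous_distribution ::
    "nat \<Rightarrow> (nat \<Rightarrow> nat) \<Rightarrow> (nat \<times> nat \<Rightarrow> real ^ 'm::finite) measure \<Rightarrow> bool" where
  "continuous_distribution K J \<mu> \<longleftrightarrow>
     prob_space \<mu> \<and>
     sets \<mu> = sets (lebesgue_states K J) \<and>
     absolutely_continuous (lebesgue_states K J) \<mu>"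

text \<open>
  The decoder of user \<open>k\<close> is indexed by \<open>j\<close> because the receiver knows its realized state; the
  encoder is not, because the transmitter does not. A code is chosen for a given \<open>h\<close>, since all
  nodes know the sets of possible states.
\<close>

record 'm code =
  len :: nat
  msg_count :: "nat \<Rightarrow> nat"
  enc :: "(nat \<Rightarrow> nat) \<Rightarrow> nat \<Rightarrow> real ^ 'm"
  dec :: "nat \<Rightarrow> nat \<Rightarrow> (nat \<Rightarrow> real) \<Rightarrow> nat"

definition messages :: "nat \<Rightarrow> 'm::finite code \<Rightarrow> (nat \<Rightarrow> nat) set" where
  "messages K c = (\<Pi>\<^sub>E k\<in>{1..K}. {..<msg_count c k})"

text \<open>Independent messages, each uniform, amount to a uniform message tuple.\<close>

definition message_dist :: "nat \<Rightarrow> 'm::finite code \<Rightarrow> (nat \<Rightarrow> nat) pmf" where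
  "message_dist K c = pmf_of_set (messages K c)"

definition valid_code :: "nat \<Rightarrow> (nat \<Rightarrow> nat) \<Rightarrow> 'm::finite code \<Rightarrow> bool" where
  "valid_code K J c \<longleftrightarrow>
     len c \<ge> 1 \<and>
     (\<forall>k\<in>{1..K}. msg_count c k \<ge> 1) \<and>
     (\<forall>(k, j)\<in>states K J. dec c k j \<in> (\<Pi>\<^sub>M t\<in>{..<len c}. borel) \<rightarrow>\<^sub>M count_space UNIV)"

definition avg_power :: "nat \<Rightarrow> 'm::finite code \<Rightarrow> real" where
  "avg_power K c =
     (\<Sum>t<len c. measure_pmf.expectation (message_dist K c) (\<lambda>w. (norm (enc c w t))\<^sup>2)) / real (len c)"

definition noise :: "nat \<Rightarrow> (nat \<Rightarrow> real) measure" where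
  "noise n = (\<Pi>\<^sub>M t\<in>{..<n}. density lborel (\<lambda>x. ennreal (std_normal_density x)))"

definition received ::
    "(nat \<times> nat \<Rightarrow> real ^ 'm::finite) \<Rightarrow> 'm code \<Rightarrow> nat \<Rightarrow> nat \<Rightarrow> (nat \<Rightarrow> nat) \<Rightarrow> (nat \<Rightarrow> real) \<Rightarrow> nat \<Rightarrow> real"
  where "received h c k j w z = (\<lambda>t\<in>{..<len c}. h (k, j) \<bullet> enc c w t + z t)"

definition error_prob ::
    "nat \<Rightarrow> (nat \<times> nat \<Rightarrow> real ^ 'm::finite) \<Rightarrow> 'm code \<Rightarrow> nat \<Rightarrow> nat \<Rightarrow> real" where
  "error_prob K h c k j =
     measure_pmf.expectation (message_dist K c)
       (\<lambda>w. measure (noise (len c))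
              {z \<in> space (noise (len c)). dec c k j (received h c k j w z) \<noteq> w k})"

text \<open>Rates are in bits per channel use.\<close>

definition achievable ::
    "nat \<Rightarrow> (nat \<Rightarrow> nat) \<Rightarrow> (nat \<times> nat \<Rightarrow> real ^ 'm::finite) \<Rightarrow> real \<Rightarrow> (nat \<Rightarrow> real) \<Rightarrow> bool" where
  "achievable K J h P R \<longleftrightarrow>
     (\<forall>k\<in>{1..K}. R k \<ge> 0) \<and>
     (\<forall>\<epsilon>>0. \<forall>n\<^sub>0. \<exists>c :: 'm code.
        valid_code K J c \<and> len c \<ge> n\<^sub>0 \<and> avg_power K c \<le> P \<and>
        (\<forall>k\<in>{1..K}. log 2 (real (msg_count c k)) / real (len c) \<ge> R k) \<and>
        (\<forall>(k, j)\<in>states K J. error_prob K h c k j \<le> \<epsilon>))"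

definition sum_capacity ::
    "nat \<Rightarrow> (nat \<Rightarrow> nat) \<Rightarrow> (nat \<times> nat \<Rightarrow> real ^ 'm::finite) \<Rightarrow> real \<Rightarrow> ereal" where
  "sum_capacity K J h P = (SUP R\<in>{R. achievable K J h P R}. ereal (\<Sum>k=1..K. R k))"

definition has_dof ::
    "nat \<Rightarrow> (nat \<Rightarrow> nat) \<Rightarrow> (nat \<times> nat \<Rightarrow> real ^ 'm::finite) \<Rightarrow> real \<Rightarrow> bool" where
  "has_dof K J h d \<longleftrightarrow>
     ((\<lambda>P. sum_capacity K J h P / ereal (1 / 2 * log 2 P)) \<longlongrightarrow> ereal d) at_top"

end

theory Submission
  imports Defs "HOL-Real_Asymp.Real_Asymp"
begin

text \<open>
  Let user \<open>a\<close> be the one with fewer than \<open>m\<close> states and \<open>b\<close> the other one, where \<open>m\<close> is the number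
  of antennas.

  Converse. Round the noiseless signals at \<open>m\<close> states of user \<open>b\<close> to integers; up to a power
  \<open>C ^ n\<close>, a receiver that sees only the rounded signal and adds its own, wider Gaussian noise
  decodes as well as the original one. The rounded signals take at most \<open>S = (O(\<surd>P)) ^ n\<close> values,
  those at the \<open>m\<close> states together determine the transmitted vector up to a bounded error, and
  counting gives \<open>|W\<^sub>a| powr (1 / m) * |W\<^sub>b| \<le> C ^ n * S\<close> and \<open>|W\<^sub>a| \<le> C ^ n * S\<close>.

  Achievability. The signal of user \<open>b\<close> is zero-forced at user \<open>a\<close>; the signal of user \<open>a\<close> uses
  integer combinations of monomials in the channel coefficients of user \<open>b\<close>, which align there into
  a fraction of about \<open>1 / m\<close> of the available dimensions. For generic coefficients the monomials are
  linearly independent over the rationals, and repeating the pattern with random real coefficients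
  yields a sufficient minimum distance by a union bound, so no Diophantine approximation on
  manifolds is needed.
\<close>

subsection \<open>The converse\<close>

text \<open>The converse is a counting form of an entropy chain. Given the message of
  \<open>b\<close>, its \<open>m\<close> outputs still determine that of \<open>a\<close>, so
  averaged over these states the interference costs \<open>b\<close> at least a share 1/m of the
  rate of \<open>a\<close>. Hence R_a / m + R_b and R_a are each at most (1/2) log P + O(1); the
  first plus 1 - 1/m times the second gives 2 - 1/m = 1 + (m - 1)/m. Having at least
  \<open>m\<close> states at \<open>b\<close> supplies the \<open>m\<close> independent outputs,
  having fewer at \<open>a\<close> leaves a direction that \<open>a\<close> does not see. For
  achievability the obstacle is that rational independence makes integer combinations nonzero
  without bounding them from below. The alphabet size \<open>Q\<close> and the exponent bound
  \<open>n\<close> therefore stay fixed while \<open>P\<close> grows: only finitely many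
  combinations occur and their minimum is a positive constant. The growth with \<open>P\<close> is
  left to the number \<open>N\<close> of repetitions, proportional to log P. The price is a factor
  log Q / log (3 m Q), as a separation bound counts differences instead of symbols; it tends to 1
  when \<open>Q\<close> grows after \<open>P\<close>.\<close>

text \<open>The wider variance makes the density ratio bounded in \<open>y\<close>: since
  \<open>(y - c)^2 <= 2 * (y - \<mu>)^2 + 2 * (\<mu> - c)^2\<close>, doubling the variance absorbs
  the first term and the second costs \<open>exp (A^2 / 2)\<close>. With equal variances the ratio
  would be unbounded as soon as \<mu> and \<open>c\<close> differ.\<close>

lemma nn_integral_gauss_translate:
  fixes \<mu> c A :: real and g :: "real \<Rightarrow> ennreal"
  assumes [measurable]: "g \<in> borel_measurable borel" and A: "\<bar>\<mu> - c\<bar> \<le> A"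
  shows "(\<integral>\<^sup>+z. g (\<mu> + z) \<partial>density lborel (\<lambda>x. ennreal (std_normal_density x)))
     \<le> ennreal (sqrt 2 * exp (A\<^sup>2 / 2)) * (\<integral>\<^sup>+y. g y \<partial>density lborel (\<lambda>x. ennreal (normal_density c (sqrt 2) x)))"
proof -
  have dens: "std_normal_density (y - \<mu>) \<le> sqrt 2 * exp (A\<^sup>2 / 2) * normal_density c (sqrt 2) y" for y
  proof -
    have "(y - c)\<^sup>2 \<le> 2 * (y - \<mu>)\<^sup>2 + 2 * (\<mu> - c)\<^sup>2"
      using zero_le_power2[of "(y - \<mu>) - (\<mu> - c)"] by (simp add: power2_eq_square algebra_simps)
    moreover have "(\<mu> - c)\<^sup>2 \<le> A\<^sup>2"
      using A by (simp add: abs_le_square_iff[symmetric])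
    ultimately have "- (y - \<mu>)\<^sup>2 / 2 \<le> A\<^sup>2 / 2 + - (y - c)\<^sup>2 / 4" by simp
    then have "exp (- (y - \<mu>)\<^sup>2 / 2) \<le> exp (A\<^sup>2 / 2) * exp (- (y - c)\<^sup>2 / 4)"
      by (simp add: exp_add[symmetric])
    then have "exp (- (y - \<mu>)\<^sup>2 / 2) / sqrt (2 * pi) \<le> exp (A\<^sup>2 / 2) * exp (- (y - c)\<^sup>2 / 4) / sqrt (2 * pi)"
      by (intro divide_right_mono) auto
    moreover have "exp (A\<^sup>2 / 2) * exp (- (y - c)\<^sup>2 / 4) / sqrt (2 * pi) = sqrt 2 * exp (A\<^sup>2 / 2) * normal_density c (sqrt 2) y"
    proof -
      have "sqrt (4 * pi) = sqrt 2 * sqrt (2 * pi)" by (simp add: real_sqrt_mult[symmetric])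
      then show ?thesis by (simp add: normal_density_def)
    qed
    ultimately show ?thesis
      by (simp add: normal_density_def)
  qed
  have "(\<integral>\<^sup>+z. g (\<mu> + z) \<partial>density lborel (\<lambda>x. ennreal (std_normal_density x)))
    = (\<integral>\<^sup>+z. ennreal (std_normal_density z) * g (\<mu> + z) \<partial>lborel)"
    by (simp add: nn_integral_density)
  also have "\<dots> = (\<integral>\<^sup>+y. ennreal (std_normal_density (y - \<mu>)) * g y \<partial>lborel)"
    by (subst nn_integral_real_affine[of _ 1 "\<mu>"]) auto
  also have "\<dots> \<le> (\<integral>\<^sup>+y. ennreal (sqrt 2 * exp (A\<^sup>2 / 2)) * (ennreal (normal_density c (sqrt 2) y) * g y) \<partial>lborel)"
    by (intro nn_integral_mono, subst mult.assoc[symmetric], rule mult_right_mono)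
       (auto simp: ennreal_mult[symmetric] dens)
  also have "\<dots> = ennreal (sqrt 2 * exp (A\<^sup>2 / 2)) * (\<integral>\<^sup>+y. g y \<partial>density lborel (\<lambda>x. ennreal (normal_density c (sqrt 2) x)))"
    by (simp add: nn_integral_density nn_integral_cmult)
  finally show ?thesis .
qed

lemma product_sigma_finite_normal:
  assumes "\<And>i. \<sigma> i > 0"
  shows "product_sigma_finite (\<lambda>i. density lborel (\<lambda>x. ennreal (normal_density (c i) (\<sigma> i) x)))"
  unfolding product_sigma_finite_def
  by (auto intro!: prob_space_imp_sigma_finite prob_space_normal_density assms)

text \<open>Fubini peels off one coordinate at a time, so the one-letter constant is raised to the
  power \<open>card I\<close>. A factor exponential in the block length costs only a bounded number
  of bits per channel use.\<close>

lemma nn_integral_PiM_gauss_translate: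
  fixes \<mu> c :: "'i \<Rightarrow> real" and f :: "('i \<Rightarrow> real) \<Rightarrow> ennreal"
  assumes "finite I" and f: "f \<in> borel_measurable (\<Pi>\<^sub>M i\<in>I. borel)" and A: "\<And>i. i \<in> I \<Longrightarrow> \<bar>\<mu> i - c i\<bar> \<le> A"
  shows "(\<integral>\<^sup>+z. f (\<lambda>i\<in>I. \<mu> i + z i) \<partial>(\<Pi>\<^sub>M i\<in>I. density lborel (\<lambda>x. ennreal (std_normal_density x))))
     \<le> ennreal ((sqrt 2 * exp (A\<^sup>2 / 2)) ^ card I) *
       (\<integral>\<^sup>+y. f y \<partial>(\<Pi>\<^sub>M i\<in>I. density lborel (\<lambda>x. ennreal (normal_density (c i) (sqrt 2) x))))"
  using assms
proof (induction I arbitrary: f rule: finite_induct)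
  case empty
  then show ?case by (simp add: PiM_empty nn_integral_count_space_finite)
next
  case (insert i I)
  let ?N = "\<lambda>i::'i. density lborel (\<lambda>x. ennreal (std_normal_density x))"
  let ?S = "\<lambda>i. density lborel (\<lambda>x. ennreal (normal_density (c i) (sqrt 2) x))"
  let ?C = "sqrt 2 * exp (A\<^sup>2 / 2)"
  interpret N: product_sigma_finite ?N by (rule product_sigma_finite_normal) simp
  interpret S: product_sigma_finite ?S by (rule product_sigma_finite_normal) simp
  interpret SI: finite_product_sigma_finite ?S I by standard fact
  note f[measurable] = insert.prems(1)
  have setsS: "sets (\<Pi>\<^sub>M i\<in>K. ?S i) = sets (\<Pi>\<^sub>M i\<in>K. borel)" for K
    by (intro sets_PiM_cong) auto
  have fS: "f \<in> borel_measurable (\<Pi>\<^sub>M i\<in>insert i I. ?S i)"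
    using f measurable_cong_sets[OF setsS refl] by blast
  have upd: "(\<lambda>(x, y). x(i := y)) \<in> (\<Pi>\<^sub>M i\<in>I. borel) \<Otimes>\<^sub>M (borel :: real measure) \<rightarrow>\<^sub>M (\<Pi>\<^sub>M i\<in>insert i I. borel)"
    by (rule measurable_add_dim)
  have fup[measurable]: "(\<lambda>(x, y). f (x(i := y))) \<in> borel_measurable ((\<Pi>\<^sub>M i\<in>I. borel) \<Otimes>\<^sub>M borel)"
    using measurable_compose[OF upd f] by (simp add: split_beta')
  have pairS: "sets ((\<Pi>\<^sub>M i\<in>I. borel) \<Otimes>\<^sub>M (borel::real measure)) = sets ((\<Pi>\<^sub>M i\<in>I. ?S i) \<Otimes>\<^sub>M ?S i)"
    by (intro sets_pair_measure_cong) (auto simp: setsS)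
  define G where "G x = (\<integral>\<^sup>+y. f (x(i := y)) \<partial>?S i)" for x
  have G: "G \<in> borel_measurable (\<Pi>\<^sub>M i\<in>I. borel)"
  proof -
    have "G \<in> borel_measurable (\<Pi>\<^sub>M i\<in>I. ?S i)"
      unfolding G_def using fup measurable_cong_sets[OF pairS refl]
      by (intro S.borel_measurable_nn_integral) blast
    then show ?thesis using measurable_cong_sets[OF setsS refl] by blast
  qed
  have meas1: "(\<lambda>z. f (\<lambda>j\<in>insert i I. \<mu> j + z j)) \<in> borel_measurable (\<Pi>\<^sub>M i\<in>insert i I. ?N i)"
    by (rule measurable_compose[OF _ f]) measurable
  have "(\<integral>\<^sup>+z. f (\<lambda>j\<in>insert i I. \<mu> j + z j) \<partial>(\<Pi>\<^sub>M i\<in>insert i I. ?N i))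
    = (\<integral>\<^sup>+x. \<integral>\<^sup>+y. f (\<lambda>j\<in>insert i I. \<mu> j + (x(i := y)) j) \<partial>?N i \<partial>(\<Pi>\<^sub>M i\<in>I. ?N i))"
    using insert by (subst N.product_nn_integral_insert[OF _ _ meas1]) auto
  also have "\<dots> = (\<integral>\<^sup>+x. \<integral>\<^sup>+y. f ((\<lambda>j\<in>I. \<mu> j + x j)(i := \<mu> i + y)) \<partial>?N i \<partial>(\<Pi>\<^sub>M i\<in>I. ?N i))"
    using insert(2) by (intro nn_integral_cong arg_cong[where f = f]) (auto simp: fun_eq_iff)
  also have "\<dots> \<le> (\<integral>\<^sup>+x. ennreal ?C * G (\<lambda>j\<in>I. \<mu> j + x j) \<partial>(\<Pi>\<^sub>M i\<in>I. ?N i))"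
  proof (rule nn_integral_mono)
    fix x :: "'i \<Rightarrow> real"
    have sp: "(\<lambda>j\<in>I. \<mu> j + x j) \<in> space (\<Pi>\<^sub>M i\<in>I. borel)" by (simp add: space_PiM)
    have "(\<lambda>y. f ((\<lambda>j\<in>I. \<mu> j + x j)(i := y))) \<in> borel_measurable borel"
      using measurable_compose[OF measurable_Pair1'[OF sp] fup] by simp
    then show "(\<integral>\<^sup>+y. f ((\<lambda>j\<in>I. \<mu> j + x j)(i := \<mu> i + y)) \<partial>?N i) \<le> ennreal ?C * G (\<lambda>j\<in>I. \<mu> j + x j)"
      unfolding G_def by (rule nn_integral_gauss_translate) (use insert in auto)
  qed
  also have "\<dots> = ennreal ?C * (\<integral>\<^sup>+x. G (\<lambda>j\<in>I. \<mu> j + x j) \<partial>(\<Pi>\<^sub>M i\<in>I. ?N i))"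
    by (rule nn_integral_cmult, rule measurable_compose[OF _ G]) measurable
  also have "\<dots> \<le> ennreal ?C * (ennreal (?C ^ card I) * (\<integral>\<^sup>+x. G x \<partial>(\<Pi>\<^sub>M i\<in>I. ?S i)))"
    by (intro mult_left_mono insert.IH G) (use insert in auto)
  also have "(\<integral>\<^sup>+x. G x \<partial>(\<Pi>\<^sub>M i\<in>I. ?S i)) = (\<integral>\<^sup>+y. f y \<partial>(\<Pi>\<^sub>M i\<in>insert i I. ?S i))"
    unfolding G_def using insert by (subst S.product_nn_integral_insert[OF _ _ fS]) auto
  finally show ?case using insert by (simp add: ennreal_mult mult.assoc)
qed

section \<open>Counting rounded signals and joint decisions\<close>

text \<open>Exponential weighting: with \<open>x = exp (- (1 / L))\<close> every admissible vector
  has weight \<open>exp 1 ^ n * (\<Prod>t<n. x ^ nat \<bar>s t\<bar>)\<close> at least 1, and the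
  total weight factors into two-sided geometric sums of size at most \<open>2 * (L + 1)\<close>. A
  box bound would be too weak, since power is averaged over time and a single entry may be as large
  as \<open>n * L\<close>.\<close>

lemma card_int_vectors_le:
  fixes L :: real and n :: nat
  assumes "L > 0"
  defines "\<S> \<equiv> {s \<in> {..<n} \<rightarrow>\<^sub>E (UNIV :: int set). (\<Sum>t<n. \<bar>real_of_int (s t)\<bar>) \<le> real n * L}"
  shows "finite \<S>" "real (card \<S>) \<le> (2 * exp 1 * (L + 1)) ^ n"
proof -
  \<comment> \<open>\<open>B\<close> serves to make the index set finite; the geometric estimate
    \<open>geo\<close> is uniform in it.\<close>
  define B where "B = nat \<lceil>real n * L\<rceil>"
  define x where "x = exp (- (1 / L))"
  let ?K = "{- int B..int B}"
  have sub: "\<S> \<subseteq> {..<n} \<rightarrow>\<^sub>E ?K"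
  proof
    fix s assume s: "s \<in> \<S>"
    have "s t \<in> ?K" if "t < n" for t
    proof -
      have "\<bar>real_of_int (s t)\<bar> \<le> (\<Sum>t<n. \<bar>real_of_int (s t)\<bar>)"
        using that by (intro member_le_sum) auto
      also have "\<dots> \<le> real n * L" using s by (simp add: \<S>_def)
      finally have "\<bar>s t\<bar> \<le> \<lceil>real n * L\<rceil>" by linarith
      moreover have "0 \<le> real n * L" using assms(1) by simp
      ultimately show ?thesis unfolding B_def by (simp add: abs_le_iff)
    qed
    then show "s \<in> {..<n} \<rightarrow>\<^sub>E ?K"
      using s by (auto simp: \<S>_def PiE_iff)
  qed
  have fin: "finite ({..<n} \<rightarrow>\<^sub>E ?K)" by (intro finite_PiE) auto
  show "finite \<S>" using sub fin by (rule finite_subset)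
  have x: "0 < x" "x < 1" using assms(1) by (auto simp: x_def)
  have "1 + 1 / L \<le> exp (1 / L)" by (rule exp_ge_add_one_self)
  then have "x \<le> 1 / (1 + 1 / L)"
    unfolding x_def exp_minus inverse_eq_divide
    using assms(1) by (intro divide_left_mono) (auto intro!: mult_pos_pos add_pos_pos)
  then have x1: "1 / (1 - x) \<le> L + 1"
    using x assms(1) by (simp add: field_simps)
  have geo: "(\<Sum>k\<in>?K. x ^ nat \<bar>k\<bar>) \<le> 2 * (L + 1)"
  proof -
    have "?K \<subseteq> int ` {..B} \<union> (\<lambda>k. - int k) ` {..B}"
    proof
      fix k assume "k \<in> ?K"
      then show "k \<in> int ` {..B} \<union> (\<lambda>k. - int k) ` {..B}"
        by (cases k rule: int_cases2) auto
    qed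
    then have "(\<Sum>k\<in>?K. x ^ nat \<bar>k\<bar>) \<le> (\<Sum>k\<in>int ` {..B} \<union> (\<lambda>k. - int k) ` {..B}. x ^ nat \<bar>k\<bar>)"
      using x by (intro sum_mono2) auto
    also have "\<dots> \<le> (\<Sum>k\<in>int ` {..B}. x ^ nat \<bar>k\<bar>) + (\<Sum>k\<in>(\<lambda>k. - int k) ` {..B}. x ^ nat \<bar>k\<bar>)"
      using x by (subst sum_Un) (auto intro!: sum_nonneg)
    also have "\<dots> = 2 * (\<Sum>k\<le>B. x ^ k)"
      by (subst (1 2) sum.reindex) (auto simp: inj_on_def)
    also have "\<dots> \<le> 2 * (1 / (1 - x))"
    proof -
      have "(\<Sum>k\<le>B. x ^ k) \<le> (\<Sum>k. x ^ k)"
        using x by (intro sum_le_suminf) (auto intro: summable_geometric)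
      also have "\<dots> = 1 / (1 - x)" using x by (intro suminf_geometric) auto
      finally show ?thesis by simp
    qed
    finally show ?thesis using x1 by simp
  qed
  have "real (card \<S>) = (\<Sum>s\<in>\<S>. 1)" by simp
  also have "\<dots> \<le> (\<Sum>s\<in>\<S>. exp 1 ^ n * (\<Prod>t<n. x ^ nat \<bar>s t\<bar>))"
  proof (rule sum_mono)
    fix s assume s: "s \<in> \<S>"
    have "(\<Prod>t<n. x ^ nat \<bar>s t\<bar>) = exp (\<Sum>t<n. - (\<bar>real_of_int (s t)\<bar> / L))"
      by (subst exp_sum) (auto simp: x_def exp_of_nat_mult[symmetric] intro!: prod.cong)
    moreover have "exp 1 ^ n = exp (real n)" by (simp add: exp_of_nat_mult[symmetric])
    moreover have "(\<Sum>t<n. - (\<bar>real_of_int (s t)\<bar> / L)) = - (\<Sum>t<n. \<bar>real_of_int (s t)\<bar>) / L"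
      by (simp add: sum_negf sum_divide_distrib)
    moreover have "(\<Sum>t<n. \<bar>real_of_int (s t)\<bar>) / L \<le> real n"
      using s assms(1) by (simp add: \<S>_def field_simps)
    ultimately show "1 \<le> exp 1 ^ n * (\<Prod>t<n. x ^ nat \<bar>s t\<bar>)"
      by (simp add: exp_add[symmetric])
  qed
  also have "\<dots> \<le> (\<Sum>s\<in>{..<n} \<rightarrow>\<^sub>E ?K. exp 1 ^ n * (\<Prod>t<n. x ^ nat \<bar>s t\<bar>))"
  proof (rule sum_mono2[OF fin sub])
    fix s show "0 \<le> exp 1 ^ n * (\<Prod>t<n. x ^ nat \<bar>s t\<bar>)"
      using x by (intro mult_nonneg_nonneg prod_nonneg) auto
  qed
  also have "\<dots> = exp 1 ^ n * (\<Prod>t<n. \<Sum>k\<in>?K. x ^ nat \<bar>k\<bar>)"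
  proof -
    have "(\<Prod>t<n. \<Sum>k\<in>?K. x ^ nat \<bar>k\<bar>) = (\<Sum>s\<in>{..<n} \<rightarrow>\<^sub>E ?K. \<Prod>t<n. x ^ nat \<bar>s t\<bar>)"
      by (rule prod_sum_PiE) auto
    then show ?thesis by (simp add: sum_distrib_left)
  qed
  also have "\<dots> = (exp 1 * (\<Sum>k\<in>?K. x ^ nat \<bar>k\<bar>)) ^ n"
    by (simp add: power_mult_distrib)
  also have "\<dots> \<le> (exp 1 * (2 * (L + 1))) ^ n"
    using x geo by (intro power_mono mult_left_mono mult_nonneg_nonneg sum_nonneg) auto
  finally show "real (card \<S>) \<le> (2 * exp 1 * (L + 1)) ^ n" by (simp add: mult_ac)
qed

text \<open>
  For a fixed message \<open>v\<close>, the set of quantized observations that lead all receivers \<open>j \<in> K\<close> to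
  decide for \<open>v\<close> is a product set, so it has at most \<open>\<Prod>j. n j v\<close> elements, where \<open>n j v\<close> counts
  the observations that receiver \<open>j\<close> alone attributes to \<open>v\<close>; the arithmetic-geometric mean
  inequality replaces the product by the sum, and \<open>\<Sum>v. n j v\<close> is at most the number of observations.
\<close>

lemma joint_decoding_bound:
  fixes q :: "'k \<Rightarrow> 'b \<Rightarrow> 's \<Rightarrow> real" and r :: "('k \<Rightarrow> 's) \<Rightarrow> 'a \<Rightarrow> real" and s :: "'a \<Rightarrow> 'b \<Rightarrow> 'k \<Rightarrow> 's"
  assumes fin: "finite U" "finite V" "finite \<S>" "finite K" and K: "K \<noteq> {}" and U: "U \<noteq> {}"
    and G: "G \<subseteq> U \<times> V" and s: "\<And>u v. (u, v) \<in> G \<Longrightarrow> s u v \<in> K \<rightarrow>\<^sub>E \<S>"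
    and q0: "\<And>j v \<sigma>. q j v \<sigma> \<ge> 0" and q1: "\<And>j \<sigma>. j \<in> K \<Longrightarrow> (\<Sum>v\<in>V. q j v \<sigma>) \<le> 1"
    and r0: "\<And>\<sigma> u. r \<sigma> u \<ge> 0" and r1: "\<And>\<sigma>. (\<Sum>u\<in>U. r \<sigma> u) \<le> 1"
  shows "(\<Sum>(u, v)\<in>G. (\<Prod>j\<in>K. q j v (s u v j)) * r (s u v) u)
     \<le> real (card U) powr (1 - 1 / real (card K)) * real (card \<S>)"
proof -
  define F where "F u v = (\<Prod>j\<in>K. q j v (s u v j)) * r (s u v) u" for u v
  define N where "N v = (\<Sum>u\<in>{u \<in> U. (u, v) \<in> G}. F u v)" for v
  define n where "n j v = (\<Sum>\<sigma>\<in>\<S>. q j v \<sigma>)" for j v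
  let ?m = "real (card K)"
  have m: "?m \<ge> 1" using fin(4) K by (simp add: Suc_le_eq card_gt_0_iff)
  have q_le: "q j v \<sigma> \<le> 1" if "j \<in> K" "v \<in> V" for j v \<sigma>
    using member_le_sum[of v V "\<lambda>v. q j v \<sigma>"] that q0 q1[of j \<sigma>] fin(2) by simp
  have r_le: "r \<sigma> u \<le> 1" if "u \<in> U" for \<sigma> u
    using member_le_sum[of u U "r \<sigma>"] that r0 r1[of \<sigma>] fin(1) by simp
  have F0: "F u v \<ge> 0" for u v by (auto simp: F_def intro!: mult_nonneg_nonneg prod_nonneg q0 r0)
  have F1: "F u v \<le> 1" if "u \<in> U" "v \<in> V" for u v
    unfolding F_def using that q_le r_le q0 r0
    by (intro mult_le_one prod_le_1) (auto intro: prod_nonneg)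
  have N0: "N v \<ge> 0" for v by (simp add: N_def sum_nonneg F0)
  have N_card: "N v \<le> real (card U)" if "v \<in> V" for v
  proof -
    have "N v \<le> (\<Sum>u\<in>{u \<in> U. (u, v) \<in> G}. 1)" unfolding N_def using F1 that by (intro sum_mono) auto
    also have "\<dots> \<le> real (card U)" using fin(1) by (auto intro!: card_mono)
    finally show ?thesis .
  qed
  have N_prod: "N v \<le> (\<Prod>j\<in>K. n j v)" for v
  proof -
    let ?A = "{u \<in> U. (u, v) \<in> G}"
    have "N v = (\<Sum>\<sigma>\<in>K \<rightarrow>\<^sub>E \<S>. \<Sum>u\<in>{u \<in> ?A. s u v = \<sigma>}. F u v)"
      unfolding N_def by (rule sum.group[symmetric]) (use fin s in \<open>auto intro!: finite_PiE\<close>)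
    also have "\<dots> \<le> (\<Sum>\<sigma>\<in>K \<rightarrow>\<^sub>E \<S>. \<Prod>j\<in>K. q j v (\<sigma> j))"
    proof (rule sum_mono)
      fix \<sigma>
      \<comment> \<open>With the whole tuple \<sigma> fixed, all \<open>u\<close> that produce it
        are weighted by the same subprobability \<open>r \<sigma>\<close>, so together they count at
        most once.\<close>
      have "(\<Sum>u\<in>{u \<in> ?A. s u v = \<sigma>}. F u v) = (\<Prod>j\<in>K. q j v (\<sigma> j)) * (\<Sum>u\<in>{u \<in> ?A. s u v = \<sigma>}. r \<sigma> u)"
        unfolding sum_distrib_left by (intro sum.cong) (auto simp: F_def)
      also have "\<dots> \<le> (\<Prod>j\<in>K. q j v (\<sigma> j)) * (\<Sum>u\<in>U. r \<sigma> u)"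
        using fin by (intro mult_left_mono sum_mono2 prod_nonneg) (auto simp: q0 r0)
      also have "\<dots> \<le> (\<Prod>j\<in>K. q j v (\<sigma> j)) * 1"
        by (intro mult_left_mono r1 prod_nonneg) (auto simp: q0)
      finally show "(\<Sum>u\<in>{u \<in> ?A. s u v = \<sigma>}. F u v) \<le> (\<Prod>j\<in>K. q j v (\<sigma> j))" by simp
    qed
    also have "\<dots> = (\<Prod>j\<in>K. n j v)"
      unfolding n_def using fin by (subst prod_sum_PiE) auto
    finally show ?thesis .
  qed
  have n0: "n j v \<ge> 0" for j v by (simp add: n_def sum_nonneg q0)
  \<comment> \<open>The two powers of \<open>N v\<close> are bounded differently: the product bound,
    made additive by the mean inequality, serves the power \<open>1 / ?m\<close>, and the trivial
    bound \<open>card U\<close> serves the rest. This is the origin of the exponent of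
    \<open>card U\<close> in the claim.\<close>
  have N_le: "N v \<le> (\<Sum>j\<in>K. n j v / ?m) * real (card U) powr (1 - 1 / ?m)" if "v \<in> V" for v
  proof -
    have "N v = N v powr (1 / ?m) * N v powr (1 - 1 / ?m)"
      using N0 by (simp add: powr_add[symmetric])
    also have "\<dots> \<le> (\<Prod>j\<in>K. n j v) powr (1 / ?m) * real (card U) powr (1 - 1 / ?m)"
      using m N0 N_prod N_card[OF that] by (intro mult_mono powr_mono2) auto
    also have "\<dots> \<le> (\<Sum>j\<in>K. n j v / ?m) * real (card U) powr (1 - 1 / ?m)"
      using arith_geom_mean[OF fin(4) K, of "\<lambda>j. n j v"] n0 by (intro mult_right_mono) auto
    finally show ?thesis .
  qed
  have "finite G" using G fin(1,2) by (meson finite_SigmaI finite_subset)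
  then have "(\<Sum>(u, v)\<in>G. F u v) = (\<Sum>v\<in>V. \<Sum>(u, v)\<in>{p \<in> G. snd p = v}. F u v)"
    by (rule sum.group[symmetric]) (use fin(2) G in auto)
  also have "\<dots> = (\<Sum>v\<in>V. N v)"
  proof (rule sum.cong)
    fix v assume "v \<in> V"
    show "(\<Sum>(u, v)\<in>{p \<in> G. snd p = v}. F u v) = N v"
      unfolding N_def
      by (rule sum.reindex_bij_witness[where i = "\<lambda>u. (u, v)" and j = fst]) (use G in auto)
  qed simp
  also have "\<dots> \<le> (\<Sum>v\<in>V. (\<Sum>j\<in>K. n j v / ?m) * real (card U) powr (1 - 1 / ?m))"
    by (intro sum_mono N_le)
  also have "\<dots> = (\<Sum>j\<in>K. \<Sum>v\<in>V. n j v) / ?m * real (card U) powr (1 - 1 / ?m)"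
    by (subst sum_distrib_right[symmetric], subst sum.swap) (simp add: sum_divide_distrib)
  also have "\<dots> \<le> (\<Sum>j\<in>K. real (card \<S>)) / ?m * real (card U) powr (1 - 1 / ?m)"
  proof (intro mult_right_mono divide_right_mono sum_mono)
    fix j assume j: "j \<in> K"
    have "(\<Sum>v\<in>V. n j v) = (\<Sum>\<sigma>\<in>\<S>. \<Sum>v\<in>V. q j v \<sigma>)" unfolding n_def by (rule sum.swap)
    also have "\<dots> \<le> (\<Sum>\<sigma>\<in>\<S>. 1)" by (intro sum_mono q1 j)
    finally show "(\<Sum>v\<in>V. n j v) \<le> real (card \<S>)" by simp
  qed auto
  also have "\<dots> = real (card U) powr (1 - 1 / ?m) * real (card \<S>)"
    using m by simp
  finally show ?thesis by (simp add: F_def)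
qed

section \<open>Receivers that see only a reference signal\<close>

text \<open>A randomized receiver that is given \<gamma> and adds its own noise of variance 2. The
  codeword influences its decision through \<gamma> alone, so there are only as many such receivers
  as there are rounded signals.\<close>

definition sim_prob :: "'m::finite code \<Rightarrow> nat \<Rightarrow> nat \<Rightarrow> (nat \<Rightarrow> real) \<Rightarrow> nat \<Rightarrow> real" where
  "sim_prob c k j \<gamma> v =
     measure (\<Pi>\<^sub>M t\<in>{..<len c}. density lborel (\<lambda>x. ennreal (normal_density (\<gamma> t) (sqrt 2) x)))
       {y \<in> space (\<Pi>\<^sub>M t\<in>{..<len c}. borel). dec c k j y = v}"

lemma sim_prob_nonneg: "sim_prob c k j \<gamma> v \<ge> 0"
  by (simp add: sim_prob_def)

lemma prob_space_PiM_normal: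
  assumes "\<And>t. \<sigma> t > 0"
  shows "prob_space (\<Pi>\<^sub>M t\<in>I. density lborel (\<lambda>x. ennreal (normal_density (\<gamma> t) (\<sigma> t) x)))"
  by (intro prob_space_PiM prob_space_normal_density assms)

lemma sum_sim_prob_le:
  assumes dec: "dec c k j \<in> (\<Pi>\<^sub>M t\<in>{..<len c}. borel) \<rightarrow>\<^sub>M count_space UNIV" and "finite V"
  shows "(\<Sum>v\<in>V. sim_prob c k j \<gamma> v) \<le> 1"
proof -
  let ?S = "\<Pi>\<^sub>M t\<in>{..<len c}. density lborel (\<lambda>x. ennreal (normal_density (\<gamma> t) (sqrt 2) x))"
  let ?D = "\<lambda>v. {y \<in> space (\<Pi>\<^sub>M t\<in>{..<len c}. (borel :: real measure)). dec c k j y = v}"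
  interpret prob_space ?S by (rule prob_space_PiM_normal) simp
  have sets: "sets ?S = sets (\<Pi>\<^sub>M t\<in>{..<len c}. (borel :: real measure))"
    by (intro sets_PiM_cong) auto
  have meas: "?D v \<in> sets ?S" for v
    unfolding sets using measurable_sets[OF dec, of "{v}"] by (simp add: vimage_def Int_def conj_commute)
  have "(\<Sum>v\<in>V. sim_prob c k j \<gamma> v) = measure ?S (\<Union>v\<in>V. ?D v)"
    unfolding sim_prob_def using assms(2) meas
    by (intro finite_measure_finite_Union[symmetric]) (auto simp: disjoint_family_on_def)
  also have "\<dots> \<le> 1" by simp
  finally show ?thesis .
qed

text \<open>The change of measure, applied to the indicator of the decision region of
  \<open>v\<close>. A success probability of one half at the true receiver leaves the simulated one
  a probability that is at worst exponentially small in the block length.\<close>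

lemma decoding_prob_le_sim_prob:
  assumes dec: "dec c k j \<in> (\<Pi>\<^sub>M t\<in>{..<len c}. borel) \<rightarrow>\<^sub>M count_space UNIV"
    and A: "\<And>t. t < len c \<Longrightarrow> \<bar>\<mu> t - \<gamma> t\<bar> \<le> A"
  shows "measure (noise (len c)) {z \<in> space (noise (len c)). dec c k j (\<lambda>t\<in>{..<len c}. \<mu> t + z t) = v}
     \<le> (sqrt 2 * exp (A\<^sup>2 / 2)) ^ len c * sim_prob c k j \<gamma> v"
proof -
  let ?n = "len c"
  let ?S = "\<Pi>\<^sub>M t\<in>{..<?n}. density lborel (\<lambda>x. ennreal (normal_density (\<gamma> t) (sqrt 2) x))"
  let ?B = "\<Pi>\<^sub>M t\<in>{..<?n}. (borel :: real measure)"
  let ?D = "{y \<in> space ?B. dec c k j y = v}"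
  let ?E = "{z \<in> space (noise ?n). dec c k j (\<lambda>t\<in>{..<?n}. \<mu> t + z t) = v}"
  interpret S: prob_space ?S by (rule prob_space_PiM_normal) simp
  interpret N: prob_space "noise ?n" unfolding noise_def by (rule prob_space_PiM_normal) simp
  have setsS: "sets ?S = sets ?B" by (intro sets_PiM_cong) auto
  have setsN: "sets (noise ?n) = sets ?B" unfolding noise_def by (intro sets_PiM_cong) auto
  have D: "?D \<in> sets ?B"
    using measurable_sets[OF dec, of "{v}"] by (simp add: vimage_def Int_def conj_commute)
  have tr: "(\<lambda>z. \<lambda>t\<in>{..<?n}. \<mu> t + z t) \<in> noise ?n \<rightarrow>\<^sub>M ?B"
    unfolding noise_def by measurable
  have E: "?E = (\<lambda>z. \<lambda>t\<in>{..<?n}. \<mu> t + z t) -` ?D \<inter> space (noise ?n)"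
    using measurable_space[OF tr] by auto
  have "emeasure (noise ?n) ?E = (\<integral>\<^sup>+z. indicator ?D (\<lambda>t\<in>{..<?n}. \<mu> t + z t) \<partial>noise ?n)"
  proof -
    have "emeasure (noise ?n) ?E = emeasure (distr (noise ?n) ?B (\<lambda>z. \<lambda>t\<in>{..<?n}. \<mu> t + z t)) ?D"
      unfolding E by (rule emeasure_distr[OF tr D, symmetric])
    also have "\<dots> = (\<integral>\<^sup>+z. indicator ?D z \<partial>distr (noise ?n) ?B (\<lambda>z. \<lambda>t\<in>{..<?n}. \<mu> t + z t))"
      using D by simp
    also have "\<dots> = (\<integral>\<^sup>+z. indicator ?D (\<lambda>t\<in>{..<?n}. \<mu> t + z t) \<partial>noise ?n)"
      using D by (intro nn_integral_distr tr) auto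
    finally show ?thesis .
  qed
  also have "\<dots> \<le> ennreal ((sqrt 2 * exp (A\<^sup>2 / 2)) ^ ?n) * (\<integral>\<^sup>+y. indicator ?D y \<partial>?S)"
    using nn_integral_PiM_gauss_translate[of "{..<?n}" "indicator ?D" \<mu> \<gamma> A] D A
    by (simp add: noise_def)
  also have "\<dots> = ennreal ((sqrt 2 * exp (A\<^sup>2 / 2)) ^ ?n) * emeasure ?S ?D"
    using D setsS by (simp add: nn_integral_indicator)
  also have "\<dots> = ennreal ((sqrt 2 * exp (A\<^sup>2 / 2)) ^ ?n * sim_prob c k j \<gamma> v)"
    by (simp add: sim_prob_def S.emeasure_eq_measure ennreal_mult)
  finally show ?thesis
    by (simp add: N.emeasure_eq_measure sim_prob_nonneg)
qed

section \<open>Message pairs and expurgation\<close>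

text \<open>Converts a pair ordered by the roles \<open>a\<close>, \<open>b\<close> into a tuple
  indexed by the users 1, 2, so that one argument covers both assignments of the roles.\<close>

definition pair_msg :: "nat \<Rightarrow> nat \<Rightarrow> nat \<Rightarrow> nat \<Rightarrow> nat" where
  "pair_msg a u v = (\<lambda>k\<in>{1..2}. if k = a then u else v)"

lemma bij_betw_pair_msg:
  assumes "{a, b} = {1, 2 :: nat}"
  shows "bij_betw (\<lambda>(u, v). pair_msg a u v) ({..<msg_count c a} \<times> {..<msg_count c b}) (messages 2 c)"
proof (rule bij_betwI[where g = "\<lambda>w. (w a, w b)"])
  have ab: "a \<noteq> b" "a \<in> {1..2}" "b \<in> {1..2}" "{1..2} = {a, b}"
    using assms by (auto simp: doubleton_eq_iff)
  show "(\<lambda>(u, v). pair_msg a u v) \<in> {..<msg_count c a} \<times> {..<msg_count c b} \<rightarrow> messages 2 c"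
    using ab by (auto simp: messages_def pair_msg_def)
  show "(\<lambda>w. (w a, w b)) \<in> messages 2 c \<rightarrow> {..<msg_count c a} \<times> {..<msg_count c b}"
    using ab by (auto simp: messages_def PiE_iff)
  show "(case (w a, w b) of (u, v) \<Rightarrow> pair_msg a u v) = w" if "w \<in> messages 2 c" for w
    using that ab by (auto simp: messages_def pair_msg_def PiE_iff extensional_def fun_eq_iff)
  show "((case p of (u, v) \<Rightarrow> pair_msg a u v) a, (case p of (u, v) \<Rightarrow> pair_msg a u v) b) = p"
    if "p \<in> {..<msg_count c a} \<times> {..<msg_count c b}" for p
    using that ab by (auto simp: pair_msg_def)
qed

lemma pair_msg_apply:
  assumes "{a, b} = {1, 2 :: nat}"
  shows "pair_msg a u v a = u" "pair_msg a u v b = v"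
  using assms by (auto simp: pair_msg_def doubleton_eq_iff)

lemma finite_messages: "finite (messages K c)"
  by (auto simp: messages_def intro!: finite_PiE)

lemma messages_nonempty: "valid_code K J c \<Longrightarrow> messages K c \<noteq> {}"
  by (auto simp: messages_def valid_code_def PiE_eq_empty_iff Suc_le_eq lessThan_empty_iff)

lemma expectation_message_dist:
  assumes "valid_code K J c"
  shows "measure_pmf.expectation (message_dist K c) f = (\<Sum>w\<in>messages K c. f w) / card (messages K c)"
  unfolding message_dist_def
  by (rule integral_pmf_of_set) (use assms in \<open>auto simp: finite_messages messages_nonempty\<close>)

lemma card_markov:
  fixes f :: "'a \<Rightarrow> real" and x y :: real
  assumes "finite W" "\<And>w. w \<in> W \<Longrightarrow> f w \<ge> 0" "(\<Sum>w\<in>W. f w) \<le> x * y * card W" "y > 0"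
  shows "real (card {w \<in> W. f w > y}) \<le> x * card W"
proof -
  have "y * card {w \<in> W. f w > y} = (\<Sum>w\<in>{w \<in> W. f w > y}. y)" by simp
  also have "\<dots> \<le> (\<Sum>w\<in>{w \<in> W. f w > y}. f w)" by (intro sum_mono) auto
  also have "\<dots> \<le> (\<Sum>w\<in>W. f w)" using assms by (intro sum_mono2) auto
  also have "\<dots> \<le> y * (x * card W)" using assms by (simp add: mult_ac)
  finally show ?thesis using \<open>y > 0\<close> by simp
qed

text \<open>Error and power are controlled only on average over the messages. Markov's inequality at
  the thresholds \<open>1 / 2\<close> and \<open>4 * P * len c\<close> discards at most the fraction
  \<open>1 / (4 * card X)\<close> for each receiver and \<open>1 / 4\<close> for the power, so at
  least half of the messages meet all requirements at once.\<close>

lemma good_messages: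
  fixes c :: "'m::finite code" and P :: real
  assumes valid: "valid_code 2 J c" and X: "finite X" "X \<subseteq> states 2 J"
    and err: "\<And>k j. (k, j) \<in> X \<Longrightarrow> error_prob 2 h c k j \<le> 1 / (8 * real (card X))"
    and pow: "avg_power 2 c \<le> P" and P: "P > 0"
  defines "G \<equiv> {w \<in> messages 2 c.
      (\<forall>(k, j)\<in>X. 1 / 2 \<le> measure (noise (len c))
          {z \<in> space (noise (len c)). dec c k j (received h c k j w z) = w k}) \<and>
      (\<Sum>t<len c. (norm (enc c w t))\<^sup>2) \<le> 4 * P * len c}"
  shows "real (card (messages 2 c)) \<le> 2 * card G"
proof -
  let ?W = "messages 2 c" and ?n = "len c"
  have n: "?n \<ge> 1" using valid by (simp add: valid_code_def)
  interpret N: prob_space "noise ?n" unfolding noise_def by (rule prob_space_PiM_normal) simp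
  define e where "e s w = measure (noise ?n)
      {z \<in> space (noise ?n). dec c (fst s) (snd s) (received h c (fst s) (snd s) w z) \<noteq> w (fst s)}" for s w
  define p where "p w = (\<Sum>t<?n. (norm (enc c w t))\<^sup>2)" for w
  have W0: "card ?W > 0" using valid by (simp add: card_gt_0_iff finite_messages messages_nonempty)
  have correct: "measure (noise ?n) {z \<in> space (noise ?n). dec c k j (received h c k j w z) = w k} = 1 - e (k, j) w"
    if "(k, j) \<in> X" for k j w
  proof -
    have dec: "dec c k j \<in> (\<Pi>\<^sub>M t\<in>{..<?n}. borel) \<rightarrow>\<^sub>M count_space UNIV"
      using valid X that by (auto simp: valid_code_def)
    have tr: "received h c k j w \<in> noise ?n \<rightarrow>\<^sub>M (\<Pi>\<^sub>M t\<in>{..<?n}. borel)"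
      unfolding noise_def received_def by measurable
    have m: "(\<lambda>z. dec c k j (received h c k j w z)) \<in> noise ?n \<rightarrow>\<^sub>M count_space UNIV"
      by (rule measurable_compose[OF tr dec])
    have "{z \<in> space (noise ?n). dec c k j (received h c k j w z) = w k} \<in> sets (noise ?n)"
      using measurable_sets[OF m, of "{w k}"] by (simp add: vimage_def Int_def conj_commute)
    from N.prob_compl[OF this] show ?thesis
      unfolding e_def by (simp add: set_diff_eq) (simp add: conj_commute cong: conj_cong)
  qed
  have bad_e: "real (card {w \<in> ?W. e s w > 1 / 2}) \<le> 1 / (4 * real (card X)) * card ?W" if "s \<in> X" for s
  proof (rule card_markov)
    obtain k j where s: "s = (k, j)" by (cases s)
    have "(\<Sum>w\<in>?W. e s w) / card ?W \<le> 1 / (8 * real (card X))"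
      using err[of k j] that by (simp add: s e_def error_prob_def expectation_message_dist[OF valid])
    then show "(\<Sum>w\<in>?W. e s w) \<le> 1 / (4 * real (card X)) * (1 / 2) * card ?W"
      using W0 by (simp add: field_simps)
  qed (auto simp: finite_messages e_def)
  have bad_p: "real (card {w \<in> ?W. p w > 4 * P * ?n}) \<le> 1 / 4 * card ?W"
  proof (rule card_markov)
    have "(\<Sum>t<?n. (\<Sum>w\<in>?W. (norm (enc c w t))\<^sup>2) / card ?W) / ?n \<le> P"
      using pow by (simp add: avg_power_def expectation_message_dist[OF valid])
    moreover have "(\<Sum>t<?n. (\<Sum>w\<in>?W. (norm (enc c w t))\<^sup>2) / card ?W) = (\<Sum>w\<in>?W. p w) / card ?W"
      unfolding p_def sum_divide_distrib[symmetric] by (subst sum.swap) simp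
    ultimately have "(\<Sum>w\<in>?W. p w) / card ?W / ?n \<le> P" by simp
    then show "(\<Sum>w\<in>?W. p w) \<le> 1 / 4 * (4 * P * ?n) * card ?W"
      using W0 n by (simp add: field_simps)
  qed (use P n in \<open>auto simp: finite_messages p_def intro!: sum_nonneg\<close>)
  have "?W \<subseteq> G \<union> {w \<in> ?W. p w > 4 * P * ?n} \<union> (\<Union>s\<in>X. {w \<in> ?W. e s w > 1 / 2})"
    using correct by (fastforce simp: G_def p_def not_le)
  then have "card ?W \<le> card (G \<union> {w \<in> ?W. p w > 4 * P * ?n} \<union> (\<Union>s\<in>X. {w \<in> ?W. e s w > 1 / 2}))"
    by (intro card_mono) (auto simp: G_def finite_messages X)
  also have "\<dots> \<le> card G + card {w \<in> ?W. p w > 4 * P * ?n} + (\<Sum>s\<in>X. card {w \<in> ?W. e s w > 1 / 2})"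
    by (intro order.trans[OF card_Un_le] add_mono card_UN_le X order.refl)
  finally have "real (card ?W) \<le> real (card G) + real (card {w \<in> ?W. p w > 4 * P * ?n}) + (\<Sum>s\<in>X. real (card {w \<in> ?W. e s w > 1 / 2}))"
    by (simp flip: of_nat_sum of_nat_add)
  also have "\<dots> \<le> card G + 1 / 4 * card ?W + (\<Sum>s\<in>X. 1 / (4 * real (card X)) * card ?W)"
    by (intro add_mono bad_p sum_mono bad_e order.refl)
  also have "\<dots> \<le> card G + 1 / 4 * card ?W + 1 / 4 * card ?W"
    by (cases "X = {}") (use X in auto)
  finally show ?thesis by simp
qed

section \<open>Size bounds for codes\<close>

text \<open>Cauchy-Schwarz over time turns the energy bound into a bound on the sum of the norms,
  which also covers codewords that spend their power in few channel uses. Rounding adds at most 1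
  per channel use.\<close>

lemma floor_signal_mem_int_vectors:
  fixes x :: "nat \<Rightarrow> 'v::real_inner" and P :: real
  assumes pow: "(\<Sum>t<n. (norm (x t))\<^sup>2) \<le> 4 * P * n" and H: "norm g \<le> H" and P: "P > 0" and n: "n \<ge> 1"
  shows "(\<lambda>t\<in>{..<n}. \<lfloor>g \<bullet> x t\<rfloor>) \<in>
     {s \<in> {..<n} \<rightarrow>\<^sub>E (UNIV :: int set). (\<Sum>t<n. \<bar>real_of_int (s t)\<bar>) \<le> real n * (2 * H * sqrt P + 1)}"
proof -
  have "(\<Sum>t<n. norm (x t))\<^sup>2 \<le> real n * (\<Sum>t<n. (norm (x t))\<^sup>2)"
    using Cauchy_Schwarz_ineq_sum[of "\<lambda>_. 1" "\<lambda>t. norm (x t)" "{..<n}"] by simp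
  also have "\<dots> \<le> real n * (4 * P * n)" using pow by (intro mult_left_mono) auto
  also have "\<dots> = (2 * sqrt P * n)\<^sup>2" using P by (simp add: power2_eq_square)
  finally have sq: "(\<Sum>t<n. norm (x t))\<^sup>2 \<le> (2 * sqrt P * n)\<^sup>2" .
  have "0 \<le> 2 * sqrt P * n" using P by simp
  with sq have l1: "(\<Sum>t<n. norm (x t)) \<le> 2 * sqrt P * n" by (rule power2_le_imp_le)
  have H0: "H \<ge> 0" using H norm_ge_zero order.trans by blast
  have "(\<Sum>t<n. \<bar>real_of_int \<lfloor>g \<bullet> x t\<rfloor>\<bar>) \<le> (\<Sum>t<n. H * norm (x t) + 1)"
  proof (rule sum_mono)
    fix t
    have "\<bar>real_of_int \<lfloor>g \<bullet> x t\<rfloor>\<bar> \<le> \<bar>g \<bullet> x t\<bar> + 1" by linarith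
    also have "\<bar>g \<bullet> x t\<bar> \<le> norm g * norm (x t)" by (rule Cauchy_Schwarz_ineq2)
    also have "\<dots> \<le> H * norm (x t)" by (intro mult_right_mono H) auto
    finally show "\<bar>real_of_int \<lfloor>g \<bullet> x t\<rfloor>\<bar> \<le> H * norm (x t) + 1" by simp
  qed
  also have "\<dots> = H * (\<Sum>t<n. norm (x t)) + n" by (simp add: sum.distrib sum_distrib_left)
  also have "\<dots> \<le> H * (2 * sqrt P * n) + n" by (intro add_mono mult_left_mono l1 H0) auto
  finally show ?thesis by (simp add: algebra_simps)
qed

text \<open>Two instances of \<open>joint_decoding_bound\<close>. In the first, the observers are
  the \<open>m\<close> states of \<open>b\<close>, and their rounded signals yield, through the
  coefficients \<alpha>, a reference signal for the receiver of \<open>a\<close>, which acts as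
  \<open>r\<close>. In the second the roles are exchanged and there is a single observer, so the
  exponent \<open>1 - 1 / 1\<close> vanishes.\<close>

lemma code_size_bounds:
  fixes c :: "'m::finite code" and h :: "nat \<times> nat \<Rightarrow> real ^ 'm" and P :: real
  assumes ab: "{a, b} = {1, 2 :: nat}" and valid: "valid_code 2 J c"
    and J: "J a \<ge> 1" and g: "inj g" "\<And>i :: 'm. g i \<in> {1..J b}"
    and \<alpha>: "h (a, 1) = (\<Sum>i\<in>UNIV. \<alpha> i *\<^sub>R h (b, g i))"
    and err: "\<And>k j. (k, j) \<in> states 2 J \<Longrightarrow> error_prob 2 h c k j \<le> 1 / (8 * real (CARD('m) + 1))"
    and pow: "avg_power 2 c \<le> P" and P: "P > 0"
    and H: "\<And>i. norm (h (b, g i)) \<le> H" "norm (h (a, 1)) \<le> H"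
    and A: "(\<Sum>i\<in>UNIV. \<bar>\<alpha> i\<bar>) \<le> A" "1 \<le> A"
  defines "C \<equiv> sqrt 2 * exp (A\<^sup>2 / 2)" and "S \<equiv> 2 * exp 1 * (2 * H * sqrt P + 2)"
  shows "real (msg_count c a) powr (1 / CARD('m)) * msg_count c b \<le> 2 * (2 * C ^ len c) ^ (CARD('m) + 1) * S ^ len c"
    and "real (msg_count c a) \<le> 4 * C ^ len c * S ^ len c"
proof -
  let ?W = "messages 2 c" and ?n = "len c" and ?m = "CARD('m)"
  have ab': "a \<noteq> b" "a \<in> {1..2}" "b \<in> {1..2}" using ab by (auto simp: doubleton_eq_iff)
  have n: "?n \<ge> 1" and ma: "msg_count c a \<ge> 1" and mb: "msg_count c b \<ge> 1"
    using valid ab' by (auto simp: valid_code_def)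
  define X where "X = insert (a, 1) ((\<lambda>i. (b, g i)) ` UNIV)"
  have XS: "X \<subseteq> states 2 J" using ab' J g by (auto simp: X_def states_def)
  have cX: "card X = ?m + 1"
    using g(1) ab'(1) by (auto simp: X_def card_insert_if card_image inj_on_def)
  define G where "G = {w \<in> ?W.
      (\<forall>(k, j)\<in>X. 1 / 2 \<le> measure (noise ?n)
          {z \<in> space (noise ?n). dec c k j (received h c k j w z) = w k}) \<and>
      (\<Sum>t<?n. (norm (enc c w t))\<^sup>2) \<le> 4 * P * ?n}"
  have G_card: "real (card ?W) \<le> 2 * card G"
    unfolding G_def
    by (rule good_messages[OF valid _ XS _ pow P]) (use err XS cX in \<open>auto simp: X_def\<close>)
  let ?U = "{..<msg_count c a}" and ?V = "{..<msg_count c b}"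
  define \<G> where "\<G> = {(u, v) \<in> ?U \<times> ?V. pair_msg a u v \<in> G}"
  note bij = bij_betw_pair_msg[OF ab, of c]
  have "bij_betw (\<lambda>(u, v). pair_msg a u v) \<G> G"
  proof (rule bij_betw_subset[OF bij])
    show "(\<lambda>(u, v). pair_msg a u v) ` \<G> = G"
    proof -
      have "(\<lambda>(u, v). pair_msg a u v) ` \<G> = ((\<lambda>(u, v). pair_msg a u v) ` (?U \<times> ?V)) \<inter> G"
        by (auto simp: \<G>_def)
      also have "\<dots> = ?W \<inter> G" by (simp only: bij_betw_imp_surj_on[OF bij])
      also have "\<dots> = G" by (auto simp: G_def)
      finally show ?thesis .
    qed
  qed (auto simp: \<G>_def)
  then have card_\<G>: "card \<G> = card G" by (rule bij_betw_same_card)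
  have card_W: "card ?W = msg_count c a * msg_count c b"
    using bij_betw_same_card[OF bij] by simp
  define L where "L = 2 * H * sqrt P + 1"
  have H0: "H \<ge> 0" using H(2) norm_ge_zero order.trans by blast
  have L: "L > 0" using H0 P by (auto simp: L_def intro!: add_nonneg_pos mult_nonneg_nonneg)
  define \<S> where "\<S> = {s \<in> {..<?n} \<rightarrow>\<^sub>E (UNIV :: int set). (\<Sum>t<?n. \<bar>real_of_int (s t)\<bar>) \<le> real ?n * L}"
  have fin_\<S>: "finite \<S>" and card_\<S>: "real (card \<S>) \<le> S ^ ?n"
    using card_int_vectors_le[OF L, of ?n] by (auto simp: \<S>_def S_def L_def algebra_simps)
  have C0: "C > 0" by (simp add: C_def)
  have dec: "dec c k j \<in> (\<Pi>\<^sub>M t\<in>{..<?n}. borel) \<rightarrow>\<^sub>M count_space UNIV" if "(k, j) \<in> X" for k j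
    using valid XS that by (auto simp: valid_code_def)
  have sim: "1 / (2 * C ^ ?n) \<le> sim_prob c k j \<gamma> (w k)"
    if "w \<in> G" "(k, j) \<in> X" "\<And>t. t < ?n \<Longrightarrow> \<bar>h (k, j) \<bullet> enc c w t - \<gamma> t\<bar> \<le> A" for w k j \<gamma>
  proof -
    have "1 / 2 \<le> measure (noise ?n) {z \<in> space (noise ?n). dec c k j (received h c k j w z) = w k}"
      using that by (auto simp: G_def)
    also have "\<dots> \<le> C ^ ?n * sim_prob c k j \<gamma> (w k)"
      unfolding C_def received_def by (rule decoding_prob_le_sim_prob[OF dec]) (use that in auto)
    finally show ?thesis using C0 by (simp add: field_simps)
  qed
  define s where "s u v i = (\<lambda>t\<in>{..<?n}. \<lfloor>h (b, g i) \<bullet> enc c (pair_msg a u v) t\<rfloor>)" for u v and i :: 'm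
  define s' where "s' u v = (\<lambda>t\<in>{..<?n}. \<lfloor>h (a, 1) \<bullet> enc c (pair_msg a u v) t\<rfloor>)" for u v
  have s: "s u v i \<in> \<S>" if "(u, v) \<in> \<G>" for u v i
    unfolding s_def \<S>_def L_def
    by (rule floor_signal_mem_int_vectors[OF _ H(1) P n]) (use that in \<open>auto simp: \<G>_def G_def\<close>)
  have s': "s' u v \<in> \<S>" if "(u, v) \<in> \<G>" for u v
    unfolding s'_def \<S>_def L_def
    by (rule floor_signal_mem_int_vectors[OF _ H(2) P n]) (use that in \<open>auto simp: \<G>_def G_def\<close>)
  note app = pair_msg_apply[OF ab]

  define q where "q i v \<sigma> = sim_prob c b (g i) (\<lambda>t. real_of_int (\<sigma> t)) v" for i v \<sigma>
  \<comment> \<open>The signal of \<open>a\<close> is reconstructed from rounded signals of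
    \<open>b\<close>; each rounding error is amplified by \<open>\<alpha> i\<close>, which is why
    \<open>A\<close> has to dominate the sum of the \<open>\<bar>\<alpha> i\<bar>\<close>.\<close>
  define r where "r \<sigma> u = sim_prob c a 1 (\<lambda>t. \<Sum>i\<in>UNIV. \<alpha> i * real_of_int (\<sigma> i t)) u" for \<sigma> u
  have "card \<G> * (1 / (2 * C ^ ?n)) ^ (?m + 1) = (\<Sum>(u, v)\<in>\<G>. (\<Prod>i\<in>(UNIV :: 'm set). 1 / (2 * C ^ ?n)) * (1 / (2 * C ^ ?n)))"
    by (simp add: case_prod_beta)
  also have "\<dots> \<le> (\<Sum>(u, v)\<in>\<G>. (\<Prod>i\<in>UNIV. q i v (s u v i)) * r (s u v) u)"
  proof (rule sum_mono, clarsimp simp del: prod_constant)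
    fix u v assume uv: "(u, v) \<in> \<G>"
    then have w: "pair_msg a u v \<in> G" by (simp add: \<G>_def)
    have q: "1 / (2 * C ^ ?n) \<le> q i v (s u v i)" for i
    proof -
      have "1 / (2 * C ^ ?n) \<le> q i (pair_msg a u v b) (s u v i)"
        unfolding q_def
      proof (rule sim[OF w])
        fix t assume "t < ?n"
        then have "\<bar>h (b, g i) \<bullet> enc c (pair_msg a u v) t - real_of_int (s u v i t)\<bar> \<le> 1"
          unfolding s_def by simp linarith
        then show "\<bar>h (b, g i) \<bullet> enc c (pair_msg a u v) t - real_of_int (s u v i t)\<bar> \<le> A"
          using A by linarith
      qed (simp add: X_def)
      then show ?thesis by (simp add: app)
    qed
    have r: "1 / (2 * C ^ ?n) \<le> r (s u v) u"
    proof -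
      have "1 / (2 * C ^ ?n) \<le> r (s u v) (pair_msg a u v a)"
        unfolding r_def
      proof (rule sim[OF w])
        fix t assume t: "t < ?n"
        let ?x = "enc c (pair_msg a u v) t"
        have "h (a, 1) \<bullet> ?x - (\<Sum>i\<in>UNIV. \<alpha> i * real_of_int (s u v i t))
            = (\<Sum>i\<in>UNIV. \<alpha> i * (h (b, g i) \<bullet> ?x - real_of_int (s u v i t)))"
          unfolding \<alpha> by (simp add: inner_sum_left sum_subtractf algebra_simps)
        also have "\<bar>\<dots>\<bar> \<le> (\<Sum>i\<in>UNIV. \<bar>\<alpha> i\<bar> * 1)"
        proof (rule order.trans[OF sum_abs sum_mono])
          fix i
          have "\<bar>h (b, g i) \<bullet> ?x - real_of_int (s u v i t)\<bar> \<le> 1"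
            using t unfolding s_def by simp linarith
          then show "\<bar>\<alpha> i * (h (b, g i) \<bullet> ?x - real_of_int (s u v i t))\<bar> \<le> \<bar>\<alpha> i\<bar> * 1"
            unfolding abs_mult by (rule mult_left_mono) simp
        qed
        finally show "\<bar>h (a, 1) \<bullet> ?x - (\<Sum>i\<in>UNIV. \<alpha> i * real_of_int (s u v i t))\<bar> \<le> A"
          using A by simp
      qed (simp add: X_def)
      then show ?thesis by (simp add: app)
    qed
    have "0 \<le> 1 / (2 * C ^ ?n)" using C0 by simp
    then show "(\<Prod>i\<in>(UNIV :: 'm set). 1 / (2 * C ^ ?n)) / (2 * C ^ ?n) \<le> (\<Prod>i\<in>UNIV. q i v (s u v i)) * r (s u v) u"
      using mult_mono[OF prod_mono[of UNIV "\<lambda>_. 1 / (2 * C ^ ?n)" "\<lambda>i. q i v (s u v i)"] r] q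
      by (simp add: prod_nonneg q_def sim_prob_nonneg)
  qed
  also have "\<dots> \<le> real (card ?U) powr (1 - 1 / real (card (UNIV :: 'm set))) * real (card \<S>)"
  proof (rule joint_decoding_bound)
    show "(\<Sum>v\<in>?V. q j v \<sigma>) \<le> 1" for j \<sigma>
      unfolding q_def by (rule sum_sim_prob_le[OF dec]) (auto simp: X_def)
    show "(\<Sum>u\<in>?U. r \<sigma> u) \<le> 1" for \<sigma>
      unfolding r_def by (rule sum_sim_prob_le[OF dec]) (auto simp: X_def)
  qed (use fin_\<S> ma s in \<open>auto simp: \<G>_def q_def r_def sim_prob_nonneg lessThan_empty_iff\<close>)
  also have "\<dots> \<le> real (msg_count c a) powr (1 - 1 / ?m) * S ^ ?n"
    using card_\<S> by (simp add: mult_left_mono)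
  finally have "card \<G> * (1 / (2 * C ^ ?n)) ^ (?m + 1) \<le> real (msg_count c a) powr (1 - 1 / ?m) * S ^ ?n" .
  then have "card \<G> \<le> real (msg_count c a) powr (1 - 1 / ?m) * S ^ ?n * (2 * C ^ ?n) ^ (?m + 1)"
    using C0 by (simp add: power_divide field_simps)
  then have "real (msg_count c a * msg_count c b) \<le> real (msg_count c a) powr (1 - 1 / ?m) * (2 * (2 * C ^ ?n) ^ (?m + 1) * S ^ ?n)"
    using G_card unfolding card_\<G> card_W by (simp only: of_nat_mult of_nat_numeral mult_ac)
  moreover have "real (msg_count c a * msg_count c b) =
      real (msg_count c a) powr (1 - 1 / ?m) * (real (msg_count c a) powr (1 / ?m) * msg_count c b)"
    using ma by (simp add: mult.assoc[symmetric] powr_add[symmetric])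
  ultimately show "real (msg_count c a) powr (1 / ?m) * msg_count c b \<le> 2 * (2 * C ^ ?n) ^ (?m + 1) * S ^ ?n"
    using ma by (simp only: mult_le_cancel_left_pos powr_gt_zero)

  \<comment> \<open>Here \<open>a\<close> is decoded from its own rounded signal; the uniform guess
    \<open>1 / msg_count c b\<close> of the message of \<open>b\<close> takes the place of
    \<open>r\<close>.\<close>
  define q' where "q' u \<sigma> = sim_prob c a 1 (\<lambda>t. real_of_int (\<sigma> t)) u" for u \<sigma>
  have "card \<G> * (1 / (2 * C ^ ?n)) / msg_count c b = (\<Sum>(v, u)\<in>prod.swap ` \<G>. 1 / (2 * C ^ ?n) * (1 / msg_count c b))"
    by (simp add: case_prod_beta card_image)
  also have "\<dots> \<le> (\<Sum>(v, u)\<in>prod.swap ` \<G>. (\<Prod>i\<in>{()}. q' u (s' u v)) * (1 / msg_count c b))"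
  proof (rule sum_mono)
    fix p assume "p \<in> prod.swap ` \<G>"
    then obtain u v where p: "p = (v, u)" and uv: "(u, v) \<in> \<G>" by auto
    then have w: "pair_msg a u v \<in> G" by (simp add: \<G>_def)
    have "1 / (2 * C ^ ?n) \<le> q' (pair_msg a u v a) (s' u v)"
      unfolding q'_def
    proof (rule sim[OF w])
      fix t assume "t < ?n"
      then have "\<bar>h (a, 1) \<bullet> enc c (pair_msg a u v) t - real_of_int (s' u v t)\<bar> \<le> 1"
        unfolding s'_def by simp linarith
      then show "\<bar>h (a, 1) \<bullet> enc c (pair_msg a u v) t - real_of_int (s' u v t)\<bar> \<le> A"
        using A by linarith
    qed (simp add: X_def)
    then have "1 / (2 * C ^ ?n) \<le> q' u (s' u v)" by (simp add: app)
    then have "1 / (2 * C ^ ?n) * (1 / msg_count c b) \<le> q' u (s' u v) * (1 / msg_count c b)"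
      by (rule mult_right_mono) simp
    then show "(case p of (v, u) \<Rightarrow> 1 / (2 * C ^ ?n) * (1 / msg_count c b))
        \<le> (case p of (v, u) \<Rightarrow> (\<Prod>i\<in>{()}. q' u (s' u v)) * (1 / msg_count c b))"
      unfolding p by simp
  qed
  also have "\<dots> = (\<Sum>(v, u)\<in>prod.swap ` \<G>. (\<Prod>i\<in>{()}. q' u ((\<lambda>i\<in>{()}. s' u v) i)) * (1 / msg_count c b))"
    by simp
  also have "\<dots> \<le> real (card ?V) powr (1 - 1 / real (card {()})) * real (card \<S>)"
  proof (rule joint_decoding_bound[where s = "\<lambda>v u. \<lambda>i\<in>{()}. s' u v" and q = "\<lambda>_. q'" and V = ?U])
    show "(\<Sum>u\<in>?U. q' u \<sigma>) \<le> 1" for \<sigma>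
      unfolding q'_def by (rule sum_sim_prob_le[OF dec]) (auto simp: X_def)
  qed (use fin_\<S> mb s' in \<open>auto simp: \<G>_def q'_def sim_prob_nonneg lessThan_empty_iff\<close>)
  also have "\<dots> \<le> S ^ ?n" using mb card_\<S> by simp
  finally have "card \<G> \<le> 2 * C ^ ?n * S ^ ?n * msg_count c b"
    using C0 mb by (simp add: field_simps)
  then have "real (msg_count c a) * msg_count c b \<le> 4 * C ^ ?n * S ^ ?n * msg_count c b"
    using G_card card_\<G> card_W by simp
  then show "real (msg_count c a) \<le> 4 * C ^ ?n * S ^ ?n"
    using mb by simp
qed

text \<open>All factors except \<open>S\<close> are bounded by constants to the power of the block
  length, so logarithms divided by the length turn them into one constant valid for all
  \<open>P\<close> and all codes. Adding \<open>1 - 1 / ?m\<close> times the bound on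
  \<open>x\<close> lifts the coefficient of \<open>x\<close> from \<open>1 / ?m\<close> to
  1.\<close>

lemma rate_sum_bound:
  fixes h :: "nat \<times> nat \<Rightarrow> real ^ 'm::finite"
  assumes ab: "{a, b} = {1, 2 :: nat}" and m2: "CARD('m) \<ge> 2"
    and J: "J a \<ge> 1" and g: "inj g" "\<And>i :: 'm. g i \<in> {1..J b}"
    and \<alpha>: "h (a, 1) = (\<Sum>i\<in>UNIV. \<alpha> i *\<^sub>R h (b, g i))"
  shows "\<exists>C. \<forall>P\<ge>1. \<forall>R. achievable 2 J h P R \<longrightarrow>
     R 1 + R 2 \<le> (1 + (real CARD('m) - 1) / CARD('m)) * (1 / 2 * log 2 P) + C"
proof -
  let ?m = "real CARD('m)"
  define H where "H = norm (h (a, 1)) + (\<Sum>i\<in>UNIV. norm (h (b, g i)))"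
  define A where "A = 1 + (\<Sum>i\<in>UNIV. \<bar>\<alpha> i\<bar>)"
  define C where "C = sqrt 2 * exp (A\<^sup>2 / 2)"
  define s where "s = log 2 (4 * exp 1 * (H + 1))"
  define D where "D = ?m + 4 + (?m + 2) * log 2 C + 2 * s"
  have H: "norm (h (b, g i)) \<le> H" "norm (h (a, 1)) \<le> H" for i
  proof -
    have "norm (h (b, g i)) \<le> (\<Sum>i\<in>UNIV. norm (h (b, g i)))" by (rule member_le_sum) auto
    then show "norm (h (b, g i)) \<le> H" by (simp add: H_def add_increasing)
    show "norm (h (a, 1)) \<le> H" by (simp add: H_def sum_nonneg)
  qed
  have H0: "H \<ge> 0" using H(2) norm_ge_zero order.trans by blast
  have A: "(\<Sum>i\<in>UNIV. \<bar>\<alpha> i\<bar>) \<le> A" "1 \<le> A" by (auto simp: A_def sum_nonneg)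
  have C1: "1 \<le> C"
    unfolding C_def by (rule order.trans[OF _ mult_mono[of 1 "sqrt 2" 1 "exp (A\<^sup>2 / 2)"]]) auto
  then have lC: "log 2 C \<ge> 0" by simp
  have "exp 1 \<ge> (1 :: real)" by simp
  then have "1 \<le> 4 * exp (1 :: real)" by linarith
  then have "1 * 1 \<le> 4 * exp 1 * (H + 1)" using H0 by (intro mult_mono) auto
  then have s0: "s \<ge> 0" unfolding s_def by (subst zero_le_log_cancel_iff) auto
  have m: "?m \<ge> 2" using m2 by simp
  have sum_ab: "R 1 + R 2 = R a + R b" for R :: "nat \<Rightarrow> real"
    using ab by (auto simp: doubleton_eq_iff)
  have "R 1 + R 2 \<le> (1 + (?m - 1) / ?m) * (1 / 2 * log 2 P) + D"
    if P: "P \<ge> 1" and R: "achievable 2 J h P R" for P R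
  proof -
    \<comment> \<open>The error level at which expurgation works for \<open>m + 1\<close> receivers:
      \<open>m\<close> states of \<open>b\<close> and one of \<open>a\<close>.\<close>
    have "1 / (8 * real (CARD('m) + 1)) > 0" by simp
    then obtain c :: "'m code" where valid: "valid_code 2 J c" and pow: "avg_power 2 c \<le> P"
      and rate: "\<forall>k\<in>{1..2}. log 2 (real (msg_count c k)) / real (len c) \<ge> R k"
      and err: "\<forall>(k, j)\<in>states 2 J. error_prob 2 h c k j \<le> 1 / (8 * real (CARD('m) + 1))"
      using R unfolding achievable_def by meson
    let ?n = "real (len c)"
    define S where "S = 2 * exp 1 * (2 * H * sqrt P + 2)"
    define x where "x = log 2 (real (msg_count c a)) / ?n"
    define y where "y = log 2 (real (msg_count c b)) / ?n"
    have k: "a \<in> {1..2}" "b \<in> {1..2}" using ab by (auto simp: doubleton_eq_iff)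
    have n: "?n \<ge> 1" and ma: "real (msg_count c a) \<ge> 1" and mb: "real (msg_count c b) \<ge> 1"
      using valid k by (auto simp: valid_code_def)
    have Rx: "R a \<le> x" and Ry: "R b \<le> y" using rate k by (auto simp: x_def y_def)
    have P0: "P > 0" using P by simp
    note bounds = code_size_bounds[OF ab valid J g \<alpha> _ pow P0 H A, folded C_def S_def]
    have b1: "real (msg_count c a) powr (1 / ?m) * msg_count c b \<le> 2 * (2 * C ^ len c) ^ (CARD('m) + 1) * S ^ len c"
      by (rule bounds(1)) (use err in auto)
    have b2: "real (msg_count c a) \<le> 4 * C ^ len c * S ^ len c"
      by (rule bounds(2)) (use err in auto)
    have S0: "S > 0" using H0 P0 by (auto simp: S_def intro!: mult_pos_pos add_nonneg_pos)
    have lS: "log 2 S \<le> s + 1 / 2 * log 2 P"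
    proof -
      have "sqrt P \<ge> 1" using P by simp
      then have "2 * H * sqrt P + 2 \<le> (2 * H + 2) * sqrt P" by (simp add: algebra_simps)
      then have "S \<le> 2 * exp 1 * ((2 * H + 2) * sqrt P)"
        unfolding S_def by (intro mult_left_mono) auto
      also have "\<dots> = 4 * exp 1 * (H + 1) * sqrt P" by (simp add: algebra_simps)
      finally have "log 2 S \<le> log 2 (4 * exp 1 * (H + 1) * sqrt P)"
        using S0 by (simp only: log_le_cancel_iff less_le_trans one_less_numeral_iff semiring_norm)
      also have "\<dots> = s + log 2 (sqrt P)"
        unfolding s_def using H0 P0 by (intro log_mult_pos) auto
      also have "log 2 (sqrt P) = 1 / 2 * log 2 P"
        using P0 by (simp add: powr_half_sqrt[symmetric] log_powr)
      finally show ?thesis .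
    qed
    have "log 2 (real (msg_count c a)) \<le> log 2 (4 * C ^ len c * S ^ len c)"
      using b2 ma by simp
    also have "\<dots> = 2 + ?n * log 2 C + ?n * log 2 S"
      using C1 S0 log_pow_cancel[of 2 2] by (simp add: log_mult_pos log_nat_power)
    finally have "x \<le> (2 + ?n * log 2 C + ?n * log 2 S) / ?n"
      unfolding x_def by (rule divide_right_mono) simp
    also have "\<dots> = 2 / ?n + log 2 C + log 2 S" using n by (simp add: add_divide_distrib)
    also have "\<dots> \<le> 2 + log 2 C + log 2 S" using n by (simp add: field_simps)
    finally have x: "x \<le> 2 + log 2 C + s + 1 / 2 * log 2 P" using lS by simp
    have "1 / ?m * log 2 (real (msg_count c a)) + log 2 (real (msg_count c b))
        = log 2 (real (msg_count c a) powr (1 / ?m) * msg_count c b)"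
      using ma mb by (simp add: log_mult_pos log_powr)
    also have "\<dots> \<le> log 2 (2 * (2 * C ^ len c) ^ (CARD('m) + 1) * S ^ len c)"
      using b1 ma mb by (subst log_le_cancel_iff) (auto intro!: mult_pos_pos simp: C1 S0 less_le_trans[OF _ C1])
    also have "\<dots> = 1 + (?m + 1) * (1 + ?n * log 2 C) + ?n * log 2 S"
      using C1 S0 by (simp add: log_mult_pos log_nat_power algebra_simps del: power_Suc)
    finally have "(1 / ?m * log 2 (real (msg_count c a)) + log 2 (real (msg_count c b))) / ?n
        \<le> (1 + (?m + 1) * (1 + ?n * log 2 C) + ?n * log 2 S) / ?n"
      by (rule divide_right_mono) simp
    then have "1 / ?m * x + y \<le> (1 + (?m + 1) * (1 + ?n * log 2 C) + ?n * log 2 S) / ?n"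
      by (simp add: x_def y_def add_divide_distrib)
    also have "\<dots> = (?m + 2) / ?n + (?m + 1) * log 2 C + log 2 S"
      using n by (simp add: field_simps)
    also have "(?m + 2) / ?n \<le> ?m + 2" using n m divide_left_mono[OF n, of "?m + 2"] by simp
    finally have y: "1 / ?m * x + y \<le> (?m + 2) + (?m + 1) * log 2 C + s + 1 / 2 * log 2 P" using lS by simp
    have "(1 - 1 / ?m) * x \<le> (1 - 1 / ?m) * (2 + log 2 C + s + 1 / 2 * log 2 P)"
      using m by (intro mult_left_mono x) simp
    also have "\<dots> = (1 - 1 / ?m) * (2 + log 2 C + s) + (1 - 1 / ?m) * (1 / 2 * log 2 P)"
      by (simp add: distrib_left)
    also have "(1 - 1 / ?m) * (2 + log 2 C + s) \<le> 1 * (2 + log 2 C + s)"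
      using lC s0 by (intro mult_right_mono) auto
    finally have xx: "(1 - 1 / ?m) * x \<le> 2 + log 2 C + s + (1 - 1 / ?m) * (1 / 2 * log 2 P)" by simp
    have "R 1 + R 2 \<le> x + y" using sum_ab[of R] Rx Ry by simp
    also have "\<dots> = (1 / ?m * x + y) + (1 - 1 / ?m) * x" by (simp add: algebra_simps)
    also have "\<dots> \<le> (?m + 2) + (?m + 1) * log 2 C + s + 1 / 2 * log 2 P + (2 + log 2 C + s + (1 - 1 / ?m) * (1 / 2 * log 2 P))"
      by (rule add_mono[OF y xx])
    also have "\<dots> = (1 + (?m - 1) / ?m) * (1 / 2 * log 2 P) + D"
      using m by (simp add: D_def diff_divide_distrib distrib_right algebra_simps)
    finally show ?thesis .
  qed
  then show ?thesis by blast
qed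

subsection \<open>Coding over a constellation\<close>

text \<open>A word of the ball is determined by a set \<open>T\<close> of at most \<open>D\<close>
  positions outside which it agrees with \<open>x\<close>, and by its entries on \<open>T\<close>.
  The crude factor \<open>2 ^ n\<close> for the choice of \<open>T\<close> will cost one bit per
  channel use, whatever the alphabet.\<close>

lemma card_hamming_ball_le:
  assumes "finite A" "A \<noteq> {}"
  shows "card {y \<in> {..<n} \<rightarrow>\<^sub>E A. card {t. t < n \<and> x t \<noteq> y t} \<le> D} \<le> 2 ^ n * card A ^ D"
proof -
  let ?T = "{T. T \<subseteq> {..<n} \<and> card T \<le> D}"
  let ?B = "\<lambda>T. {y \<in> {..<n} \<rightarrow>\<^sub>E A. \<forall>t\<in>{..<n} - T. y t = x t}"
  have finX: "finite ({..<n} \<rightarrow>\<^sub>E A)" using assms by (intro finite_PiE) auto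
  have q: "card A \<ge> 1" using assms by (simp add: Suc_le_eq card_gt_0_iff)
  have B: "card (?B T) \<le> card A ^ D" if T: "T \<in> ?T" for T
  proof -
    have "inj_on (\<lambda>y. restrict y T) (?B T)"
    proof (rule inj_onI)
      fix y y' assume y: "y \<in> ?B T" and y': "y' \<in> ?B T" and eq: "restrict y T = restrict y' T"
      show "y = y'"
      proof (rule PiE_ext[of y "{..<n}" "\<lambda>_. A" y'])
        show "y \<in> {..<n} \<rightarrow>\<^sub>E A" "y' \<in> {..<n} \<rightarrow>\<^sub>E A" using y y' by simp_all
        fix t assume "t \<in> {..<n}"
        then show "y t = y' t"
          using y y' fun_cong[OF eq, of t] by (cases "t \<in> T") auto
      qed
    qed
    moreover have "(\<lambda>y. restrict y T) ` ?B T \<subseteq> T \<rightarrow>\<^sub>E A" using T by (auto simp: PiE_iff)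
    moreover have "finite T" using T finite_subset by blast
    moreover have "finite (T \<rightarrow>\<^sub>E A)" using \<open>finite T\<close> assms by (intro finite_PiE) auto
    ultimately have "card (?B T) \<le> card (T \<rightarrow>\<^sub>E A)" by (meson card_inj_on_le)
    also have "\<dots> = card A ^ card T" using \<open>finite T\<close> by (simp add: card_PiE)
    also have "\<dots> \<le> card A ^ D" using T q by (intro power_increasing) auto
    finally show ?thesis .
  qed
  have "{y \<in> {..<n} \<rightarrow>\<^sub>E A. card {t. t < n \<and> x t \<noteq> y t} \<le> D} \<subseteq> (\<Union>T\<in>?T. ?B T)"
  proof
    fix y assume y: "y \<in> {y \<in> {..<n} \<rightarrow>\<^sub>E A. card {t. t < n \<and> x t \<noteq> y t} \<le> D}"
    show "y \<in> (\<Union>T\<in>?T. ?B T)"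
      by (rule UN_I[where a = "{t. t < n \<and> x t \<noteq> y t}"]) (use y in auto)
  qed
  then have "card {y \<in> {..<n} \<rightarrow>\<^sub>E A. card {t. t < n \<and> x t \<noteq> y t} \<le> D} \<le> card (\<Union>T\<in>?T. ?B T)"
    by (intro card_mono finite_subset[OF _ finX]) auto
  also have "\<dots> \<le> (\<Sum>T\<in>?T. card (?B T))" by (intro card_UN_le) auto
  also have "\<dots> \<le> (\<Sum>T\<in>?T. card A ^ D)" by (intro sum_mono B)
  also have "\<dots> \<le> 2 ^ n * card A ^ D"
  proof -
    have "card ?T \<le> card (Pow {..<n})" by (intro card_mono) auto
    then show ?thesis by (simp add: card_Pow)
  qed
  finally show ?thesis .
qed

text \<open>To a code that is maximal for inclusion no word can be added, so the balls of radius
  \<open>D\<close> around its words cover the whole space.\<close>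

lemma gilbert_varshamov:
  assumes "finite A" "A \<noteq> {}"
  obtains C where "C \<subseteq> {..<n} \<rightarrow>\<^sub>E A" "C \<noteq> {}"
    "\<And>x y. x \<in> C \<Longrightarrow> y \<in> C \<Longrightarrow> card {t. t < n \<and> x t \<noteq> y t} \<le> D \<Longrightarrow> x = y"
    "card A ^ n \<le> card C * (2 ^ n * card A ^ D)"
proof -
  let ?X = "{..<n} \<rightarrow>\<^sub>E A"
  let ?dist = "\<lambda>x y. card {t. t < n \<and> x t \<noteq> y t}"
  define \<C> where "\<C> = {C. C \<subseteq> ?X \<and> (\<forall>x\<in>C. \<forall>y\<in>C. ?dist x y \<le> D \<longrightarrow> x = y)}"
  have finX: "finite ?X" using assms by (intro finite_PiE) auto
  have "finite \<C>" by (rule finite_subset[of _ "Pow ?X"]) (auto simp: \<C>_def finX)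
  moreover have "{} \<in> \<C>" by (simp add: \<C>_def)
  ultimately obtain C where C: "C \<in> \<C>" and max: "\<And>C'. C' \<in> \<C> \<Longrightarrow> C \<subseteq> C' \<Longrightarrow> C = C'"
    using finite_has_maximal[of \<C>] by blast
  have cover: "?X \<subseteq> (\<Union>x\<in>C. {y \<in> ?X. ?dist x y \<le> D})"
  proof
    fix y assume y: "y \<in> ?X"
    have sym: "?dist u v = ?dist v u" for u v by (simp add: eq_commute[of "u _"])
    show "y \<in> (\<Union>x\<in>C. {y \<in> ?X. ?dist x y \<le> D})"
    proof (cases "y \<in> C")
      case True
      then show ?thesis using y by (intro UN_I[of y]) auto
    next
      case False
      then have "insert y C \<notin> \<C>" using max[of "insert y C"] by blast
      moreover have "insert y C \<subseteq> ?X" using C y by (simp add: \<C>_def)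
      ultimately obtain u v where uv: "u \<in> insert y C" "v \<in> insert y C" "?dist u v \<le> D" "u \<noteq> v"
        unfolding \<C>_def by blast
      moreover have "\<not> (u \<in> C \<and> v \<in> C)" using C uv(3,4) unfolding \<C>_def by blast
      ultimately obtain x where "x \<in> C" "?dist x y \<le> D"
        using sym[of u v] by (cases "u = y") auto
      then show ?thesis using y by auto
    qed
  qed
  have finC: "finite C" using C finX by (auto simp: \<C>_def intro: finite_subset)
  have "card A ^ n = card ?X" by (simp add: card_PiE)
  also have "\<dots> \<le> card (\<Union>x\<in>C. {y \<in> ?X. ?dist x y \<le> D})"
    by (intro card_mono cover) (auto simp: finC finX)
  also have "\<dots> \<le> (\<Sum>x\<in>C. card {y \<in> ?X. ?dist x y \<le> D})" by (intro card_UN_le finC)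
  also have "\<dots> \<le> (\<Sum>x\<in>C. 2 ^ n * card A ^ D)" by (intro sum_mono card_hamming_ball_le assms)
  finally have size: "card A ^ n \<le> card C * (2 ^ n * card A ^ D)" by simp
  have "C \<noteq> {}"
  proof
    assume "C = {}"
    with cover have "?X = {}" by auto
    with assms show False by (simp add: PiE_eq_empty_iff)
  qed
  with C size show ?thesis by (intro that[of C]) (auto simp: \<C>_def)
qed

section \<open>Noise outliers and concatenation\<close>

abbreviation std_gauss :: "real measure" where
  "std_gauss \<equiv> density lborel (\<lambda>x. ennreal (std_normal_density x))"

lemma std_gauss_tail:
  assumes "\<tau> > 0"
  obtains d :: real where "d > 0" "measure std_gauss {z. \<bar>z\<bar> \<ge> d / 2} \<le> \<tau>"
proof -
  interpret prob_space std_gauss by (rule prob_space_normal_density) simp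
  have "(\<lambda>i. measure std_gauss {z. \<bar>z\<bar> \<ge> real i}) \<longlonglongrightarrow> measure std_gauss (\<Inter>i. {z. \<bar>z\<bar> \<ge> real i})"
    by (rule finite_Lim_measure_decseq) (auto simp: decseq_def)
  moreover have "(\<Inter>i. {z :: real. \<bar>z\<bar> \<ge> real i}) = {}"
  proof -
    have "\<exists>i. \<not> real i \<le> \<bar>x\<bar>" for x :: real using reals_Archimedean2[of "\<bar>x\<bar>"] by (auto simp: not_le)
    then show ?thesis by blast
  qed
  ultimately have "(\<lambda>i. measure std_gauss {z. \<bar>z\<bar> \<ge> real i}) \<longlonglongrightarrow> 0" by simp
  then have "eventually (\<lambda>i. measure std_gauss {z. \<bar>z\<bar> \<ge> real i} < \<tau>) sequentially"
    using assms by (rule order_tendstoD)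
  then obtain i where i: "i > 0" "measure std_gauss {z. \<bar>z\<bar> \<ge> real i} < \<tau>"
    using eventually_gt_at_top[of "0 :: nat"] by (metis (mono_tags, lifting) eventually_conj eventually_happens trivial_limit_sequentially)
  then show ?thesis by (intro that[of "2 * real i"]) auto
qed

text \<open>A union bound over the sets of more than \<open>\<eta> * n\<close> positions: there are
  at most \<open>2 ^ n\<close> of them, and each is entirely hit with probability at most
  \<open>measure std_gauss B powr (\<eta> * n)\<close> by independence.\<close>

lemma noise_many_outliers:
  fixes \<eta> :: real
  assumes B: "B \<in> sets borel" and \<eta>: "\<eta> > 0"
  shows "measure (noise n) {z \<in> space (noise n). \<eta> * n < card {t. t < n \<and> z t \<in> B}}
     \<le> (2 * measure std_gauss B powr \<eta>) ^ n"
proof -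
  let ?p = "measure std_gauss B"
  interpret G: prob_space std_gauss by (rule prob_space_normal_density) simp
  interpret product_prob_space "\<lambda>_. std_gauss" "{..<n}" by unfold_locales
  let ?T = "{T. T \<subseteq> {..<n} \<and> \<eta> * n < card T}"
  let ?E = "\<lambda>T. {z \<in> space (noise n). \<forall>t\<in>T. z t \<in> B}"
  have meas: "measure (noise n) (?E T) = ?p ^ card T" "?E T \<in> sets (noise n)" if "T \<subseteq> {..<n}" for T
  proof -
    have T: "finite T" using that finite_subset by blast
    have "emeasure (noise n) (?E T) = (\<Prod>t\<in>T. emeasure std_gauss B)"
      unfolding noise_def using that T B by (intro emeasure_PiM_Collect) auto
    also have "\<dots> = ennreal (?p ^ card T)"
      by (simp add: G.emeasure_eq_measure ennreal_power)
    finally show "measure (noise n) (?E T) = ?p ^ card T" by (simp add: measure_def)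
    show "?E T \<in> sets (noise n)"
    proof -
      have "?E T = space (noise n) \<inter> (\<Inter>t\<in>T. {z \<in> space (noise n). z t \<in> B})" by auto
      moreover have "{z \<in> space (noise n). z t \<in> B} \<in> sets (noise n)" if "t \<in> T" for t
        unfolding noise_def using that \<open>T \<subseteq> {..<n}\<close> B
        by (intro sets_Collect_single) auto
      ultimately show ?thesis using T by (cases "T = {}") (auto intro!: sets.finite_INT)
    qed
  qed
  have sp: "noise n = (\<Pi>\<^sub>M t\<in>{..<n}. std_gauss)" by (simp add: noise_def)
  have "measure (noise n) {z \<in> space (noise n). \<eta> * n < card {t. t < n \<and> z t \<in> B}}
     \<le> measure (noise n) (\<Union>T\<in>?T. ?E T)"
  proof (intro P.finite_measure_mono[folded sp])
    show "{z \<in> space (noise n). \<eta> * n < card {t. t < n \<and> z t \<in> B}} \<subseteq> (\<Union>T\<in>?T. ?E T)"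
    proof
      fix z assume "z \<in> {z \<in> space (noise n). \<eta> * n < card {t. t < n \<and> z t \<in> B}}"
      then show "z \<in> (\<Union>T\<in>?T. ?E T)"
        by (intro UN_I[where a = "{t. t < n \<and> z t \<in> B}"]) auto
    qed
    show "(\<Union>T\<in>?T. ?E T) \<in> sets (noise n)"
      using meas by (intro sets.finite_UN) auto
  qed
  also have "\<dots> \<le> (\<Sum>T\<in>?T. measure (noise n) (?E T))"
    by (rule measure_UNION_le) (use meas in auto)
  also have "\<dots> \<le> (\<Sum>T\<in>?T. ?p powr (\<eta> * n))"
  proof (rule sum_mono)
    fix T assume T: "T \<in> ?T"
    then have "0 \<le> \<eta> * n" "\<eta> * n < card T" using \<eta> by auto
    then have "card T > 0" by (metis of_nat_0_less_iff order_le_less_trans)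
    have "?p ^ card T = ?p powr card T"
      using \<open>card T > 0\<close> by (cases "?p = 0") (auto simp: powr_realpow zero_less_measure_iff)
    also have "\<dots> \<le> ?p powr (\<eta> * n)"
      using \<open>\<eta> * n < card T\<close> by (intro powr_mono') auto
    finally show "measure (noise n) (?E T) \<le> ?p powr (\<eta> * n)" using meas T by simp
  qed
  also have "\<dots> = card ?T * ?p powr (\<eta> * n)" by simp
  also have "\<dots> \<le> 2 ^ n * ?p powr (\<eta> * n)"
  proof (rule mult_right_mono)
    have "card ?T \<le> card (Pow {..<n})" by (intro card_mono) auto
    then have "real (card ?T) \<le> real (2 ^ n)" by (simp only: card_Pow finite_lessThan card_lessThan of_nat_le_iff)
    then show "real (card ?T) \<le> 2 ^ n" by simp
  qed simp
  also have "\<dots> \<le> (2 * ?p powr \<eta>) ^ n"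
    by (cases "?p = 0"; cases "n = 0")
       (auto simp: power_mult_distrib powr_powr[symmetric] powr_realpow zero_less_measure_iff)
  finally show ?thesis .
qed

text \<open>
  A one-shot constellation with minimum distance \<open>d\<close> is concatenated with Gilbert-Varshamov codes of
  relative distance \<open>2 \<eta>\<close>: only the channel uses with noise exceeding \<open>d / 2\<close> can be harmful, and
  \<open>d\<close> makes these rarer than a fraction \<open>\<eta>\<close>, independently of the alphabet.
\<close>

lemma achievable_of_constellation:
  fixes \<eta> :: real
  assumes \<eta>: "0 < \<eta>" "2 * \<eta> \<le> 1"
  obtains d :: real where "d > 0"
    "\<And>K J (h :: nat \<times> nat \<Rightarrow> real ^ 'm::finite) P q (X :: (nat \<Rightarrow> nat) \<Rightarrow> real ^ 'm).
      (\<And>k. k \<in> {1..K} \<Longrightarrow> q k \<ge> (1 :: nat)) \<Longrightarrow>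
      (\<And>s. s \<in> (\<Pi>\<^sub>E k\<in>{1..K}. {..<q k}) \<Longrightarrow> (norm (X s))\<^sup>2 \<le> P) \<Longrightarrow>
      (\<And>k j s s'. (k, j) \<in> states K J \<Longrightarrow> s \<in> (\<Pi>\<^sub>E k\<in>{1..K}. {..<q k}) \<Longrightarrow>
          s' \<in> (\<Pi>\<^sub>E k\<in>{1..K}. {..<q k}) \<Longrightarrow> s k \<noteq> s' k \<Longrightarrow> d \<le> \<bar>h (k, j) \<bullet> X s - h (k, j) \<bullet> X s'\<bar>) \<Longrightarrow>
      achievable K J h P (\<lambda>k. max 0 ((1 - 2 * \<eta>) * log 2 (q k) - 1))"
proof -
  \<comment> \<open>Chosen so that \<open>\<tau> powr \<eta> = 1 / 4\<close>, which turns the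
    outlier bound into \<open>(1 / 2) ^ n\<close>.\<close>
  define \<tau> where "\<tau> = (1 / 4 :: real) powr (1 / \<eta>)"
  have "\<tau> > 0" by (simp add: \<tau>_def)
  then obtain d :: real where d: "d > 0" and tail: "measure std_gauss {z. \<bar>z\<bar> \<ge> d / 2} \<le> \<tau>"
    by (rule std_gauss_tail)
  define p where "p = measure std_gauss {z. \<bar>z\<bar> \<ge> d / 2}"
  have "p powr \<eta> \<le> \<tau> powr \<eta>" using tail \<eta> by (intro powr_mono2) (auto simp: p_def)
  also have "\<tau> powr \<eta> = 1 / 4" using \<eta> by (simp add: \<tau>_def powr_powr)
  finally have p: "2 * p powr \<eta> \<le> 1 / 2" by simp
  show ?thesis
  proof (rule that[OF d])
    fix K :: nat and J and h :: "nat \<times> nat \<Rightarrow> real ^ 'm" and P and q :: "nat \<Rightarrow> nat" and X :: "(nat \<Rightarrow> nat) \<Rightarrow> real ^ 'm"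
    let ?A = "\<Pi>\<^sub>E k\<in>{1..K}. {..<q k}"
    assume q: "\<And>k. k \<in> {1..K} \<Longrightarrow> q k \<ge> 1"
      and pow: "\<And>s. s \<in> ?A \<Longrightarrow> (norm (X s))\<^sup>2 \<le> P"
      and sep: "\<And>k j s s'. (k, j) \<in> states K J \<Longrightarrow> s \<in> ?A \<Longrightarrow> s' \<in> ?A \<Longrightarrow> s k \<noteq> s' k \<Longrightarrow>
          d \<le> \<bar>h (k, j) \<bullet> X s - h (k, j) \<bullet> X s'\<bar>"
    have code: "\<exists>c :: 'm code. valid_code K J c \<and> len c \<ge> n0 \<and> avg_power K c \<le> P \<and>
        (\<forall>k\<in>{1..K}. log 2 (real (msg_count c k)) / real (len c) \<ge> max 0 ((1 - 2 * \<eta>) * log 2 (q k) - 1)) \<and>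
        (\<forall>(k, j)\<in>states K J. error_prob K h c k j \<le> \<epsilon>)" if \<epsilon>: "\<epsilon> > 0" for \<epsilon> :: real and n0 :: nat
    proof -
      obtain n1 where n1: "(1 / 2 :: real) ^ n1 < \<epsilon>" using \<epsilon> real_arch_pow_inv[of \<epsilon> "1 / 2"] by auto
      define n where "n = max 1 (max n0 n1)"
      have "(1 / 2 :: real) ^ n \<le> (1 / 2) ^ n1" by (rule power_decreasing) (auto simp: n_def)
      with n1 have n: "(1 / 2 :: real) ^ n \<le> \<epsilon>" "n \<ge> 1" "n \<ge> n0" by (linarith, auto simp: n_def)
      \<comment> \<open>Two candidates that each have at most \<open>\<eta> * n\<close> large
        residuals differ in at most \<open>2 * \<eta> * n\<close> symbols; a distance above
        \<open>D\<close> makes them equal.\<close>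
      define D where "D = nat \<lfloor>2 * \<eta> * n\<rfloor>"
      have D: "real D \<le> 2 * \<eta> * n" using \<eta> by (simp add: D_def)
      have "\<forall>k\<in>{1..K}. \<exists>C. C \<subseteq> {..<n} \<rightarrow>\<^sub>E {..<q k} \<and> C \<noteq> {} \<and>
          (\<forall>x\<in>C. \<forall>y\<in>C. card {t. t < n \<and> x t \<noteq> y t} \<le> D \<longrightarrow> x = y) \<and> q k ^ n \<le> card C * (2 ^ n * q k ^ D)"
      proof
        fix k assume "k \<in> {1..K}"
        then have ne: "{..<q k} \<noteq> {}" using q[of k] by (auto simp: lessThan_empty_iff)
        show "\<exists>C. C \<subseteq> {..<n} \<rightarrow>\<^sub>E {..<q k} \<and> C \<noteq> {} \<and>
          (\<forall>x\<in>C. \<forall>y\<in>C. card {t. t < n \<and> x t \<noteq> y t} \<le> D \<longrightarrow> x = y) \<and> q k ^ n \<le> card C * (2 ^ n * q k ^ D)"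
        proof (rule gilbert_varshamov[OF finite_lessThan ne, of n D])
          fix C assume "C \<subseteq> {..<n} \<rightarrow>\<^sub>E {..<q k}" "C \<noteq> {}"
            "\<And>x y. x \<in> C \<Longrightarrow> y \<in> C \<Longrightarrow> card {t. t < n \<and> x t \<noteq> y t} \<le> D \<Longrightarrow> x = y"
            "card {..<q k} ^ n \<le> card C * (2 ^ n * card {..<q k} ^ D)"
          then show ?thesis by (intro exI[of _ C]) simp
        qed
      qed
      from bchoice[OF this] obtain C where CC: "\<forall>k\<in>{1..K}. C k \<subseteq> {..<n} \<rightarrow>\<^sub>E {..<q k} \<and> C k \<noteq> {} \<and>
          (\<forall>x\<in>C k. \<forall>y\<in>C k. card {t. t < n \<and> x t \<noteq> y t} \<le> D \<longrightarrow> x = y) \<and> q k ^ n \<le> card (C k) * (2 ^ n * q k ^ D)"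
        by (elim exE)
      then have C: "\<And>k. k \<in> {1..K} \<Longrightarrow> C k \<subseteq> {..<n} \<rightarrow>\<^sub>E {..<q k}" "\<And>k. k \<in> {1..K} \<Longrightarrow> C k \<noteq> {}"
        and dist: "\<And>k x y. k \<in> {1..K} \<Longrightarrow> x \<in> C k \<Longrightarrow> y \<in> C k \<Longrightarrow> card {t. t < n \<and> x t \<noteq> y t} \<le> D \<Longrightarrow> x = y"
        and size: "\<And>k. k \<in> {1..K} \<Longrightarrow> q k ^ n \<le> card (C k) * (2 ^ n * q k ^ D)"
        by simp_all
      have finC: "finite (C k)" if "k \<in> {1..K}" for k
        using C(1)[OF that] by (rule finite_subset) (auto intro!: finite_PiE)
      have "\<forall>k\<in>{1..K}. \<exists>f. bij_betw f {..<card (C k)} (C k)"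
        using finC ex_bij_betw_nat_finite by (metis atLeast0LessThan)
      from bchoice[OF this] obtain f where "\<forall>k\<in>{1..K}. bij_betw (f k) {..<card (C k)} (C k)" by (elim exE)
      then have f: "\<And>k. k \<in> {1..K} \<Longrightarrow> bij_betw (f k) {..<card (C k)} (C k)" by blast
      define W where "W = (\<Pi>\<^sub>E k\<in>{1..K}. {..<card (C k)})"
      define sym where "sym w t = (\<lambda>k\<in>{1..K}. f k (w k) t)" for w t
      define out where "out k j w t = h (k, j) \<bullet> X (sym w t)" for k j w t
      \<comment> \<open>A candidate is a whole tuple \<open>w\<close>, since the other users'
        symbols also shape the received signal, but only its component \<open>k\<close> has to be
        unique. The count is a sum of indicators so that the decoder is visibly measurable, and
        \<open>LEAST\<close> gives it a value on every input.\<close>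
      define close where "close k j w y \<longleftrightarrow> (\<Sum>t<n. if \<bar>y t - out k j w t\<bar> \<ge> d / 2 then 1 else 0) \<le> \<eta> * n" for k j w y
      define c :: "'m code" where "c = \<lparr>len = n, msg_count = (\<lambda>k. card (C k)), enc = (\<lambda>w t. X (sym w t)),
          dec = (\<lambda>k j y. LEAST v. \<exists>w\<in>W. w k = v \<and> close k j w y)\<rparr>"
      have W: "messages K c = W" by (simp add: messages_def c_def W_def)
      have c_simps: "len c = n" "msg_count c k = card (C k)" "enc c w t = X (sym w t)" for k w t
        by (simp_all add: c_def)
      have finW: "finite W" by (auto simp: W_def intro!: finite_PiE)
      have fC: "f k (w k) \<in> C k" if "w \<in> W" "k \<in> {1..K}" for w k
        using f[OF that(2)] that by (auto simp: W_def bij_betw_def PiE_iff)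
      have sym: "sym w t \<in> ?A" if "w \<in> W" "t < n" for w t
        using fC[OF that(1)] C(1) that(2) unfolding sym_def by (fastforce simp: PiE_iff)
      have valid: "valid_code K J c"
        unfolding valid_code_def
      proof (intro conjI ballI, safe)
        show "len c \<ge> 1" using n by (simp add: c_def)
        show "msg_count c k \<ge> 1" if "k \<in> {1..K}" for k
          using C(2)[OF that] finC[OF that] by (simp add: c_def Suc_le_eq card_gt_0_iff)
        show "dec c k j \<in> (\<Pi>\<^sub>M t\<in>{..<len c}. borel) \<rightarrow>\<^sub>M count_space UNIV" for k j
        proof -
          have "(\<lambda>y. \<exists>w\<in>W. w k = v \<and> close k j w y) \<in> (\<Pi>\<^sub>M t\<in>{..<n}. borel) \<rightarrow>\<^sub>M count_space UNIV" for v
            unfolding close_def using finW by measurable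
          then show ?thesis unfolding c_def by simp
        qed
      qed
      have power: "avg_power K c \<le> P"
      proof -
        have "measure_pmf.expectation (message_dist K c) (\<lambda>w. (norm (enc c w t))\<^sup>2) \<le> P" if "t < n" for t
        proof -
          have W0: "W \<noteq> {}" using messages_nonempty[OF valid] W by simp
          have "(\<Sum>w\<in>W. (norm (X (sym w t)))\<^sup>2) \<le> (\<Sum>w\<in>W. P)"
            by (intro sum_mono pow sym that)
          then have "(\<Sum>w\<in>W. (norm (X (sym w t)))\<^sup>2) / card W \<le> P"
            using W0 finW by (simp add: divide_le_eq mult.commute card_gt_0_iff)
          then show ?thesis by (simp add: expectation_message_dist[OF valid] W c_simps)
        qed
        then have "(\<Sum>t<n. measure_pmf.expectation (message_dist K c) (\<lambda>w. (norm (enc c w t))\<^sup>2)) \<le> (\<Sum>t<n. P)"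
          by (intro sum_mono) auto
        then show ?thesis using n by (simp add: avg_power_def c_simps divide_le_eq mult.commute)
      qed
      have rate: "log 2 (real (card (C k))) / real n \<ge> max 0 ((1 - 2 * \<eta>) * log 2 (q k) - 1)" if k: "k \<in> {1..K}" for k
      proof -
        have c1: "real (card (C k)) \<ge> 1" using C(2)[OF k] finC[OF k] by (simp add: Suc_le_eq card_gt_0_iff)
        have q1: "real (q k) \<ge> 1" using q[OF k] by simp
        have "real (q k ^ n) \<le> real (card (C k) * (2 ^ n * q k ^ D))" using size[OF k] by (simp only: of_nat_le_iff)
        then have "real (q k) ^ n \<le> real (card (C k)) * (2 ^ n * real (q k) ^ D)" by simp
        then have "log 2 (real (q k) ^ n) \<le> log 2 (real (card (C k)) * (2 ^ n * real (q k) ^ D))"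
          using q1 c1 by (subst log_le_cancel_iff) (auto intro!: mult_pos_pos)
        then have "n * log 2 (q k) \<le> log 2 (card (C k)) + (n + D * log 2 (q k))"
          using q1 c1 by (simp add: log_mult_pos log_nat_power)
        moreover have "D * log 2 (q k) \<le> 2 * \<eta> * n * log 2 (q k)"
          using D q1 by (intro mult_right_mono) auto
        ultimately have "((1 - 2 * \<eta>) * log 2 (q k) - 1) * n \<le> log 2 (card (C k))"
          by (simp add: algebra_simps)
        then have "(1 - 2 * \<eta>) * log 2 (q k) - 1 \<le> log 2 (card (C k)) / n"
          using n by (simp add: le_divide_eq)
        moreover have "0 \<le> log 2 (card (C k)) / n" using c1 by simp
        ultimately show ?thesis by simp
      qed
      have err: "error_prob K h c k j \<le> \<epsilon>" if kj: "(k, j) \<in> states K J" for k j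
      proof -
        have k: "k \<in> {1..K}" using kj by (auto simp: states_def)
        let ?bad = "{z \<in> space (noise n). \<eta> * n < card {t. t < n \<and> z t \<in> {z. \<bar>z\<bar> \<ge> d / 2}}}"
        interpret N: prob_space "noise n"
          unfolding noise_def by (intro prob_space_PiM prob_space_normal_density) simp
        have bad: "measure (noise n) ?bad \<le> \<epsilon>"
        proof -
          have "{z :: real. \<bar>z\<bar> \<ge> d / 2} \<in> sets borel" by measurable
          then have "measure (noise n) ?bad \<le> (2 * p powr \<eta>) ^ n"
            unfolding p_def by (rule noise_many_outliers[OF _ \<eta>(1)])
          also have "\<dots> \<le> (1 / 2) ^ n" by (intro power_mono p) auto
          finally show ?thesis using n by simp
        qed
        have card_sum: "(\<Sum>t<n. if B t then 1 else (0 :: real)) = card {t. t < n \<and> B t}" for B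
        proof -
          have "{..<n} \<inter> Collect B = {t. t < n \<and> B t}" by auto
          then show ?thesis by (simp add: sum.If_cases)
        qed
        have sub: "{z \<in> space (noise (len c)). dec c k j (received h c k j w z) \<noteq> w k} \<subseteq> ?bad" if w: "w \<in> W" for w
        proof (clarsimp simp: c_simps, rule ccontr)
          fix z assume z: "z \<in> space (noise n)" and ne: "dec c k j (received h c k j w z) \<noteq> w k"
            and "\<not> \<eta> * n < card {t. t < n \<and> d \<le> \<bar>z t\<bar> * 2}"
          then have few: "card {t. t < n \<and> d / 2 \<le> \<bar>z t\<bar>} \<le> \<eta> * n" by (simp add: mult.commute)
          define y where "y = received h c k j w z"
          have y: "y t = out k j w t + z t" if "t < n" for t
            using that by (simp add: y_def received_def c_simps out_def)
          have "{t. t < n \<and> d / 2 \<le> \<bar>y t - out k j w t\<bar>} = {t. t < n \<and> d / 2 \<le> \<bar>z t\<bar>}"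
            using y by auto
          then have cw: "close k j w y" unfolding close_def card_sum using few by simp
          have unique: "w' k = w k" if w': "w' \<in> W" "close k j w' y" for w'
          proof -
            let ?B = "\<lambda>w. {t. t < n \<and> d / 2 \<le> \<bar>y t - out k j w t\<bar>}"
            have "{t. t < n \<and> f k (w' k) t \<noteq> f k (w k) t} \<subseteq> ?B w' \<union> ?B w"
            proof
              fix t assume "t \<in> {t. t < n \<and> f k (w' k) t \<noteq> f k (w k) t}"
              then have t: "t < n" and "sym w' t k \<noteq> sym w t k" using k by (auto simp: sym_def)
              then have "d \<le> \<bar>out k j w' t - out k j w t\<bar>"
                unfolding out_def by (intro sep[OF kj] sym w w')
              then have "d / 2 \<le> \<bar>y t - out k j w' t\<bar> \<or> d / 2 \<le> \<bar>y t - out k j w t\<bar>" by linarith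
              then show "t \<in> ?B w' \<union> ?B w" using t by blast
            qed
            then have "card {t. t < n \<and> f k (w' k) t \<noteq> f k (w k) t} \<le> card (?B w' \<union> ?B w)"
              by (intro card_mono) auto
            also have "\<dots> \<le> card (?B w') + card (?B w)" by (rule card_Un_le)
            finally have "real (card {t. t < n \<and> f k (w' k) t \<noteq> f k (w k) t}) \<le> 2 * \<eta> * n"
              using w'(2) cw unfolding close_def card_sum by linarith
            then have "card {t. t < n \<and> f k (w' k) t \<noteq> f k (w k) t} \<le> D"
              unfolding D_def by linarith
            then have "f k (w' k) = f k (w k)" by (intro dist[OF k] fC w w' k)
            then show ?thesis
              using f[OF k] w w' k by (auto simp: bij_betw_def inj_on_def W_def PiE_iff)
          qed
          have "dec c k j y = (LEAST v. \<exists>w\<in>W. w k = v \<and> close k j w y)" by (simp add: c_def)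
          also have "\<dots> = w k"
          proof (rule Least_equality)
            show "\<exists>w'\<in>W. w' k = w k \<and> close k j w' y" using cw w by blast
            show "w k \<le> v" if ex: "\<exists>w'\<in>W. w' k = v \<and> close k j w' y" for v
            proof -
              obtain w' where "w' \<in> W" "w' k = v" "close k j w' y" using ex by (elim bexE conjE)
              then show ?thesis using unique[of w'] by simp
            qed
          qed
          finally show False using ne by (simp add: y_def)
        qed
        have bad_meas: "?bad \<in> sets (noise n)"
        proof -
          have "?bad = {z \<in> space (noise n). \<eta> * n < (\<Sum>t<n. if z t \<in> {z. \<bar>z\<bar> \<ge> d / 2} then 1 else (0 :: real))}"
            unfolding card_sum by simp
          also have "\<dots> \<in> sets (noise n)" unfolding noise_def by measurable
          finally show ?thesis .
        qed
        have W0: "W \<noteq> {}" using messages_nonempty[OF valid] W by simp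
        have "error_prob K h c k j = (\<Sum>w\<in>W. measure (noise (len c))
              {z \<in> space (noise (len c)). dec c k j (received h c k j w z) \<noteq> w k}) / card W"
          by (simp add: error_prob_def expectation_message_dist[OF valid] W)
        also have "\<dots> \<le> (\<Sum>w\<in>W. \<epsilon>) / card W"
        proof (intro divide_right_mono sum_mono)
          fix w assume "w \<in> W"
          from N.finite_measure_mono[OF sub[OF this] bad_meas] bad
          show "measure (noise (len c)) {z \<in> space (noise (len c)). dec c k j (received h c k j w z) \<noteq> w k} \<le> \<epsilon>"
            by (simp add: c_simps)
        qed simp
        also have "\<dots> = \<epsilon>" using W0 finW by simp
        finally show ?thesis .
      qed
      show ?thesis
        by (rule exI[of _ c]) (use valid power rate err n in \<open>auto simp: c_simps\<close>)
    qed
    show "achievable K J h P (\<lambda>k. max 0 ((1 - 2 * \<eta>) * log 2 (q k) - 1))"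
      unfolding achievable_def using code by auto
  qed
qed

subsection \<open>Interference alignment\<close>

lemma card_nat_diff_le:
  fixes S :: "nat set" and L :: real
  assumes "L \<ge> 0" and "\<And>k l. k \<in> S \<Longrightarrow> l \<in> S \<Longrightarrow> real l - real k \<le> L" and "finite S"
  shows "real (card S) \<le> L + 1"
proof (cases "S = {}")
  case False
  have "S \<subseteq> {Min S..Max S}" using assms by auto
  then have "card S \<le> card {Min S..Max S}" by (intro card_mono) auto
  then have "real (card S) \<le> real (Max S) - real (Min S) + 1"
    using Min_le[OF \<open>finite S\<close> Max_in[OF \<open>finite S\<close> False]] by simp
  also have "\<dots> \<le> L + 1" using assms False by auto
  finally show ?thesis .
qed (use assms in auto)

text \<open>Fixing all coordinates but \<open>i\<close> confines \<open>\<theta> i / N\<close> to an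
  interval of length \<open>2 * \<delta> / \<mu>\<close>, hence \<open>\<theta> i\<close> to at most
  \<open>2 * \<delta> * N / \<mu> + 1\<close> values. This is the volume of a slab, taken on a grid
  so that counting suffices.\<close>

lemma card_small_linear_form:
  fixes u :: "'i \<Rightarrow> real"
  assumes I: "finite I" "i \<in> I" and \<mu>: "\<mu> > 0" "\<bar>u i\<bar> \<ge> \<mu>" and \<delta>: "\<delta> > 0" and N: "N \<ge> 1"
  shows "real (card {\<theta> \<in> I \<rightarrow>\<^sub>E {..<N}. \<bar>\<Sum>l\<in>I. real (\<theta> l) / N * u l\<bar> < \<delta>}) \<le> (2 * \<delta> / \<mu> + 1 / N) * real N ^ card I"
proof -
  let ?B = "{\<theta> \<in> I \<rightarrow>\<^sub>E {..<N}. \<bar>\<Sum>l\<in>I. real (\<theta> l) / N * u l\<bar> < \<delta>}"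
  let ?R = "(I - {i}) \<rightarrow>\<^sub>E {..<N}"
  let ?F = "\<lambda>\<phi>. {\<theta> \<in> ?B. restrict \<theta> (I - {i}) = \<phi>}"
  have fin: "finite ?B" by (rule finite_subset[of _ "I \<rightarrow>\<^sub>E {..<N}"]) (use I in \<open>auto intro!: finite_PiE\<close>)
  have fib: "real (card (?F \<phi>)) \<le> 2 * \<delta> * N / \<mu> + 1" for \<phi>
  proof -
    have inj: "inj_on (\<lambda>\<theta>. \<theta> i) (?F \<phi>)"
    proof (rule inj_onI)
      fix \<theta> \<theta>' assume t: "\<theta> \<in> ?F \<phi>" and t': "\<theta>' \<in> ?F \<phi>" and eq: "\<theta> i = \<theta>' i"
      have r: "restrict \<theta> (I - {i}) = restrict \<theta>' (I - {i})" using t t' by simp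
      show "\<theta> = \<theta>'"
      proof (rule PiE_ext[of \<theta> I "\<lambda>_. {..<N}" \<theta>'])
        show "\<theta> \<in> I \<rightarrow>\<^sub>E {..<N}" "\<theta>' \<in> I \<rightarrow>\<^sub>E {..<N}" using t t' by simp_all
        fix l assume "l \<in> I"
        then show "\<theta> l = \<theta>' l" using eq fun_cong[OF r, of l] by (cases "l = i") auto
      qed
    qed
    have "real (card ((\<lambda>\<theta>. \<theta> i) ` ?F \<phi>)) \<le> 2 * \<delta> * N / \<mu> + 1"
    proof (rule card_nat_diff_le)
      show "finite ((\<lambda>\<theta>. \<theta> i) ` ?F \<phi>)" using finite_subset[OF _ fin, of "?F \<phi>"] by blast
      fix k l assume "k \<in> (\<lambda>\<theta>. \<theta> i) ` ?F \<phi>" "l \<in> (\<lambda>\<theta>. \<theta> i) ` ?F \<phi>"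
      then obtain \<theta> \<theta>' where t: "\<theta> \<in> ?F \<phi>" "\<theta>' \<in> ?F \<phi>" "k = \<theta> i" "l = \<theta>' i" by auto
      have r: "restrict \<theta> (I - {i}) = restrict \<theta>' (I - {i})" using t by simp
      have same: "(\<Sum>l\<in>I - {i}. real (\<theta> l) / N * u l) = (\<Sum>l\<in>I - {i}. real (\<theta>' l) / N * u l)"
      proof (rule sum.cong)
        fix l assume "l \<in> I - {i}"
        then have "\<theta> l = \<theta>' l" using fun_cong[OF r, of l] by simp
        then show "real (\<theta> l) / N * u l = real (\<theta>' l) / N * u l" by simp
      qed simp
      have "\<bar>\<Sum>l\<in>I. real (\<theta> l) / N * u l\<bar> < \<delta>" "\<bar>\<Sum>l\<in>I. real (\<theta>' l) / N * u l\<bar> < \<delta>"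
        using t by auto
      then have "\<bar>real l / N * u i - real k / N * u i\<bar> < 2 * \<delta>"
      proof -
        have *: "\<bar>A\<bar> < \<delta> \<Longrightarrow> \<bar>B\<bar> < \<delta> \<Longrightarrow> A = x + s \<Longrightarrow> B = y + s' \<Longrightarrow> s = s' \<Longrightarrow> \<bar>y - x\<bar> < 2 * \<delta>"
          for A B x y s s' :: real by linarith
        from \<open>\<bar>\<Sum>l\<in>I. real (\<theta> l) / N * u l\<bar> < \<delta>\<close> \<open>\<bar>\<Sum>l\<in>I. real (\<theta>' l) / N * u l\<bar> < \<delta>\<close>
          sum.remove[OF I] sum.remove[OF I] same
        show ?thesis unfolding t(3,4) by (rule *)
      qed
      moreover have "\<bar>real l / N * u i - real k / N * u i\<bar> = \<bar>real l - real k\<bar> / N * \<bar>u i\<bar>"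
        by (simp add: left_diff_distrib[symmetric] diff_divide_distrib[symmetric] abs_mult)
      ultimately have "\<bar>real l - real k\<bar> / N * \<bar>u i\<bar> < 2 * \<delta>" by simp
      moreover have "\<bar>real l - real k\<bar> / N * \<mu> \<le> \<bar>real l - real k\<bar> / N * \<bar>u i\<bar>"
        by (intro mult_left_mono \<mu>) auto
      ultimately have "\<bar>real l - real k\<bar> / N * \<mu> < 2 * \<delta>" by simp
      then have "\<bar>real l - real k\<bar> < 2 * \<delta> * N / \<mu>" using \<mu> N by (simp add: field_simps)
      then show "real l - real k \<le> 2 * \<delta> * N / \<mu>" by simp
    qed (use \<mu> \<delta> in auto)
    then show ?thesis using card_image[OF inj] by simp
  qed
  have "card ?B \<le> card (\<Union>\<phi>\<in>?R. ?F \<phi>)"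
  proof (rule card_mono)
    show "finite (\<Union>\<phi>\<in>?R. ?F \<phi>)" by (rule finite_subset[OF _ fin]) blast
    show "?B \<subseteq> (\<Union>\<phi>\<in>?R. ?F \<phi>)" by auto
  qed
  also have "\<dots> \<le> (\<Sum>\<phi>\<in>?R. card (?F \<phi>))" using I by (intro card_UN_le finite_PiE) auto
  finally have "real (card ?B) \<le> (\<Sum>\<phi>\<in>?R. real (card (?F \<phi>)))" by (simp flip: of_nat_sum)
  also have "\<dots> \<le> (\<Sum>\<phi>\<in>?R. 2 * \<delta> * N / \<mu> + 1)" by (intro sum_mono fib)
  also have "\<dots> = real N ^ (card I - 1) * (2 * \<delta> * N / \<mu> + 1)"
    using I by (simp add: card_PiE card_Diff_singleton)
  also have "\<dots> = (2 * \<delta> / \<mu> + 1 / N) * (real N ^ (card I - 1) * N)"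
    using N by (simp add: field_simps)
  also have "real N ^ (card I - 1) * N = real N ^ card I"
    using I by (metis card_gt_0_iff empty_iff power_minus_mult)
  finally show ?thesis .
qed

text \<open>A union bound over \<open>U\<close>: once \<open>N\<close> is large enough for the
  discretization term \<open>1 / N\<close>, the fractions of bad grid points add up to less than
  one.\<close>

lemma exists_separating_coefficients:
  fixes U :: "('i \<Rightarrow> real) set"
  assumes I: "finite I" and U: "finite U" and \<mu>: "\<mu> > 0" "\<And>u. u \<in> U \<Longrightarrow> \<exists>i\<in>I. \<bar>u i\<bar> \<ge> \<mu>"
    and \<delta>: "\<delta> > 0" "card U * (2 * \<delta> / \<mu>) < 1"
  obtains \<theta> :: "'i \<Rightarrow> real" where "\<And>i. i \<in> I \<Longrightarrow> 0 \<le> \<theta> i \<and> \<theta> i \<le> 1"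
    "\<And>u. u \<in> U \<Longrightarrow> \<bar>\<Sum>i\<in>I. \<theta> i * u i\<bar> \<ge> \<delta>"
proof -
  obtain N :: nat where N: "card U / (1 - card U * (2 * \<delta> / \<mu>)) < N" using reals_Archimedean2 by blast
  have N1: "N \<ge> 1"
  proof (rule ccontr)
    assume "\<not> N \<ge> 1"
    with N have "card U / (1 - card U * (2 * \<delta> / \<mu>)) < 0" by simp
    with \<delta> show False by (simp add: divide_less_0_iff)
  qed
  have small: "card U * (2 * \<delta> / \<mu> + 1 / N) < 1"
    using N \<delta> N1 by (simp add: field_simps)
  let ?B = "\<lambda>u. {\<theta> \<in> I \<rightarrow>\<^sub>E {..<N}. \<bar>\<Sum>l\<in>I. real (\<theta> l) / N * u l\<bar> < \<delta>}"
  have "card (\<Union>u\<in>U. ?B u) \<le> (\<Sum>u\<in>U. card (?B u))" by (intro card_UN_le U)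
  then have "real (card (\<Union>u\<in>U. ?B u)) \<le> (\<Sum>u\<in>U. real (card (?B u)))" by (simp flip: of_nat_sum)
  also have "\<dots> \<le> (\<Sum>u\<in>U. (2 * \<delta> / \<mu> + 1 / N) * real N ^ card I)"
  proof (rule sum_mono)
    fix u assume "u \<in> U"
    with \<mu> obtain i where "i \<in> I" "\<bar>u i\<bar> \<ge> \<mu>" by blast
    then show "real (card (?B u)) \<le> (2 * \<delta> / \<mu> + 1 / N) * real N ^ card I"
      by (intro card_small_linear_form[of _ i]) (use I \<mu> \<delta> N1 in auto)
  qed
  also have "\<dots> = card U * (2 * \<delta> / \<mu> + 1 / N) * real N ^ card I" by simp
  also have "\<dots> < 1 * real N ^ card I" using small N1 by (intro mult_strict_right_mono) auto
  also have "\<dots> = card (I \<rightarrow>\<^sub>E {..<N})" using I by (simp add: card_PiE)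
  finally have "card (\<Union>u\<in>U. ?B u) < card (I \<rightarrow>\<^sub>E {..<N})" by simp
  then obtain \<theta> where \<theta>: "\<theta> \<in> I \<rightarrow>\<^sub>E {..<N}" "\<theta> \<notin> (\<Union>u\<in>U. ?B u)"
    by (metis (no_types, lifting) I U card_mono finite_PiE finite_UN finite_lessThan finite_subset linorder_not_less mem_Collect_eq subsetI)
  show ?thesis
  proof (rule that[of "\<lambda>i. real (\<theta> i) / N"])
    fix i assume "i \<in> I"
    then have "\<theta> i < N" using \<theta>(1) by auto
    then show "0 \<le> real (\<theta> i) / N \<and> real (\<theta> i) / N \<le> 1" by (simp add: divide_le_eq)
  qed (use \<theta> in \<open>auto simp: not_less\<close>)
qed

text \<open>
  Both users see a random real linear form in integer unknowns. The streams of user \<open>a\<close> are sent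
  along the directions \<open>mon e\<close> from every antenna, so that at each state of user \<open>b\<close> they collapse into
  the directions \<open>mon e'\<close> with \<open>e' \<in> T'\<close>; the streams of user \<open>b\<close> are zero-forced at user \<open>a\<close>. Repeating
  the whole pattern \<open>N\<close> times with independent coefficients \<open>\<theta>\<close> makes the constant \<open>\<kappa>\<close>, the only trace
  of how well the channel coefficients can be approximated by rationals, irrelevant as \<open>N\<close> grows.
\<close>

lemma aligned_constellation:
  fixes ha hb :: "nat \<Rightarrow> real ^ 'm::finite" and T T' :: "'e set" and mon :: "'e \<Rightarrow> real"
    and sh :: "nat \<Rightarrow> 'm \<Rightarrow> 'e \<Rightarrow> 'e" and v0 :: "real ^ 'm" and Ja Jb Q L :: nat
  assumes T: "finite T" "finite T'"
    and sh: "\<And>j i. j \<in> {1..Jb} \<Longrightarrow> inj_on (sh j i) T" "\<And>j i. j \<in> {1..Jb} \<Longrightarrow> sh j i ` T \<subseteq> T'"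
      "\<And>j i e. j \<in> {1..Jb} \<Longrightarrow> e \<in> T \<Longrightarrow> hb j $ i * mon e = mon (sh j i e)"
    and indep: "\<And>j c. j \<in> {1..Ja} \<Longrightarrow> \<exists>p\<in>UNIV \<times> T. c p \<noteq> 0 \<Longrightarrow>
        (\<Sum>(i, e)\<in>UNIV \<times> T. real_of_int (c (i, e)) * (ha j $ i * mon e)) \<noteq> 0"
    and v0: "\<And>j. j \<in> {1..Ja} \<Longrightarrow> ha j \<bullet> v0 = 0" "\<And>j. j \<in> {1..Jb} \<Longrightarrow> hb j \<bullet> v0 \<noteq> 0"
    and Q: "Q \<ge> 1" and L: "CARD('m) * card T \<le> card T' + L"
  obtains \<kappa> B :: real where "\<kappa> > 0" "B > 0"
    "\<And>N. \<exists>X :: (nat \<times> 'm \<times> 'e \<Rightarrow> nat) \<Rightarrow> (nat \<times> nat \<Rightarrow> nat) \<Rightarrow> real ^ 'm.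
       \<forall>\<alpha>\<in>({..<N} \<times> UNIV \<times> T) \<rightarrow>\<^sub>E {..<Q}. \<forall>\<beta>\<in>({..<N} \<times> {..<L}) \<rightarrow>\<^sub>E {..<Q}.
         norm (X \<alpha> \<beta>) \<le> B * (real N + 1) \<and>
         (\<forall>\<alpha>'\<in>({..<N} \<times> UNIV \<times> T) \<rightarrow>\<^sub>E {..<Q}. \<forall>\<beta>'\<in>({..<N} \<times> {..<L}) \<rightarrow>\<^sub>E {..<Q}.
           (\<alpha> \<noteq> \<alpha>' \<longrightarrow> (\<forall>j\<in>{1..Ja}. \<kappa> / real (3 * CARD('m) * Q) ^ (N * (card T' + L)) \<le> \<bar>ha j \<bullet> X \<alpha> \<beta> - ha j \<bullet> X \<alpha>' \<beta>'\<bar>)) \<and>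
           (\<beta> \<noteq> \<beta>' \<longrightarrow> (\<forall>j\<in>{1..Jb}. \<kappa> / real (3 * CARD('m) * Q) ^ (N * (card T' + L)) \<le> \<bar>hb j \<bullet> X \<alpha> \<beta> - hb j \<bullet> X \<alpha>' \<beta>'\<bar>)))"
proof -
  let ?m = "CARD('m)"
  let ?W = "real (3 * ?m * Q)"
  define F where "F j c = (\<Sum>(i, e)\<in>UNIV \<times> T. real_of_int (c (i, e)) * (ha j $ i * mon e))" for j and c :: "'m \<times> 'e \<Rightarrow> int"
  define P where "P = ((UNIV :: 'm set) \<times> T) \<rightarrow>\<^sub>E {- int Q..int Q}"
  \<comment> \<open>Finitely many positive numbers: the values of the nonzero integer forms at the
    states of \<open>a\<close>, and the gains of \<open>v0\<close> at those of \<open>b\<close>. The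
    element 1 makes \<open>Min\<close> well defined if both families are empty.\<close>
  define V where "V = insert 1 ({\<bar>F j c\<bar> | j c. j \<in> {1..Ja} \<and> c \<in> P \<and> (\<exists>p\<in>UNIV \<times> T. c p \<noteq> 0)}
      \<union> {\<bar>hb j \<bullet> v0\<bar> | j. j \<in> {1..Jb}})"
  define \<mu> where "\<mu> = Min V"
  have "finite ({1..Ja} \<times> P)" unfolding P_def using T by (intro finite_SigmaI finite_PiE) auto
  then have fin: "finite ((\<lambda>(j, c). \<bar>F j c\<bar>) ` ({1..Ja} \<times> P) \<union> (\<lambda>j. \<bar>hb j \<bullet> v0\<bar>) ` {1..Jb})" by blast
  have sub: "{\<bar>F j c\<bar> | j c. j \<in> {1..Ja} \<and> c \<in> P \<and> (\<exists>p\<in>UNIV \<times> T. c p \<noteq> 0)}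
      \<union> {\<bar>hb j \<bullet> v0\<bar> | j. j \<in> {1..Jb}}
    \<subseteq> (\<lambda>(j, c). \<bar>F j c\<bar>) ` ({1..Ja} \<times> P) \<union> (\<lambda>j. \<bar>hb j \<bullet> v0\<bar>) ` {1..Jb}" by fast
  from finite_subset[OF sub fin] have finV: "finite V" by (simp only: V_def finite_insert)
  have posV: "x > 0" if x: "x \<in> V" for x
  proof -
    have pF: "\<bar>F j c\<bar> > 0" if "j \<in> {1..Ja}" "\<exists>p\<in>UNIV \<times> T. c p \<noteq> 0" for j c
      using indep[OF that] by (simp add: F_def)
    have pv: "\<bar>hb j \<bullet> v0\<bar> > 0" if "j \<in> {1..Jb}" for j using v0(2)[OF that] by simp
    consider "x = 1" | j c where "j \<in> {1..Ja}" "\<exists>p\<in>UNIV \<times> T. c p \<noteq> 0" "x = \<bar>F j c\<bar>"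
      | j where "j \<in> {1..Jb}" "x = \<bar>hb j \<bullet> v0\<bar>"
      using x unfolding V_def insert_iff Un_iff mem_Collect_eq by metis
    then show ?thesis using pF pv by cases (simp, metis, metis)
  qed
  have \<mu>0: "\<mu> > 0" unfolding \<mu>_def using finV posV by (subst Min_gr_iff) (auto simp: V_def)
  have \<mu>F: "\<mu> \<le> \<bar>F j c\<bar>" if "j \<in> {1..Ja}" "c \<in> P" "\<exists>p\<in>UNIV \<times> T. c p \<noteq> 0" for j c
    unfolding \<mu>_def by (rule Min_le[OF finV]) (use that in \<open>unfold V_def, blast\<close>)
  have \<mu>v: "\<mu> \<le> \<bar>hb j \<bullet> v0\<bar>" if "j \<in> {1..Jb}" for j
    unfolding \<mu>_def by (rule Min_le[OF finV]) (use that in \<open>unfold V_def, blast\<close>)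
  \<comment> \<open>At most \<open>(Ja + Jb) * ?W ^ (N * (card T' + L))\<close> differences must be
    kept away from 0, each excluding a fraction of about \<open>2 * ?\<delta> / \<mu>\<close> of the
    coefficients; the factor 4 keeps the sum of these fractions below one half.\<close>
  define \<kappa> where "\<kappa> = \<mu> / (4 * (real Ja + real Jb + 1))"
  define B where "B = 1 + (\<Sum>i\<in>(UNIV :: 'm set). \<Sum>e\<in>T. Q * \<bar>mon e\<bar>) + L * Q * norm v0"
  have B0: "(\<Sum>i\<in>(UNIV :: 'm set). \<Sum>e\<in>T. Q * \<bar>mon e\<bar>) \<ge> 0" by (intro sum_nonneg) auto
  have \<kappa>0: "\<kappa> > 0" using \<mu>0 by (simp add: \<kappa>_def)
  have "B > 0" using B0 by (auto simp: B_def intro!: add_pos_nonneg)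
  show ?thesis
  proof (rule that[OF \<kappa>0 \<open>B > 0\<close>])
    fix N :: nat
    let ?A = "({..<N} \<times> (UNIV :: 'm set) \<times> T)" and ?B = "({..<N} \<times> {..<L})"
    let ?I = "{..<N} <+> ?B"
    let ?\<delta> = "\<kappa> / ?W ^ (N * (card T' + L))"
    \<comment> \<open>The coordinates \<open>Inl k\<close> belong to the repetitions of the pattern
      of \<open>a\<close>, the coordinates \<open>Inr p\<close> to the single streams of
      \<open>b\<close>. The latter vanish in \<open>ua\<close> by zero forcing.\<close>
    define ua where "ua j \<Delta> l = (case l of Inl k \<Rightarrow> F j (\<lambda>(i, e). \<Delta> (k, i, e)) | Inr p \<Rightarrow> 0)"
      for j and \<Delta> :: "nat \<times> 'm \<times> 'e \<Rightarrow> int" and l :: "nat + nat \<times> nat"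
    define ub where "ub j \<gamma> \<zeta> l = (case l of Inl k \<Rightarrow> (\<Sum>e\<in>T'. real_of_int (\<gamma> (k, e)) * mon e) | Inr p \<Rightarrow> hb j \<bullet> v0 * real_of_int (\<zeta> p))"
      for j and \<gamma> :: "nat \<times> 'e \<Rightarrow> int" and \<zeta> :: "nat \<times> nat \<Rightarrow> int" and l :: "nat + nat \<times> nat"
    define Da where "Da = ?A \<rightarrow>\<^sub>E {- int Q..int Q}"
    define Db where "Db = ({..<N} \<times> T') \<rightarrow>\<^sub>E {- int (?m * Q)..int (?m * Q)}"
    define Dc where "Dc = ?B \<rightarrow>\<^sub>E {- int Q..int Q}"
    define Ua where "Ua = {ua j \<Delta> | j \<Delta>. j \<in> {1..Ja} \<and> \<Delta> \<in> Da \<and> (\<exists>p\<in>?A. \<Delta> p \<noteq> 0)}"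
    \<comment> \<open>Only \<zeta> is required to be nonzero: \<open>b\<close> does not resolve the
      aligned interference \<gamma>, but its own streams must stay visible under every value of
      \<gamma>.\<close>
    define Ub where "Ub = {ub j \<gamma> \<zeta> | j \<gamma> \<zeta>. j \<in> {1..Jb} \<and> \<gamma> \<in> Db \<and> \<zeta> \<in> Dc \<and> (\<exists>p\<in>?B. \<zeta> p \<noteq> 0)}"
    have Ua: "Ua \<subseteq> (\<lambda>(j, \<Delta>). ua j \<Delta>) ` ({1..Ja} \<times> Da)" unfolding Ua_def by fast
    have Ub: "Ub \<subseteq> (\<lambda>(j, \<gamma>, \<zeta>). ub j \<gamma> \<zeta>) ` ({1..Jb} \<times> Db \<times> Dc)"
    proof
      fix u assume "u \<in> Ub"
      then obtain j \<gamma> \<zeta> where u: "u = ub j \<gamma> \<zeta>" "j \<in> {1..Jb}" "\<gamma> \<in> Db" "\<zeta> \<in> Dc" unfolding Ub_def mem_Collect_eq by metis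
      show "u \<in> (\<lambda>(j, \<gamma>, \<zeta>). ub j \<gamma> \<zeta>) ` ({1..Jb} \<times> Db \<times> Dc)"
        by (rule image_eqI[of _ _ "(j, \<gamma>, \<zeta>)"]) (use u in simp_all)
    qed
    have finD: "finite ({1..Ja} \<times> Da)" "finite ({1..Jb} \<times> Db \<times> Dc)"
      unfolding Da_def Db_def Dc_def using T by (intro finite_SigmaI finite_PiE; simp)+
    have W1: "?W \<ge> 1"
    proof -
      have "1 \<le> 3 * ?m * Q" using Q by (simp add: Suc_le_eq)
      then show ?thesis by (simp only: one_le_numeral of_nat_1 flip: of_nat_le_iff)
    qed
    \<comment> \<open>The base \<open>3 * ?m * Q\<close> bounds both the \<open>2 * Q + 1\<close>
      differences of a single stream and the \<open>2 * ?m * Q + 1\<close> values of an aligned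
      coordinate.\<close>
    have range_le: "real (nat (int Q + int Q + 1)) \<le> ?W" "real (nat (int (?m * Q) + int (?m * Q) + 1)) \<le> ?W"
    proof -
      have "1 \<le> ?m" by (simp add: Suc_le_eq)
      then have "1 * Q \<le> ?m * Q" by (rule mult_le_mono1)
      then have "nat (int Q + int Q + 1) \<le> 3 * ?m * Q" "nat (int (?m * Q) + int (?m * Q) + 1) \<le> 3 * ?m * Q"
        using Q by linarith+
      then show "real (nat (int Q + int Q + 1)) \<le> ?W" "real (nat (int (?m * Q) + int (?m * Q) + 1)) \<le> ?W"
        by (simp_all only: of_nat_le_iff)
    qed
    \<comment> \<open>The assumption on \<open>L\<close> balances the receivers: per repetition
      \<open>a\<close> faces \<open>?m * card T\<close> unknowns, and \<open>b\<close> faces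
      \<open>card T' + L\<close>.\<close>
    have card_Da: "real (card Da) \<le> ?W ^ (N * (card T' + L))"
    proof -
      have "card Da = nat (int Q + int Q + 1) ^ (N * (?m * card T))"
        unfolding Da_def using T by (simp add: card_PiE)
      then have "real (card Da) = real (nat (int Q + int Q + 1)) ^ (N * (?m * card T))" by (simp only: of_nat_power)
      also have "\<dots> \<le> ?W ^ (N * (?m * card T))" by (intro power_mono range_le) auto
      also have "\<dots> \<le> ?W ^ (N * (card T' + L))" using L by (intro power_increasing W1) auto
      finally show ?thesis .
    qed
    have card_Dbc: "real (card (Db \<times> Dc)) \<le> ?W ^ (N * (card T' + L))"
    proof -
      have "card Db = nat (int (?m * Q) + int (?m * Q) + 1) ^ (N * card T')" "card Dc = nat (int Q + int Q + 1) ^ (N * L)"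
        unfolding Db_def Dc_def using T by (simp_all add: card_PiE)
      then have "real (card (Db \<times> Dc)) = real (nat (int (?m * Q) + int (?m * Q) + 1)) ^ (N * card T') * real (nat (int Q + int Q + 1)) ^ (N * L)"
        by (simp only: card_cartesian_product of_nat_mult of_nat_power)
      also have "\<dots> \<le> ?W ^ (N * card T') * ?W ^ (N * L)" by (intro mult_mono power_mono range_le) auto
      also have "\<dots> = ?W ^ (N * (card T' + L))" by (simp only: power_add distrib_left)
      finally show ?thesis .
    qed
    have U: "finite (Ua \<union> Ub)" "real (card (Ua \<union> Ub)) \<le> (real Ja + real Jb) * ?W ^ (N * (card T' + L))"
    proof -
      have "finite Ua" "finite Ub"
        using finite_subset[OF Ua finite_imageI[OF finD(1)]] finite_subset[OF Ub finite_imageI[OF finD(2)]] by simp_all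
      then show "finite (Ua \<union> Ub)" by simp
      have "card Ua \<le> card ({1..Ja} \<times> Da)" by (rule surj_card_le[OF finD(1) Ua])
      then have a: "real (card Ua) \<le> real Ja * real (card Da)" by (simp add: card_cartesian_product flip: of_nat_mult)
      have "card Ub \<le> card ({1..Jb} \<times> Db \<times> Dc)" by (rule surj_card_le[OF finD(2) Ub])
      also have "\<dots> = Jb * card (Db \<times> Dc)" by (subst card_cartesian_product) simp
      finally have b: "real (card Ub) \<le> real Jb * real (card (Db \<times> Dc))" by (simp only: of_nat_le_iff flip: of_nat_mult)
      have "real (card (Ua \<union> Ub)) \<le> real (card Ua) + real (card Ub)" using card_Un_le[of Ua Ub] by simp
      also have "\<dots> \<le> real Ja * ?W ^ (N * (card T' + L)) + real Jb * ?W ^ (N * (card T' + L))"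
        by (intro add_mono order.trans[OF a] order.trans[OF b] mult_left_mono card_Da card_Dbc of_nat_0_le_iff)
      finally show "real (card (Ua \<union> Ub)) \<le> (real Ja + real Jb) * ?W ^ (N * (card T' + L))"
        by (simp only: distrib_right)
    qed
    have W0: "?W ^ (N * (card T' + L)) > 0" using W1 by (intro zero_less_power) linarith
    obtain \<theta> :: "nat + nat \<times> nat \<Rightarrow> real" where \<theta>: "\<And>l. l \<in> ?I \<Longrightarrow> 0 \<le> \<theta> l \<and> \<theta> l \<le> 1"
      and sep: "\<And>u. u \<in> Ua \<union> Ub \<Longrightarrow> ?\<delta> \<le> \<bar>\<Sum>l\<in>?I. \<theta> l * u l\<bar>"
    proof (rule exists_separating_coefficients[of ?I "Ua \<union> Ub" \<mu> ?\<delta>])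
      show "finite ?I" by auto
      show "finite (Ua \<union> Ub)" by (rule U)
      show "\<mu> > 0" by (rule \<mu>0)
      show "?\<delta> > 0" using \<kappa>0 W0 by (rule divide_pos_pos)
      have "card (Ua \<union> Ub) * (2 * ?\<delta> / \<mu>) \<le> ((real Ja + real Jb) * ?W ^ (N * (card T' + L))) * (2 * ?\<delta> / \<mu>)"
        using U(2) \<kappa>0 W0 \<mu>0 by (intro mult_right_mono) auto
      also have "\<dots> = (real Ja + real Jb) * 2 / (4 * (real Ja + real Jb + 1))"
      proof -
        have *: "x * w * (2 * (\<mu> / (4 * y) / w) / \<mu>) = x * 2 / (4 * y)" if "w > 0" "y > 0" for x y w :: real
          using that \<mu>0 by (simp add: field_simps)
        show ?thesis unfolding \<kappa>_def by (rule *[OF W0]) simp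
      qed
      also have "\<dots> < 1" by (simp add: divide_less_eq)
      finally show "card (Ua \<union> Ub) * (2 * ?\<delta> / \<mu>) < 1" .
    next
      fix u assume "u \<in> Ua \<union> Ub"
      then consider j \<Delta> p where "j \<in> {1..Ja}" "\<Delta> \<in> Da" "p \<in> ?A" "\<Delta> p \<noteq> 0" "u = ua j \<Delta>"
        | j \<gamma> \<zeta> p where "j \<in> {1..Jb}" "p \<in> ?B" "\<zeta> p \<noteq> 0" "u = ub j \<gamma> \<zeta>"
        unfolding Ua_def Ub_def Un_iff mem_Collect_eq by metis
      then show "\<exists>l\<in>?I. \<mu> \<le> \<bar>u l\<bar>"
      proof cases
        case 1
        obtain k i e where p: "p = (k, i, e)" by (cases p)
        define c where "c = restrict (\<lambda>(i, e). \<Delta> (k, i, e)) (UNIV \<times> T)"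
        have "F j (\<lambda>(i, e). \<Delta> (k, i, e)) = F j c" by (auto simp: F_def c_def intro!: sum.cong)
        moreover have "c \<in> P" using 1 p by (auto simp: c_def P_def Da_def PiE_iff)
        moreover have "\<exists>p\<in>UNIV \<times> T. c p \<noteq> 0" using 1 p by (intro bexI[of _ "(i, e)"]) (auto simp: c_def)
        ultimately have "\<mu> \<le> \<bar>u (Inl k)\<bar>" using \<mu>F[of j c] 1 by (simp add: ua_def)
        then show ?thesis using 1 p by blast
      next
        case 2
        have "\<mu> * 1 \<le> \<bar>hb j \<bullet> v0\<bar> * \<bar>real_of_int (\<zeta> p)\<bar>"
          using 2 \<mu>v[of j] \<mu>0 by (intro mult_mono) auto
        then have "\<mu> \<le> \<bar>u (Inr p)\<bar>" using 2 by (simp add: ub_def abs_mult)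
        then show ?thesis using 2 by blast
      qed
    qed blast
    define X :: "(nat \<times> 'm \<times> 'e \<Rightarrow> nat) \<Rightarrow> (nat \<times> nat \<Rightarrow> nat) \<Rightarrow> real ^ 'm" where
      "X \<alpha> \<beta> = (\<Sum>k<N. \<theta> (Inl k) *\<^sub>R (\<chi> i. \<Sum>e\<in>T. real (\<alpha> (k, i, e)) * mon e)) + (\<Sum>p\<in>?B. \<theta> (Inr p) * real (\<beta> p)) *\<^sub>R v0" for \<alpha> \<beta>
    have sumI: "(\<Sum>l\<in>?I. f l) = (\<Sum>k<N. f (Inl k)) + (\<Sum>p\<in>?B. f (Inr p))" for f :: "nat + nat \<times> nat \<Rightarrow> real"
      by (subst sum.Plus) auto
    have inner_X: "g \<bullet> X \<alpha> \<beta> = (\<Sum>k<N. \<theta> (Inl k) * (\<Sum>(i, e)\<in>UNIV \<times> T. real (\<alpha> (k, i, e)) * (g $ i * mon e)))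
        + (\<Sum>p\<in>?B. \<theta> (Inr p) * (g \<bullet> v0 * real (\<beta> p)))" for g \<alpha> \<beta>
      unfolding X_def inner_add_right inner_sum_right inner_scaleR_right
      by (simp add: inner_vec_def[where 'b = 'm] sum.cartesian_product[symmetric] sum_distrib_left sum_distrib_right mult_ac)
    have norm_X: "norm (X \<alpha> \<beta>) \<le> B * (real N + 1)" if \<alpha>: "\<alpha> \<in> ?A \<rightarrow>\<^sub>E {..<Q}" and \<beta>: "\<beta> \<in> ?B \<rightarrow>\<^sub>E {..<Q}" for \<alpha> \<beta>
    proof -
      let ?S = "\<Sum>i\<in>(UNIV :: 'm set). \<Sum>e\<in>T. Q * \<bar>mon e\<bar>"
      have 1: "norm (\<theta> (Inl k) *\<^sub>R (\<chi> i. \<Sum>e\<in>T. real (\<alpha> (k, i, e)) * mon e)) \<le> ?S" if k: "k < N" for k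
      proof -
        let ?v = "\<chi> i. \<Sum>e\<in>T. real (\<alpha> (k, i, e)) * mon e"
        have "norm ?v \<le> (\<Sum>i\<in>UNIV. \<bar>?v $ i\<bar>)" by (rule norm_le_l1_cart)
        also have "\<dots> \<le> ?S"
        proof (rule sum_mono)
          fix i
          have "\<bar>?v $ i\<bar> \<le> (\<Sum>e\<in>T. \<bar>real (\<alpha> (k, i, e)) * mon e\<bar>)" by simp
          also have "\<dots> \<le> (\<Sum>e\<in>T. Q * \<bar>mon e\<bar>)"
          proof (rule sum_mono)
            fix e assume "e \<in> T"
            then have "\<alpha> (k, i, e) < Q" using \<alpha> k by (auto simp: PiE_iff)
            then show "\<bar>real (\<alpha> (k, i, e)) * mon e\<bar> \<le> Q * \<bar>mon e\<bar>" by (auto simp: abs_mult intro!: mult_right_mono)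
          qed
          finally show "\<bar>?v $ i\<bar> \<le> (\<Sum>e\<in>T. Q * \<bar>mon e\<bar>)" .
        qed
        finally have "norm ?v \<le> ?S" .
        moreover have "\<bar>\<theta> (Inl k)\<bar> \<le> 1" using \<theta>[OF InlI[of k]] k by simp
        ultimately have "\<bar>\<theta> (Inl k)\<bar> * norm ?v \<le> 1 * ?S" by (intro mult_mono) auto
        then show ?thesis by simp
      qed
      have 2: "\<bar>\<Sum>p\<in>?B. \<theta> (Inr p) * real (\<beta> p)\<bar> \<le> N * L * Q"
      proof -
        have "\<bar>\<Sum>p\<in>?B. \<theta> (Inr p) * real (\<beta> p)\<bar> \<le> (\<Sum>p\<in>?B. \<bar>\<theta> (Inr p) * real (\<beta> p)\<bar>)" by (rule sum_abs)
        also have "\<dots> \<le> (\<Sum>p\<in>?B. 1 * real Q)"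
        proof (rule sum_mono)
          fix p assume p: "p \<in> ?B"
          then have "\<bar>\<theta> (Inr p)\<bar> \<le> 1" using \<theta>[OF InrI[OF p]] by simp
          moreover have "\<beta> p < Q" using \<beta> p by (auto simp: PiE_iff)
          ultimately show "\<bar>\<theta> (Inr p) * real (\<beta> p)\<bar> \<le> 1 * real Q" unfolding abs_mult by (intro mult_mono) auto
        qed
        also have "\<dots> = N * L * Q" by simp
        finally show ?thesis .
      qed
      have "norm (X \<alpha> \<beta>) \<le> norm (\<Sum>k<N. \<theta> (Inl k) *\<^sub>R (\<chi> i. \<Sum>e\<in>T. real (\<alpha> (k, i, e)) * mon e)) + \<bar>\<Sum>p\<in>?B. \<theta> (Inr p) * real (\<beta> p)\<bar> * norm v0"
        unfolding X_def by (rule order.trans[OF norm_triangle_ineq]) simp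
      also have "\<dots> \<le> (\<Sum>k<N. ?S) + N * L * Q * norm v0"
        by (intro add_mono mult_right_mono 2 order.trans[OF norm_sum sum_mono]) (use 1 in auto)
      also have "\<dots> = N * (?S + L * Q * norm v0)" by (simp add: algebra_simps)
      also have "\<dots> \<le> (real N + 1) * B"
        using B0 by (intro mult_mono) (auto simp: B_def intro!: add_nonneg_nonneg)
      finally show ?thesis by (simp add: mult.commute)
    qed
    have sep_a: "?\<delta> \<le> \<bar>ha j \<bullet> X \<alpha> \<beta> - ha j \<bullet> X \<alpha>' \<beta>'\<bar>"
      if \<alpha>: "\<alpha> \<in> ?A \<rightarrow>\<^sub>E {..<Q}" "\<alpha>' \<in> ?A \<rightarrow>\<^sub>E {..<Q}" "\<alpha> \<noteq> \<alpha>'" and j: "j \<in> {1..Ja}" for \<alpha> \<alpha>' \<beta> \<beta>' j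
    proof -
      define \<Delta> where "\<Delta> = restrict (\<lambda>p. int (\<alpha> p) - int (\<alpha>' p)) ?A"
      obtain p where "p \<in> ?A" "\<alpha> p \<noteq> \<alpha>' p" using \<alpha> PiE_ext[of \<alpha> ?A "\<lambda>_. {..<Q}" \<alpha>'] by blast
      then have ne: "\<exists>p\<in>?A. \<Delta> p \<noteq> 0" by (intro bexI[of _ p]) (auto simp: \<Delta>_def)
      have "\<Delta> p \<in> {- int Q..int Q}" if p: "p \<in> ?A" for p
      proof -
        have "\<alpha> p < Q" "\<alpha>' p < Q" using \<alpha> p by (auto simp: PiE_iff)
        then show ?thesis using p by (auto simp: \<Delta>_def)
      qed
      then have "\<Delta> \<in> Da" unfolding Da_def by (intro PiE_I) (auto simp: \<Delta>_def)
      then have "ua j \<Delta> \<in> Ua \<union> Ub" unfolding Ua_def using j ne by blast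
      from sep[OF this] have "?\<delta> \<le> \<bar>\<Sum>k<N. \<theta> (Inl k) * F j (\<lambda>(i, e). \<Delta> (k, i, e))\<bar>"
        unfolding sumI by (simp add: ua_def)
      also have "(\<Sum>k<N. \<theta> (Inl k) * F j (\<lambda>(i, e). \<Delta> (k, i, e))) = ha j \<bullet> X \<alpha> \<beta> - ha j \<bullet> X \<alpha>' \<beta>'"
      proof -
        have "F j (\<lambda>(i, e). \<Delta> (k, i, e)) = (\<Sum>(i, e)\<in>UNIV \<times> T. real (\<alpha> (k, i, e)) * (ha j $ i * mon e))
            - (\<Sum>(i, e)\<in>UNIV \<times> T. real (\<alpha>' (k, i, e)) * (ha j $ i * mon e))" if "k < N" for k
          unfolding F_def sum_subtractf[symmetric] using that
          by (intro sum.cong) (auto simp: \<Delta>_def left_diff_distrib)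
        then show ?thesis unfolding inner_X using v0(1)[OF j] by (simp add: right_diff_distrib sum_subtractf)
      qed
      finally show ?thesis .
    qed
    have sep_b: "?\<delta> \<le> \<bar>hb j \<bullet> X \<alpha> \<beta> - hb j \<bullet> X \<alpha>' \<beta>'\<bar>"
      if \<alpha>: "\<alpha> \<in> ?A \<rightarrow>\<^sub>E {..<Q}" "\<alpha>' \<in> ?A \<rightarrow>\<^sub>E {..<Q}"
        and \<beta>: "\<beta> \<in> ?B \<rightarrow>\<^sub>E {..<Q}" "\<beta>' \<in> ?B \<rightarrow>\<^sub>E {..<Q}" "\<beta> \<noteq> \<beta>'" and j: "j \<in> {1..Jb}" for \<alpha> \<alpha>' \<beta> \<beta>' j
    proof -
      define \<Delta> where "\<Delta> p = int (\<alpha> p) - int (\<alpha>' p)" for p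
      have \<Delta>: "\<bar>\<Delta> p\<bar> \<le> int Q" if "p \<in> ?A" for p
      proof -
        have "\<alpha> p < Q" "\<alpha>' p < Q" using \<alpha> that by (auto simp: PiE_iff)
        then show ?thesis by (auto simp: \<Delta>_def)
      qed
      define \<zeta> where "\<zeta> = restrict (\<lambda>p. int (\<beta> p) - int (\<beta>' p)) ?B"
      obtain p where "p \<in> ?B" "\<beta> p \<noteq> \<beta>' p" using \<beta> PiE_ext[of \<beta> ?B "\<lambda>_. {..<Q}" \<beta>'] by blast
      then have ne: "\<exists>p\<in>?B. \<zeta> p \<noteq> 0" by (intro bexI[of _ p]) (auto simp: \<zeta>_def)
      have "\<zeta> p \<in> {- int Q..int Q}" if p: "p \<in> ?B" for p
      proof -
        have "\<beta> p < Q" "\<beta>' p < Q" using \<beta> p by (auto simp: PiE_iff)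
        then show ?thesis using p by (auto simp: \<zeta>_def)
      qed
      then have \<zeta>: "\<zeta> \<in> Dc" unfolding Dc_def by (intro PiE_I) (auto simp: \<zeta>_def)
      \<comment> \<open>Regrouping by the shifted direction: the integer with which
        \<open>mon e'\<close> arrives at state \<open>j\<close> of \<open>b\<close>. As
        \<open>sh j i\<close> is injective, each antenna contributes at most one difference, whence
        the range \<open>?m * Q\<close>.\<close>
      define \<gamma> where "\<gamma> = restrict (\<lambda>(k, e'). \<Sum>i\<in>(UNIV :: 'm set). \<Sum>e\<in>{e \<in> T. sh j i e = e'}. \<Delta> (k, i, e)) ({..<N} \<times> T')"
      have \<gamma>: "\<gamma> \<in> Db"
        unfolding Db_def
      proof (rule PiE_I)
        fix p assume "p \<in> {..<N} \<times> T'"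
        then obtain k e' where p: "p = (k, e')" "k < N" "e' \<in> T'" by auto
        have "\<bar>\<gamma> p\<bar> \<le> (\<Sum>i\<in>(UNIV :: 'm set). \<bar>\<Sum>e\<in>{e \<in> T. sh j i e = e'}. \<Delta> (k, i, e)\<bar>)"
          using p by (simp add: \<gamma>_def)
        also have "\<dots> \<le> (\<Sum>i\<in>(UNIV :: 'm set). int Q)"
        proof (rule sum_mono)
          fix i :: 'm
          show "\<bar>\<Sum>e\<in>{e \<in> T. sh j i e = e'}. \<Delta> (k, i, e)\<bar> \<le> int Q"
          proof (cases "\<exists>e\<in>T. sh j i e = e'")
            case True
            then obtain e where e: "e \<in> T" "sh j i e = e'" by blast
            then have "{e \<in> T. sh j i e = e'} = {e}" using sh(1)[OF j, of i] by (auto simp: inj_on_def)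
            then show ?thesis using \<Delta>[of "(k, i, e)"] e p by simp
          next
            case False
            then have "{e \<in> T. sh j i e = e'} = {}" by blast
            then show ?thesis by (simp only: sum.empty)
          qed
        qed
        finally show "\<gamma> p \<in> {- int (?m * Q)..int (?m * Q)}" by (auto simp: abs_le_iff)
      qed (auto simp: \<gamma>_def)
      have "ub j \<gamma> \<zeta> \<in> Ua \<union> Ub" unfolding Ub_def using j ne \<gamma> \<zeta> by blast
      from sep[OF this] have "?\<delta> \<le> \<bar>(\<Sum>k<N. \<theta> (Inl k) * (\<Sum>e\<in>T'. real_of_int (\<gamma> (k, e)) * mon e)) + (\<Sum>p\<in>?B. \<theta> (Inr p) * (hb j \<bullet> v0 * real_of_int (\<zeta> p)))\<bar>"
        unfolding sumI by (simp add: ub_def)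
      also have "(\<Sum>k<N. \<theta> (Inl k) * (\<Sum>e\<in>T'. real_of_int (\<gamma> (k, e)) * mon e)) + (\<Sum>p\<in>?B. \<theta> (Inr p) * (hb j \<bullet> v0 * real_of_int (\<zeta> p)))
          = hb j \<bullet> X \<alpha> \<beta> - hb j \<bullet> X \<alpha>' \<beta>'"
      proof -
        have 1: "(\<Sum>e\<in>T'. real_of_int (\<gamma> (k, e)) * mon e) = (\<Sum>(i, e)\<in>UNIV \<times> T. real (\<alpha> (k, i, e)) * (hb j $ i * mon e))
            - (\<Sum>(i, e)\<in>UNIV \<times> T. real (\<alpha>' (k, i, e)) * (hb j $ i * mon e))" if "k < N" for k
        proof -
          have "(\<Sum>e\<in>T'. real_of_int (\<gamma> (k, e)) * mon e)
              = (\<Sum>e'\<in>T'. \<Sum>i\<in>(UNIV :: 'm set). \<Sum>e\<in>{e \<in> T. sh j i e = e'}. real_of_int (\<Delta> (k, i, e)) * mon (sh j i e))"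
            using that by (intro sum.cong) (auto simp: \<gamma>_def sum_distrib_right)
          also have "\<dots> = (\<Sum>i\<in>(UNIV :: 'm set). \<Sum>e'\<in>T'. \<Sum>e\<in>{e \<in> T. sh j i e = e'}. real_of_int (\<Delta> (k, i, e)) * mon (sh j i e))"
            by (rule sum.swap)
          also have "\<dots> = (\<Sum>i\<in>(UNIV :: 'm set). \<Sum>e\<in>T. real_of_int (\<Delta> (k, i, e)) * mon (sh j i e))"
            by (intro sum.cong refl sum.group T sh j)
          also have "\<dots> = (\<Sum>i\<in>(UNIV :: 'm set). \<Sum>e\<in>T. real_of_int (\<Delta> (k, i, e)) * (hb j $ i * mon e))"
            by (intro sum.cong refl) (simp add: sh(3)[OF j])
          finally show ?thesis
            by (simp add: \<Delta>_def left_diff_distrib sum_subtractf sum.cartesian_product[symmetric])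
        qed
        have 2: "real_of_int (\<zeta> p) = real (\<beta> p) - real (\<beta>' p)" if "p \<in> ?B" for p
          using that by (simp add: \<zeta>_def)
        have "(\<Sum>k<N. \<theta> (Inl k) * (\<Sum>e\<in>T'. real_of_int (\<gamma> (k, e)) * mon e))
            = (\<Sum>k<N. \<theta> (Inl k) * (\<Sum>(i, e)\<in>UNIV \<times> T. real (\<alpha> (k, i, e)) * (hb j $ i * mon e)))
            - (\<Sum>k<N. \<theta> (Inl k) * (\<Sum>(i, e)\<in>UNIV \<times> T. real (\<alpha>' (k, i, e)) * (hb j $ i * mon e)))"
          by (simp add: 1 right_diff_distrib sum_subtractf)
        moreover have "(\<Sum>p\<in>?B. \<theta> (Inr p) * (hb j \<bullet> v0 * real_of_int (\<zeta> p)))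
            = (\<Sum>p\<in>?B. \<theta> (Inr p) * (hb j \<bullet> v0 * real (\<beta> p))) - (\<Sum>p\<in>?B. \<theta> (Inr p) * (hb j \<bullet> v0 * real (\<beta>' p)))"
          unfolding sum_subtractf[symmetric] right_diff_distrib[symmetric] by (intro sum.cong refl) (simp only: 2)
        ultimately show ?thesis unfolding inner_X by simp
      qed
      finally show ?thesis .
    qed
    show "\<exists>X :: (nat \<times> 'm \<times> 'e \<Rightarrow> nat) \<Rightarrow> (nat \<times> nat \<Rightarrow> nat) \<Rightarrow> real ^ 'm.
       \<forall>\<alpha>\<in>?A \<rightarrow>\<^sub>E {..<Q}. \<forall>\<beta>\<in>?B \<rightarrow>\<^sub>E {..<Q}.
         norm (X \<alpha> \<beta>) \<le> B * (real N + 1) \<and>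
         (\<forall>\<alpha>'\<in>?A \<rightarrow>\<^sub>E {..<Q}. \<forall>\<beta>'\<in>?B \<rightarrow>\<^sub>E {..<Q}.
           (\<alpha> \<noteq> \<alpha>' \<longrightarrow> (\<forall>j\<in>{1..Ja}. ?\<delta> \<le> \<bar>ha j \<bullet> X \<alpha> \<beta> - ha j \<bullet> X \<alpha>' \<beta>'\<bar>)) \<and>
           (\<beta> \<noteq> \<beta>' \<longrightarrow> (\<forall>j\<in>{1..Jb}. ?\<delta> \<le> \<bar>hb j \<bullet> X \<alpha> \<beta> - hb j \<bullet> X \<alpha>' \<beta>'\<bar>)))"
      by (intro exI[of _ X] ballI conjI impI; (rule norm_X sep_a sep_b; assumption))
  qed
qed

subsection \<open>Generic channel coefficients\<close>

text \<open>The polynomial is fixed before the null set, and its coefficients are real. Real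
  coefficients are what the induction over coordinates calls for: fixing some coordinates turns them
  into coefficients of a polynomial in the others. A null set common to all polynomials is formed
  later, over the integers.\<close>

definition generic_coords :: "'x measure \<Rightarrow> 'i set \<Rightarrow> ('i \<Rightarrow> 'x \<Rightarrow> real) \<Rightarrow> bool" where
  "generic_coords M I \<phi> \<longleftrightarrow> (\<forall>i\<in>I. \<phi> i \<in> borel_measurable M) \<and>
     (\<forall>D c. (\<exists>e\<in>I \<rightarrow>\<^sub>E {..D :: nat}. c e \<noteq> 0) \<longrightarrow>
        (AE x in M. (\<Sum>e\<in>I \<rightarrow>\<^sub>E {..D}. c e * (\<Prod>i\<in>I. \<phi> i x ^ e i)) \<noteq> 0))"

lemma generic_coordsD:
  "generic_coords M I \<phi> \<Longrightarrow> \<exists>e\<in>I \<rightarrow>\<^sub>E {..D}. c e \<noteq> 0 \<Longrightarrow>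
    AE x in M. (\<Sum>e\<in>I \<rightarrow>\<^sub>E {..D}. c e * (\<Prod>i\<in>I. \<phi> i x ^ e i)) \<noteq> 0"
  by (simp add: generic_coords_def)

lemma generic_coords_empty: "generic_coords M {} \<phi>"
  by (auto simp: generic_coords_def)

text \<open>A nonzero polynomial in one variable has finitely many roots; \<iota> identifies a
  degree with an exponent vector of one entry.\<close>

lemma generic_coords_lborel: "generic_coords lborel {i} (\<lambda>_ x. x)"
  unfolding generic_coords_def
proof (intro conjI ballI allI impI)
  fix D :: nat and c :: "('a \<Rightarrow> nat) \<Rightarrow> real"
  assume "\<exists>e\<in>{i} \<rightarrow>\<^sub>E {..D}. c e \<noteq> 0"
  then obtain e where e: "e \<in> {i} \<rightarrow>\<^sub>E {..D}" "c e \<noteq> 0" by blast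
  define \<iota> :: "nat \<Rightarrow> 'a \<Rightarrow> nat" where "\<iota> k = (\<lambda>_\<in>{i}. k)" for k
  have \<iota>: "\<iota> (e' i) = e'" if "e' \<in> {i} \<rightarrow>\<^sub>E {..D}" for e'
    using that by (auto simp: \<iota>_def PiE_iff extensional_def)
  have \<iota>': "\<iota> k i = k" "k \<le> D \<Longrightarrow> \<iota> k \<in> {i} \<rightarrow>\<^sub>E {..D}" for k
    unfolding \<iota>_def by simp_all
  have eq: "(\<Sum>e\<in>{i} \<rightarrow>\<^sub>E {..D}. c e * (\<Prod>i\<in>{i}. x ^ e i)) = (\<Sum>k\<le>D. c (\<iota> k) * x ^ k)" for x
    by (rule sum.reindex_bij_witness[where i = \<iota> and j = "\<lambda>e. e i"]) (auto simp: \<iota> \<iota>')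
  have "finite {x. (\<Sum>k\<le>D. c (\<iota> k) * x ^ k) = 0}"
    unfolding polyfun_finite_roots using e \<iota>[OF e(1)] by (intro exI[of _ "e i"]) auto
  then have "{x. (\<Sum>k\<le>D. c (\<iota> k) * x ^ k) = 0} \<in> null_sets lborel"
    by (rule finite_imp_null_set_lborel)
  then show "AE x in lborel. (\<Sum>e\<in>{i} \<rightarrow>\<^sub>E {..D}. c e * (\<Prod>i\<in>{i}. x ^ e i)) \<noteq> 0"
    unfolding eq by (rule AE_I') auto
qed simp

text \<open>Applied to Lebesgue measure on vectors, which is the image of a product measure over the
  axes.\<close>

lemma generic_coords_distr:
  fixes I :: "'k set"
  assumes T: "T \<in> M \<rightarrow>\<^sub>M N" and \<phi>: "\<And>i. i \<in> I \<Longrightarrow> \<phi> i \<in> borel_measurable N"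
    and gen: "generic_coords M I (\<lambda>i x. \<phi> i (T x))"
  shows "generic_coords (distr M N T) I \<phi>"
  unfolding generic_coords_def
proof (intro conjI ballI allI impI)
  fix D :: nat and c :: "('k \<Rightarrow> nat) \<Rightarrow> real"
  assume "\<exists>e\<in>I \<rightarrow>\<^sub>E {..D}. c e \<noteq> 0"
  then have "AE x in M. (\<Sum>e\<in>I \<rightarrow>\<^sub>E {..D}. c e * (\<Prod>i\<in>I. \<phi> i (T x) ^ e i)) \<noteq> 0"
    using gen by (simp add: generic_coords_def)
  moreover have "{x \<in> space N. (\<Sum>e\<in>I \<rightarrow>\<^sub>E {..D}. c e * (\<Prod>i\<in>I. \<phi> i x ^ e i)) \<noteq> 0} \<in> sets N"
    using \<phi> by measurable
  ultimately show "AE x in distr M N T. (\<Sum>e\<in>I \<rightarrow>\<^sub>E {..D}. c e * (\<Prod>i\<in>I. \<phi> i x ^ e i)) \<noteq> 0"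
    by (simp add: AE_distr_iff[OF T])
qed (simp add: \<phi>)

context product_sigma_finite
begin

lemma AE_PiM_insert:
  assumes S: "finite S" "s \<notin> S" and P: "{x \<in> space (PiM (insert s S) M). P x} \<in> sets (PiM (insert s S) M)"
    and ae: "AE x in PiM S M. AE y in M s. P (x(s := y))"
  shows "AE x in PiM (insert s S) M. P x"
proof -
  let ?B = "{x \<in> space (PiM (insert s S) M). \<not> P x}"
  have B: "?B \<in> sets (PiM (insert s S) M)" using P by (rule sets.sets_Collect_neg)
  have "emeasure (PiM (insert s S) M) ?B = (\<integral>\<^sup>+x. indicator ?B x \<partial>PiM (insert s S) M)" using B by simp
  also have "\<dots> = (\<integral>\<^sup>+x. \<integral>\<^sup>+y. indicator ?B (x(s := y)) \<partial>M s \<partial>PiM S M)"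
    using B by (intro product_nn_integral_insert S) auto
  also have "\<dots> = (\<integral>\<^sup>+x. 0 \<partial>PiM S M)"
  proof (rule nn_integral_cong_AE, use ae in eventually_elim)
    fix x assume "AE y in M s. P (x(s := y))"
    then have "(\<integral>\<^sup>+y. indicator ?B (x(s := y)) \<partial>M s) = (\<integral>\<^sup>+y. 0 \<partial>M s)"
      by (intro nn_integral_cong_AE) (auto elim!: eventually_mono)
    then show "(\<integral>\<^sup>+y. indicator ?B (x(s := y)) \<partial>M s) = 0" by simp
  qed
  finally have "emeasure (PiM (insert s S) M) ?B = 0" by simp
  then show ?thesis using B by (intro AE_I[of _ _ ?B]) auto
qed

text \<open>Group the polynomial by monomials in the \<open>J\<close>-coordinates. Its coefficients
  \<open>c' x\<close> are polynomials in the \<open>I\<close>-coordinates, at least one of them with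
  a nonzero coefficient, so almost every \<open>x\<close> leaves a nonzero polynomial in the new
  factor. Coordinates and factors are indexed separately because a factor may itself be a
  vector.\<close>

lemma generic_coords_insert:
  fixes I J :: "'k set"
  assumes S: "finite S" "s \<notin> S" and IJ: "finite I" "finite J" "I \<inter> J = {}"
    and gen: "generic_coords (PiM S M) I \<phi>" "generic_coords (M s) J \<psi>"
    and meas: "\<And>i. i \<in> I \<union> J \<Longrightarrow> \<omega> i \<in> borel_measurable (PiM (insert s S) M)"
    and \<omega>: "\<And>i x y. i \<in> I \<Longrightarrow> \<omega> i (x(s := y)) = \<phi> i x" "\<And>j x y. j \<in> J \<Longrightarrow> \<omega> j (x(s := y)) = \<psi> j y"
  shows "generic_coords (PiM (insert s S) M) (I \<union> J) \<omega>"
  unfolding generic_coords_def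
proof (intro conjI ballI allI impI)
  fix D :: nat and c :: "('k \<Rightarrow> nat) \<Rightarrow> real"
  assume "\<exists>e\<in>I \<union> J \<rightarrow>\<^sub>E {..D}. c e \<noteq> 0"
  then obtain e0 where e0: "e0 \<in> I \<union> J \<rightarrow>\<^sub>E {..D}" "c e0 \<noteq> 0" by blast
  define c' where "c' x e2 = (\<Sum>e1\<in>I \<rightarrow>\<^sub>E {..D}. c (merge I J (e1, e2)) * (\<Prod>i\<in>I. \<phi> i x ^ e1 i))" for x e2
  have split: "(\<Sum>e\<in>I \<union> J \<rightarrow>\<^sub>E {..D}. c e * (\<Prod>i\<in>I \<union> J. \<omega> i (x(s := y)) ^ e i))
      = (\<Sum>e2\<in>J \<rightarrow>\<^sub>E {..D}. c' x e2 * (\<Prod>j\<in>J. \<psi> j y ^ e2 j))" for x y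
  proof -
    have "(\<Sum>e\<in>I \<union> J \<rightarrow>\<^sub>E {..D}. c e * (\<Prod>i\<in>I \<union> J. \<omega> i (x(s := y)) ^ e i))
        = (\<Sum>(e2, e1)\<in>(J \<rightarrow>\<^sub>E {..D}) \<times> (I \<rightarrow>\<^sub>E {..D}). c (merge I J (e1, e2)) * (\<Prod>i\<in>I. \<phi> i x ^ e1 i) * (\<Prod>j\<in>J. \<psi> j y ^ e2 j))"
    proof (rule sum.reindex_bij_witness[where i = "\<lambda>(e2, e1). merge I J (e1, e2)" and j = "\<lambda>e. (restrict e J, restrict e I)"])
      fix e assume e: "e \<in> I \<union> J \<rightarrow>\<^sub>E {..D}"
      then have mrg: "merge I J (restrict e I, restrict e J) = e" by (auto simp: merge_def PiE_iff extensional_def fun_eq_iff)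
      then show "(case (restrict e J, restrict e I) of (e2, e1) \<Rightarrow> merge I J (e1, e2)) = e" by simp
      show "(restrict e J, restrict e I) \<in> (J \<rightarrow>\<^sub>E {..D}) \<times> (I \<rightarrow>\<^sub>E {..D})" using e by (auto simp: PiE_iff)
      have "(\<Prod>i\<in>I \<union> J. \<omega> i (x(s := y)) ^ e i) = (\<Prod>i\<in>I. \<omega> i (x(s := y)) ^ e i) * (\<Prod>i\<in>J. \<omega> i (x(s := y)) ^ e i)"
        by (rule prod.union_disjoint) (use IJ in auto)
      also have "\<dots> = (\<Prod>i\<in>I. \<phi> i x ^ e i) * (\<Prod>j\<in>J. \<psi> j y ^ e j)"
        by (intro arg_cong2[where f = "(*)"] prod.cong refl) (simp_all add: \<omega>)
      finally show "(case (restrict e J, restrict e I) of (e2, e1) \<Rightarrow> c (merge I J (e1, e2)) * (\<Prod>i\<in>I. \<phi> i x ^ e1 i) * (\<Prod>j\<in>J. \<psi> j y ^ e2 j))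
          = c e * (\<Prod>i\<in>I \<union> J. \<omega> i (x(s := y)) ^ e i)"
        by (simp add: PiE_restrict[OF e])
    next
      fix p assume "p \<in> (J \<rightarrow>\<^sub>E {..D}) \<times> (I \<rightarrow>\<^sub>E {..D})"
      then obtain e2 e1 where p: "p = (e2, e1)" "e2 \<in> J \<rightarrow>\<^sub>E {..D}" "e1 \<in> I \<rightarrow>\<^sub>E {..D}" by auto
      show "(case p of (e2, e1) \<Rightarrow> merge I J (e1, e2)) \<in> I \<union> J \<rightarrow>\<^sub>E {..D}"
        using p by (auto simp: merge_def PiE_iff extensional_def)
      have "restrict (merge I J (e1, e2)) J = e2" "restrict (merge I J (e1, e2)) I = e1"
        using p IJ(3) by (auto simp: merge_def PiE_iff extensional_def fun_eq_iff)
      then show "(restrict (case p of (e2, e1) \<Rightarrow> merge I J (e1, e2)) J, restrict (case p of (e2, e1) \<Rightarrow> merge I J (e1, e2)) I) = p"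
        using p by simp
    qed
    also have "\<dots> = (\<Sum>e2\<in>J \<rightarrow>\<^sub>E {..D}. c' x e2 * (\<Prod>j\<in>J. \<psi> j y ^ e2 j))"
      by (simp add: sum.cartesian_product[symmetric] c'_def sum_distrib_right)
    finally show ?thesis .
  qed
  have "merge I J (restrict e0 I, restrict e0 J) = e0" using e0 by (auto simp: merge_def PiE_iff extensional_def fun_eq_iff)
  then have "\<exists>e1\<in>I \<rightarrow>\<^sub>E {..D}. c (merge I J (e1, restrict e0 J)) \<noteq> 0"
    using e0 by (intro bexI[of _ "restrict e0 I"]) (auto simp: PiE_iff)
  then have "AE x in PiM S M. c' x (restrict e0 J) \<noteq> 0"
    using generic_coordsD[OF gen(1), of D "\<lambda>e1. c (merge I J (e1, restrict e0 J))"] unfolding c'_def by simp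
  then have ae: "AE x in PiM S M. AE y in M s. (\<Sum>e2\<in>J \<rightarrow>\<^sub>E {..D}. c' x e2 * (\<Prod>j\<in>J. \<psi> j y ^ e2 j)) \<noteq> 0"
  proof eventually_elim
    case (elim x)
    moreover have "restrict e0 J \<in> J \<rightarrow>\<^sub>E {..D}" using e0 by (auto simp: PiE_iff)
    ultimately show ?case by (intro generic_coordsD[OF gen(2)]) blast
  qed
  show "AE x in PiM (insert s S) M. (\<Sum>e\<in>I \<union> J \<rightarrow>\<^sub>E {..D}. c e * (\<Prod>i\<in>I \<union> J. \<omega> i x ^ e i)) \<noteq> 0"
  proof (rule AE_PiM_insert[OF S])
    show "{x \<in> space (PiM (insert s S) M). (\<Sum>e\<in>I \<union> J \<rightarrow>\<^sub>E {..D}. c e * (\<Prod>i\<in>I \<union> J. \<omega> i x ^ e i)) \<noteq> 0} \<in> sets (PiM (insert s S) M)"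
      using meas by measurable
  qed (unfold split, rule ae)
qed (rule meas)

end

lemma generic_coords_vec: "generic_coords (lborel :: (real ^ 'm::finite) measure) ({s} \<times> UNIV) (\<lambda>(s, i) x. x $ i)"
proof -
  interpret product_sigma_finite "\<lambda>_ :: real ^ 'm. lborel :: real measure" by unfold_locales
  let ?ax = "\<lambda>i :: 'm. axis i (1 :: real)"
  have "generic_coords (\<Pi>\<^sub>M b\<in>?ax ` A. lborel) ({s} \<times> A) (\<lambda>(s, i) f. f (?ax i))" if "finite A" for A
    using that
  proof (induction A)
    case empty
    then show ?case using generic_coords_empty by simp
  next
    case (insert i A)
    have "generic_coords (\<Pi>\<^sub>M b\<in>insert (?ax i) (?ax ` A). lborel) (({s} \<times> A) \<union> {(s, i)}) (\<lambda>(s, i) f. f (?ax i))"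
    proof (rule generic_coords_insert[OF _ _ _ _ _ insert.IH generic_coords_lborel])
      show "?ax i \<notin> ?ax ` A" using insert by (auto simp: axis_eq_axis)
      show "(case p of (s, i) \<Rightarrow> \<lambda>f. f (?ax i)) (x(?ax i := y)) = (case p of (s, i) \<Rightarrow> \<lambda>f. f (?ax i)) x"
        if "p \<in> {s} \<times> A" for p x and y :: real
        using that insert by (auto simp: axis_eq_axis)
    qed (use insert in \<open>auto simp: axis_eq_axis\<close>)
    moreover have "({s} \<times> A) \<union> {(s, i)} = {s} \<times> insert i A" by auto
    ultimately show ?case by simp
  qed
  from this[of UNIV] have gen: "generic_coords (\<Pi>\<^sub>M b\<in>range ?ax. lborel) ({s} \<times> UNIV) (\<lambda>(s, i) f. f (?ax i))" by simp
  have B: "(Basis :: (real ^ 'm) set) = range ?ax" by (auto simp: Basis_vec_def)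
  have "lborel = distr (\<Pi>\<^sub>M b\<in>range ?ax. lborel) borel (\<lambda>f. \<Sum>b\<in>range ?ax. f b *\<^sub>R b)"
    using lborel_eq[where 'a = "real ^ 'm"] unfolding B .
  moreover have "generic_coords (distr (\<Pi>\<^sub>M b\<in>range ?ax. lborel) borel (\<lambda>f. \<Sum>b\<in>range ?ax. f b *\<^sub>R b)) ({s} \<times> UNIV) (\<lambda>(s, i) x. x $ i)"
  proof (rule generic_coords_distr)
    have "(\<Sum>b\<in>range ?ax. f b *\<^sub>R b) $ i = f (?ax i)" for f and i :: 'm
    proof -
      have "inj ?ax" by (auto simp: inj_on_def axis_eq_axis)
      then have "(\<Sum>b\<in>range ?ax. f b *\<^sub>R b) $ i = (\<Sum>k\<in>UNIV. f (?ax k) * ?ax k $ i)" by (simp add: sum.reindex)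
      also have "\<dots> = (\<Sum>k\<in>UNIV. if k = i then f (?ax k) else 0)" by (intro sum.cong) (auto simp: axis_def)
      finally show ?thesis by simp
    qed
    then show "generic_coords (\<Pi>\<^sub>M b\<in>range ?ax. lborel) ({s} \<times> UNIV) (\<lambda>i x. (case i of (s, i) \<Rightarrow> \<lambda>x. x $ i) (\<Sum>b\<in>range ?ax. x b *\<^sub>R b))"
      using gen by (simp add: case_prod_beta')
  qed (auto simp: case_prod_beta')
  ultimately show ?thesis by simp
qed

lemma generic_coords_PiM_vec:
  assumes "finite S"
  shows "generic_coords (\<Pi>\<^sub>M s\<in>S. lborel :: (real ^ 'm::finite) measure) (S \<times> UNIV) (\<lambda>(s, i) h. h s $ i)"
  using assms
proof (induction S)
  case empty
  then show ?case using generic_coords_empty by simp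
next
  case (insert s S)
  interpret product_sigma_finite "\<lambda>_. lborel :: (real ^ 'm) measure" by unfold_locales
  have "generic_coords (\<Pi>\<^sub>M s\<in>insert s S. lborel :: (real ^ 'm::finite) measure) ((S \<times> UNIV) \<union> ({s} \<times> UNIV)) (\<lambda>(s, i) h. h s $ i)"
  proof (rule generic_coords_insert[OF _ _ _ _ _ insert.IH generic_coords_vec[of s]])
    fix p :: "'a \<times> 'm" assume p: "p \<in> (S \<times> UNIV) \<union> ({s} \<times> UNIV)"
    have "(\<lambda>h. h (fst p)) \<in> (\<Pi>\<^sub>M s\<in>insert s S. lborel :: (real ^ 'm) measure) \<rightarrow>\<^sub>M lborel"
      by (rule measurable_component_singleton) (use p in auto)
    moreover have "(\<lambda>x :: real ^ 'm. x $ snd p) \<in> borel_measurable lborel" by simp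
    ultimately have "(\<lambda>h. h (fst p) $ snd p) \<in> borel_measurable (\<Pi>\<^sub>M s\<in>insert s S. lborel :: (real ^ 'm) measure)"
      by (rule measurable_compose)
    then show "(case p of (s, i) \<Rightarrow> \<lambda>h. h s $ i) \<in> borel_measurable (\<Pi>\<^sub>M s\<in>insert s S. lborel :: (real ^ 'm) measure)"
      by (simp add: case_prod_beta')
  qed (use insert in \<open>auto simp: case_prod_beta'\<close>)
  moreover have "(S \<times> UNIV) \<union> ({s} \<times> (UNIV :: 'm set)) = insert s S \<times> UNIV" by auto
  ultimately show ?case by simp
qed

section \<open>Algebraic independence of a realization\<close>

text \<open>Algebraic independence over the rationals with denominators cleared. Extensional
  families \<open>c\<close> on a finite index set are countable in number, which permits a common
  null set.\<close>

definition algebraically_generic :: "'s set \<Rightarrow> ('s \<Rightarrow> real ^ 'm::finite) \<Rightarrow> bool" where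
  "algebraically_generic S h \<longleftrightarrow> (\<forall>D. \<forall>c\<in>((S \<times> UNIV) \<rightarrow>\<^sub>E {..D :: nat}) \<rightarrow>\<^sub>E (UNIV :: int set).
     (\<exists>e\<in>(S \<times> UNIV) \<rightarrow>\<^sub>E {..D}. c e \<noteq> 0) \<longrightarrow>
     (\<Sum>e\<in>(S \<times> UNIV) \<rightarrow>\<^sub>E {..D}. real_of_int (c e) * (\<Prod>(s, i)\<in>S \<times> UNIV. h s $ i ^ e (s, i))) \<noteq> 0)"

lemma AE_algebraically_generic:
  assumes S: "finite S"
  shows "AE h in (\<Pi>\<^sub>M s\<in>S. lborel :: (real ^ 'm::finite) measure). algebraically_generic S h"
  unfolding algebraically_generic_def AE_all_countable
proof
  fix D :: nat
  let ?E = "(S \<times> (UNIV :: 'm set)) \<rightarrow>\<^sub>E {..D}"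
  have "countable (?E \<rightarrow>\<^sub>E (UNIV :: int set))"
    using S by (intro countable_PiE finite_PiE) auto
  then show "AE h in (\<Pi>\<^sub>M s\<in>S. lborel). \<forall>c\<in>?E \<rightarrow>\<^sub>E (UNIV :: int set).
     (\<exists>e\<in>?E. c e \<noteq> 0) \<longrightarrow> (\<Sum>e\<in>?E. real_of_int (c e) * (\<Prod>(s, i)\<in>S \<times> UNIV. h s $ i ^ e (s, i))) \<noteq> 0"
  proof (subst AE_ball_countable, safe)
    fix c :: "(('a \<times> 'm) \<Rightarrow> nat) \<Rightarrow> int"
    show "AE h in (\<Pi>\<^sub>M s\<in>S. lborel). (\<exists>e\<in>?E. c e \<noteq> 0) \<longrightarrow>
        (\<Sum>e\<in>?E. real_of_int (c e) * (\<Prod>(s, i)\<in>S \<times> UNIV. h s $ i ^ e (s, i))) \<noteq> 0"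
    proof (cases "\<exists>e\<in>?E. c e \<noteq> 0")
      case True
      then have "\<exists>e\<in>?E. real_of_int (c e) \<noteq> 0" by simp
      then have "AE h in (\<Pi>\<^sub>M s\<in>S. lborel :: (real ^ 'm) measure).
          (\<Sum>e\<in>?E. real_of_int (c e) * (\<Prod>p\<in>S \<times> UNIV. (case p of (s, i) \<Rightarrow> \<lambda>h. h s $ i) h ^ e p)) \<noteq> 0"
        by (rule generic_coordsD[OF generic_coords_PiM_vec[OF S]])
      then show ?thesis by (simp add: case_prod_beta')
    qed auto
  qed
qed

text \<open>Coefficients are carried along the injection into exponent vectors and filled up with
  zeros, so that applications only have to tell exponent vectors apart.\<close>

lemma algebraically_generic_sum_ne_0:
  fixes h :: "'s \<Rightarrow> real ^ 'm::finite" and \<epsilon> :: "'x \<Rightarrow> 's \<times> 'm \<Rightarrow> nat" and c :: "'x \<Rightarrow> int"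
  assumes gen: "algebraically_generic S h" and S: "finite S" and X: "finite X"
    and inj: "inj_on (\<lambda>x. restrict (\<epsilon> x) (S \<times> UNIV)) X" and c: "\<exists>x\<in>X. c x \<noteq> 0"
  shows "(\<Sum>x\<in>X. real_of_int (c x) * (\<Prod>(s, i)\<in>S \<times> UNIV. h s $ i ^ \<epsilon> x (s, i))) \<noteq> 0"
proof -
  let ?r = "\<lambda>x. restrict (\<epsilon> x) (S \<times> UNIV)"
  define D where "D = Max (insert 0 ((\<lambda>(x, p). \<epsilon> x p) ` (X \<times> (S \<times> UNIV))))"
  have "\<epsilon> x p \<le> D" if "x \<in> X" "p \<in> S \<times> UNIV" for x p
    unfolding D_def by (rule Max_ge) (use that S X in \<open>auto intro!: image_eqI[where x = "(x, p)"]\<close>)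
  then have r: "?r ` X \<subseteq> (S \<times> UNIV) \<rightarrow>\<^sub>E {..D}" by (intro image_subsetI restrict_PiE_iff[THEN iffD2]) auto
  let ?E = "(S \<times> (UNIV :: 'm set)) \<rightarrow>\<^sub>E {..D}"
  define c' where "c' = (\<lambda>e\<in>?E. if e \<in> ?r ` X then c (the_inv_into X ?r e) else 0)"
  have c'r: "c' (?r x) = c x" if "x \<in> X" for x
  proof -
    have "?r x \<in> ?E" "?r x \<in> ?r ` X" using r that by blast+
    then show ?thesis unfolding c'_def by (simp add: the_inv_into_f_f[OF inj that])
  qed
  have "finite ?E" using S by (intro finite_PiE) auto
  then have "(\<Sum>e\<in>?E. real_of_int (c' e) * (\<Prod>(s, i)\<in>S \<times> UNIV. h s $ i ^ e (s, i)))
      = (\<Sum>e\<in>?r ` X. real_of_int (c' e) * (\<Prod>(s, i)\<in>S \<times> UNIV. h s $ i ^ e (s, i)))"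
    by (intro sum.mono_neutral_right r) (auto simp: c'_def)
  also have "\<dots> = (\<Sum>x\<in>X. real_of_int (c x) * (\<Prod>(s, i)\<in>S \<times> UNIV. h s $ i ^ ?r x (s, i)))"
    unfolding sum.reindex[OF inj] comp_def by (intro sum.cong refl) (simp only: c'r)
  also have "\<dots> = (\<Sum>x\<in>X. real_of_int (c x) * (\<Prod>(s, i)\<in>S \<times> UNIV. h s $ i ^ \<epsilon> x (s, i)))"
    by (intro sum.cong refl arg_cong2[where f = "(*)"] prod.cong) auto
  finally have eq: "(\<Sum>e\<in>?E. real_of_int (c' e) * (\<Prod>(s, i)\<in>S \<times> UNIV. h s $ i ^ e (s, i)))
      = (\<Sum>x\<in>X. real_of_int (c x) * (\<Prod>(s, i)\<in>S \<times> UNIV. h s $ i ^ \<epsilon> x (s, i)))" .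
  have "c' \<in> ?E \<rightarrow>\<^sub>E UNIV" by (simp add: c'_def)
  moreover obtain x where "x \<in> X" "c x \<noteq> 0" using c by blast
  then have "?r x \<in> ?E" "c' (?r x) \<noteq> 0" using c'r[of x] subsetD[OF r imageI[of x X ?r]] by simp_all
  then have "\<exists>e\<in>?E. c' e \<noteq> 0" by blast
  ultimately show ?thesis using gen unfolding algebraically_generic_def eq[symmetric] by blast
qed

text \<open>In the Leibniz formula distinct permutations give distinct monomials in the entries,
  each with coefficient 1 or -1, so nothing cancels.\<close>

lemma algebraically_generic_det_ne_0:
  fixes h :: "'s \<Rightarrow> real ^ 'm::finite"
  assumes gen: "algebraically_generic S h" and S: "finite S" and g: "inj g" "range g \<subseteq> S"
  shows "det (\<chi> i. h (g i)) \<noteq> 0"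
proof -
  define \<epsilon> where "\<epsilon> p = (\<lambda>(s, k). if \<exists>i. g i = s \<and> p i = k then 1 else 0 :: nat)" for p :: "'m \<Rightarrow> 'm"
  let ?X = "{p :: 'm \<Rightarrow> 'm. p permutes UNIV}"
  have \<epsilon>: "\<epsilon> p (g i, k) = (if p i = k then 1 else 0)" for p i k
    using g(1) by (auto simp: \<epsilon>_def inj_eq)
  have inj: "inj_on (\<lambda>p. restrict (\<epsilon> p) (S \<times> UNIV)) ?X"
  proof (rule inj_onI, rule ext)
    fix p p' :: "'m \<Rightarrow> 'm" and i
    assume "restrict (\<epsilon> p) (S \<times> UNIV) = restrict (\<epsilon> p') (S \<times> UNIV)"
    from fun_cong[OF this, of "(g i, p i)"] have "\<epsilon> p (g i, p i) = \<epsilon> p' (g i, p i)"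
      using subsetD[OF g(2) rangeI[of g i]] by simp
    then show "p i = p' i" by (simp add: \<epsilon> split: if_splits)
  qed
  have mon: "(\<Prod>(s, k)\<in>S \<times> UNIV. h s $ k ^ \<epsilon> p (s, k)) = (\<Prod>i\<in>UNIV. h (g i) $ p i)" for p
  proof -
    let ?f = "\<lambda>(s, k). h s $ k ^ \<epsilon> p (s, k)"
    let ?R = "(\<lambda>i. (g i, p i)) ` UNIV"
    have "prod ?f (S \<times> UNIV) = prod ?f ?R"
    proof (rule prod.mono_neutral_right)
      show "?R \<subseteq> S \<times> UNIV" using g(2) by auto
      show "\<forall>q\<in>S \<times> UNIV - ?R. ?f q = 1" by (auto simp: \<epsilon>_def)
    qed (use S in auto)
    also have "\<dots> = (\<Prod>i\<in>UNIV. ?f (g i, p i))"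
      by (subst prod.reindex) (use g(1) in \<open>auto simp: inj_on_def comp_def\<close>)
    finally show ?thesis by (simp add: \<epsilon>)
  qed
  have "(\<Sum>p\<in>?X. real_of_int (sign p) * (\<Prod>(s, k)\<in>S \<times> UNIV. h s $ k ^ \<epsilon> p (s, k))) \<noteq> 0"
    by (rule algebraically_generic_sum_ne_0[OF gen S _ inj])
       (auto intro!: exI[of _ id] simp: permutes_id sign_id finite_permutations)
  then show ?thesis unfolding mon by (simp add: det_def)
qed

lemma algebraically_generic_dual_vector:
  fixes h :: "'s \<Rightarrow> real ^ 'm::finite" and g :: "'m \<Rightarrow> 's"
  assumes "algebraically_generic S h" "finite S" "inj g" "range g \<subseteq> S"
  obtains x where "\<And>i. h (g i) \<bullet> x = (if i = i0 then 1 else 0)"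
proof -
  let ?A = "\<chi> i. h (g i)"
  have "invertible ?A" using algebraically_generic_det_ne_0[OF assms] by (simp add: invertible_det_nz)
  then obtain B where "?A ** B = mat 1" unfolding invertible_def by blast
  then have "?A *v (B *v axis i0 1) = axis i0 1" by (simp add: matrix_vector_mul_assoc)
  then have "h (g i) \<bullet> (B *v axis i0 1) = (axis i0 1 :: real ^ 'm) $ i" for i
    using matrix_vector_mul_component[of ?A "B *v axis i0 1" i] by simp
  then show ?thesis by (intro that[of "B *v axis i0 1"]) (auto simp: axis_def)
qed

text \<open>Provides the coefficients \<alpha> with which the converse expresses a channel vector of
  \<open>a\<close> through \<open>m\<close> channel vectors of \<open>b\<close>.\<close>

lemma algebraically_generic_combination:
  fixes h :: "'s \<Rightarrow> real ^ 'm::finite" and g :: "'m \<Rightarrow> 's"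
  assumes "algebraically_generic S h" "finite S" "inj g" "range g \<subseteq> S"
  obtains \<alpha> where "y = (\<Sum>i\<in>UNIV. \<alpha> i *\<^sub>R h (g i))"
proof -
  let ?A = "\<chi> i. h (g i)"
  have "invertible (transpose ?A)"
    using algebraically_generic_det_ne_0[OF assms] by (simp add: invertible_det_nz)
  then obtain B where "transpose ?A ** B = mat 1" unfolding invertible_def by blast
  then have y: "transpose ?A *v (B *v y) = y" by (simp add: matrix_vector_mul_assoc)
  have "y $ k = (\<Sum>i\<in>UNIV. (B *v y) $ i *\<^sub>R h (g i)) $ k" for k
  proof -
    have "y $ k = (transpose ?A *v (B *v y)) $ k" by (simp only: y)
    also have "\<dots> = (\<Sum>i\<in>UNIV. (B *v y) $ i *\<^sub>R h (g i)) $ k"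
      by (subst matrix_vector_mult_def) (simp add: transpose_def mult.commute)
    finally show ?thesis .
  qed
  then show ?thesis by (intro that[of "\<lambda>i. (B *v y) $ i"]) (simp add: vec_eq_iff)
qed

section \<open>Consequences for the two users\<close>

text \<open>For a single state \<open>j\<close> of \<open>b\<close>, the \<open>J a + 1\<close>
  vectors involved are completed by further states of \<open>b\<close> to \<open>m\<close>
  independent ones, and a dual vector \<open>x j\<close> does the job. The solutions are merged into
  \<open>\<Sum>k\<in>{1..J b}. t ^ k *\<^sub>R x k\<close>: its gain at state \<open>j\<close> is a
  polynomial in \<open>t\<close> with coefficient 1 at \<open>t ^ j\<close>, and some real
  \<open>t\<close> avoids the finitely many roots of all of them.\<close>

lemma zero_forcing_direction:
  fixes h :: "nat \<times> nat \<Rightarrow> real ^ 'm::finite"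
  assumes gen: "algebraically_generic (states 2 J) h" and ab: "{a, b} = {1, 2 :: nat}"
    and J: "J a < CARD('m)" "CARD('m) \<le> J b"
  obtains v where "\<And>j. j \<in> {1..J a} \<Longrightarrow> h (a, j) \<bullet> v = 0" "\<And>j. j \<in> {1..J b} \<Longrightarrow> h (b, j) \<bullet> v \<noteq> 0"
proof -
  have ab': "a \<noteq> b" "a \<in> {1..2}" "b \<in> {1..2}" using ab by (auto simp: doubleton_eq_iff)
  have fin: "finite (states 2 J)" by (auto simp: states_def)
  have "\<exists>x. (\<forall>k\<in>{1..J a}. h (a, k) \<bullet> x = 0) \<and> h (b, j) \<bullet> x = 1" if j: "j \<in> {1..J b}" for j
  proof -
    let ?Z = "insert (b, j) (Pair a ` {1..J a})" and ?C = "insert (b, j) (Pair a ` {1..J a}) \<union> Pair b ` {1..J b}"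
    have "card ?Z = J a + 1" using ab' by (subst card_insert_disjoint) (auto simp: card_image inj_on_def)
    moreover have "J b \<le> card ?C"
    proof -
      have "card (Pair b ` {1..J b}) \<le> card ?C" by (rule card_mono) blast+
      then show ?thesis by (simp add: card_image inj_on_def)
    qed
    ultimately obtain Y where Y: "?Z \<subseteq> Y" "Y \<subseteq> ?C" "card Y = CARD('m)"
      using exists_subset_between[of ?Z "CARD('m)" ?C] J by auto
    have "finite Y" using Y(2) by (rule finite_subset) auto
    then obtain g where g: "bij_betw g (UNIV :: 'm set) Y"
      using Y(3) finite_same_card_bij[of "UNIV :: 'm set" Y] by auto
    have gS: "range g \<subseteq> states 2 J" "inj g"
      using g Y(2) j ab' by (auto simp: bij_betw_def states_def)
    obtain i0 where i0: "g i0 = (b, j)" using g Y(1) by (metis bij_betw_def image_iff insert_subset)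
    obtain x where x: "\<And>i. h (g i) \<bullet> x = (if i = i0 then 1 else 0)"
      using algebraically_generic_dual_vector[OF gen fin gS(2,1)] by blast
    have "h (a, k) \<bullet> x = 0" if "k \<in> {1..J a}" for k
    proof -
      have "(a, k) \<in> range g" using g Y(1) that by (auto simp: bij_betw_def)
      then obtain i where i: "g i = (a, k)" by auto
      then have "i \<noteq> i0" using i0 ab' by auto
      then show ?thesis using x[of i] i by simp
    qed
    moreover have "h (b, j) \<bullet> x = 1" using x[of i0] i0 by simp
    ultimately show ?thesis by blast
  qed
  then have "\<forall>j\<in>{1..J b}. \<exists>x. (\<forall>k\<in>{1..J a}. h (a, k) \<bullet> x = 0) \<and> h (b, j) \<bullet> x = 1" by blast
  from bchoice[OF this] obtain x where x: "\<forall>j\<in>{1..J b}. (\<forall>k\<in>{1..J a}. h (a, k) \<bullet> x j = 0) \<and> h (b, j) \<bullet> x j = 1" by blast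
  \<comment> \<open>The zero in degree 0 pads the states \<open>1..J b\<close> to the index range of
    a polynomial.\<close>
  define co where "co j k = (if k = 0 then 0 else h (b, j) \<bullet> x k)" for j k
  have "finite {t. (\<Sum>k\<le>J b. co j k * t ^ k) = 0}" if "j \<in> {1..J b}" for j
    unfolding polyfun_finite_roots using that x by (intro exI[of _ j]) (auto simp: co_def)
  then have "finite (\<Union>j\<in>{1..J b}. {t. (\<Sum>k\<le>J b. co j k * t ^ k) = 0})" by blast
  then obtain t :: real where t: "t \<notin> (\<Union>j\<in>{1..J b}. {t. (\<Sum>k\<le>J b. co j k * t ^ k) = 0})"
    using ex_new_if_finite[OF infinite_UNIV_char_0] by blast
  show ?thesis
  proof (rule that[of "\<Sum>k\<in>{1..J b}. t ^ k *\<^sub>R x k"])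
    show "h (a, j) \<bullet> (\<Sum>k\<in>{1..J b}. t ^ k *\<^sub>R x k) = 0" if "j \<in> {1..J a}" for j
      unfolding inner_sum_right inner_scaleR_right using x that by (intro sum.neutral) auto
    show "h (b, j) \<bullet> (\<Sum>k\<in>{1..J b}. t ^ k *\<^sub>R x k) \<noteq> 0" if j: "j \<in> {1..J b}" for j
    proof -
      have "h (b, j) \<bullet> (\<Sum>k\<in>{1..J b}. t ^ k *\<^sub>R x k) = (\<Sum>k\<in>{1..J b}. co j k * t ^ k)"
        unfolding inner_sum_right inner_scaleR_right by (intro sum.cong) (auto simp: co_def)
      also have "\<dots> = (\<Sum>k\<le>J b. co j k * t ^ k)"
        by (intro sum.mono_neutral_left) (auto simp: co_def)
      also have "\<dots> \<noteq> 0" using t j by blast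
      finally show ?thesis .
    qed
  qed
qed

text \<open>The directions are monomials in the coefficients of \<open>b\<close> only, so after
  multiplication by a coefficient of \<open>a\<close> the antenna \<open>i\<close> can be read off
  from the part of \<open>a\<close>, and \<open>e\<close> from the part of \<open>b\<close>:
  distinct pairs have distinct exponent vectors.\<close>

lemma monomials_rationally_independent:
  fixes h :: "nat \<times> nat \<Rightarrow> real ^ 'm::finite" and c :: "'m \<times> (nat \<times> 'm \<Rightarrow> nat) \<Rightarrow> int"
  assumes gen: "algebraically_generic (states 2 J) h" and ab: "{a, b} = {1, 2 :: nat}"
    and j: "j \<in> {1..J a}" and c: "\<exists>p\<in>UNIV \<times> (({1..J b} \<times> UNIV) \<rightarrow>\<^sub>E {..<n}). c p \<noteq> 0"
  shows "(\<Sum>(i, e)\<in>UNIV \<times> (({1..J b} \<times> UNIV) \<rightarrow>\<^sub>E {..<n}).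
      real_of_int (c (i, e)) * (h (a, j) $ i * (\<Prod>(k, l)\<in>{1..J b} \<times> UNIV. h (b, k) $ l ^ e (k, l)))) \<noteq> 0"
proof -
  have ab': "a \<noteq> b" "a \<in> {1..2}" "b \<in> {1..2}" "{1..2} = {a, b}" using ab by (auto simp: doubleton_eq_iff)
  have fin: "finite (states 2 J)" by (auto simp: states_def)
  let ?T = "({1..J b} \<times> (UNIV :: 'm set)) \<rightarrow>\<^sub>E {..<n}"
  define \<epsilon> where "\<epsilon> p = (\<lambda>((u, k), l). if u = a then (if k = j \<and> l = fst p then 1 else 0) else snd p (k, l))"
    for p :: "'m \<times> (nat \<times> 'm \<Rightarrow> nat)"
  have finT: "finite ?T" by (intro finite_PiE) auto
  have inj: "inj_on (\<lambda>p. restrict (\<epsilon> p) (states 2 J \<times> UNIV)) (UNIV \<times> ?T)"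
  proof (rule inj_onI)
    fix p p' assume p: "p \<in> UNIV \<times> ?T" and p': "p' \<in> UNIV \<times> ?T"
      and eq: "restrict (\<epsilon> p) (states 2 J \<times> UNIV) = restrict (\<epsilon> p') (states 2 J \<times> UNIV)"
    have "\<epsilon> p ((a, j), fst p) = \<epsilon> p' ((a, j), fst p)"
      using fun_cong[OF eq, of "((a, j), fst p)"] j ab' by (auto simp: states_def)
    then have "fst p = fst p'" by (simp add: \<epsilon>_def split: if_splits)
    moreover have "snd p = snd p'"
    proof (rule PiE_ext[of "snd p" "{1..J b} \<times> UNIV" "\<lambda>_. {..<n}" "snd p'"])
      fix q assume "q \<in> {1..J b} \<times> (UNIV :: 'm set)"
      then obtain k l where q: "q = (k, l)" "k \<in> {1..J b}" by auto
      have "\<epsilon> p ((b, k), l) = \<epsilon> p' ((b, k), l)"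
        using fun_cong[OF eq, of "((b, k), l)"] q ab' by (auto simp: states_def)
      then show "snd p q = snd p' q" using ab' q by (simp add: \<epsilon>_def)
    qed (use p p' in auto)
    ultimately show "p = p'" by (rule prod_eqI)
  qed
  have mon: "(\<Prod>(s, l)\<in>states 2 J \<times> UNIV. h s $ l ^ \<epsilon> p (s, l)) =
      h (a, j) $ fst p * (\<Prod>(k, l)\<in>{1..J b} \<times> UNIV. h (b, k) $ l ^ snd p (k, l))" for p
  proof -
    let ?f = "\<lambda>(s, l). h s $ l ^ \<epsilon> p (s, l)"
    have st: "states 2 J \<times> (UNIV :: 'm set) = (Pair a ` {1..J a}) \<times> UNIV \<union> (Pair b ` {1..J b}) \<times> UNIV"
      using ab' by (auto simp: states_def)
    have "prod ?f (states 2 J \<times> UNIV) = prod ?f ((Pair a ` {1..J a}) \<times> UNIV) * prod ?f ((Pair b ` {1..J b}) \<times> UNIV)"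
      unfolding st by (rule prod.union_disjoint) (use ab' in auto)
    also have "prod ?f ((Pair a ` {1..J a}) \<times> UNIV) = prod ?f {((a, j), fst p)}"
      by (rule prod.mono_neutral_right) (use j in \<open>auto simp: \<epsilon>_def split: if_splits\<close>)
    also have "\<dots> = h (a, j) $ fst p" by (simp add: \<epsilon>_def)
    also have "prod ?f ((Pair b ` {1..J b}) \<times> UNIV) = (\<Prod>(k, l)\<in>{1..J b} \<times> UNIV. h (b, k) $ l ^ snd p (k, l))"
      by (rule prod.reindex_bij_witness[where i = "\<lambda>(k, l). ((b, k), l)" and j = "\<lambda>((u, k), l). (k, l)"])
         (use ab' in \<open>auto simp: \<epsilon>_def\<close>)
    finally show ?thesis .
  qed
  have "(\<Sum>p\<in>UNIV \<times> ?T. real_of_int (c p) * (\<Prod>(s, l)\<in>states 2 J \<times> UNIV. h s $ l ^ \<epsilon> p (s, l))) \<noteq> 0"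
    by (rule algebraically_generic_sum_ne_0[OF gen fin _ inj c]) (use finT in auto)
  then show ?thesis unfolding mon by (simp add: case_prod_beta')
qed

subsection \<open>Degrees of freedom\<close>

text \<open>\<open>V\<close> counts the channel coefficients of \<open>b\<close>, \<nu> bounds the
  integer unknowns per repetition at a receiver, and \<open>W\<close> the differences per unknown.
  As \<open>d\<close>, \<kappa> and \<open>B\<close> do not depend on \<open>P\<close>, the number
  of repetitions is fitted to \<open>P\<close>: \<open>W ^ (N * \<nu>)\<close> may reach
  \<open>P powr ((1 - \<epsilon>) / 2)\<close>, and the reserve
  \<open>P powr (\<epsilon> / 2)\<close> pays for the constants and for the norm, which grows only
  like log P.\<close>

lemma achievable_sum_rate:
  fixes h :: "nat \<times> nat \<Rightarrow> real ^ 'm::finite" and \<eta> \<epsilon> :: real and n Q :: nat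
  assumes gen: "algebraically_generic (states 2 J) h" and ab: "{a, b} = {1, 2 :: nat}"
    and J: "J a < CARD('m)" "CARD('m) \<le> J b"
    and n: "n \<ge> 1" and Q: "Q \<ge> 1" and \<eta>: "0 < \<eta>" "2 * \<eta> \<le> 1" and \<epsilon>: "0 < \<epsilon>" "\<epsilon> < 1"
  defines "V \<equiv> J b * CARD('m)" and "W \<equiv> real (3 * CARD('m) * Q)"
  defines "\<nu> \<equiv> (n + 1) ^ V + (CARD('m) - 1) * n ^ V"
  shows "\<forall>\<^sub>F P in at_top. \<exists>R. achievable 2 J h P R \<and>
    (1 - 2 * \<eta>) * real ((2 * CARD('m) - 1) * n ^ V) * log 2 Q *
      ((1 - \<epsilon>) * (1 / 2 * log 2 P) / (real \<nu> * log 2 W) - 1) - 2 \<le> R 1 + R 2"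
proof -
  let ?m = "CARD('m)"
  have ab': "a \<noteq> b" "a \<in> {1..2}" "b \<in> {1..2}" "{1..2} = {a, b}" using ab by (auto simp: doubleton_eq_iff)
  have m1: "?m \<ge> 1" by (simp add: Suc_le_eq)
  obtain d :: real where d: "d > 0" and concat:
    "\<And>K J (h :: nat \<times> nat \<Rightarrow> real ^ 'm) P q (X :: (nat \<Rightarrow> nat) \<Rightarrow> real ^ 'm).
      (\<And>k. k \<in> {1..K} \<Longrightarrow> q k \<ge> (1 :: nat)) \<Longrightarrow>
      (\<And>s. s \<in> (\<Pi>\<^sub>E k\<in>{1..K}. {..<q k}) \<Longrightarrow> (norm (X s))\<^sup>2 \<le> P) \<Longrightarrow>
      (\<And>k j s s'. (k, j) \<in> states K J \<Longrightarrow> s \<in> (\<Pi>\<^sub>E k\<in>{1..K}. {..<q k}) \<Longrightarrow>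
          s' \<in> (\<Pi>\<^sub>E k\<in>{1..K}. {..<q k}) \<Longrightarrow> s k \<noteq> s' k \<Longrightarrow> d \<le> \<bar>h (k, j) \<bullet> X s - h (k, j) \<bullet> X s'\<bar>) \<Longrightarrow>
      achievable K J h P (\<lambda>k. max 0 ((1 - 2 * \<eta>) * log 2 (q k) - 1))"
    using achievable_of_constellation[OF \<eta>] by metis
  obtain v0 where v0: "\<And>j. j \<in> {1..J a} \<Longrightarrow> h (a, j) \<bullet> v0 = 0" "\<And>j. j \<in> {1..J b} \<Longrightarrow> h (b, j) \<bullet> v0 \<noteq> 0"
    using zero_forcing_direction[OF gen ab J] by blast
  let ?I = "{1..J b} \<times> (UNIV :: 'm set)"
  define T where "T = ?I \<rightarrow>\<^sub>E {..<n}"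
  \<comment> \<open>Multiplication by a coefficient of \<open>b\<close> raises one exponent by one,
    hence the bound \<open>n + 1\<close>. The overhead \<open>((n + 1) / n) ^ V\<close> over
    \<open>T\<close> tends to 1 as \<open>n\<close> grows.\<close>
  define T' where "T' = ?I \<rightarrow>\<^sub>E {..<n + 1}"
  define mon where "mon e = (\<Prod>(k, l)\<in>?I. h (b, k) $ l ^ e (k, l))" for e
  define sh where "sh j i e = e((j, i) := e (j, i) + 1)" for j i and e :: "nat \<times> 'm \<Rightarrow> nat"
  \<comment> \<open>With this number of streams for \<open>b\<close> and \<open>?m * n ^ V\<close>
    for \<open>a\<close>, a repetition carries \<open>(2 * ?m - 1) * n ^ V\<close> symbols, while
    each receiver faces at most \<nu> unknowns, about \<open>?m * n ^ V\<close>.\<close>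
  define L where "L = (?m - 1) * n ^ V"
  have cT: "card T = n ^ V" "card T' = (n + 1) ^ V"
    unfolding T_def T'_def by (simp_all add: card_PiE V_def)
  have finT: "finite T" "finite T'" unfolding T_def T'_def by (auto intro!: finite_PiE)
  have \<nu>: "card T' + L = \<nu>" by (simp add: cT L_def \<nu>_def)
  obtain \<kappa> B :: real where \<kappa>: "\<kappa> > 0" and B: "B > 0" and const:
    "\<And>N. \<exists>X :: (nat \<times> 'm \<times> (nat \<times> 'm \<Rightarrow> nat) \<Rightarrow> nat) \<Rightarrow> (nat \<times> nat \<Rightarrow> nat) \<Rightarrow> real ^ 'm.
       \<forall>\<alpha>\<in>({..<N} \<times> UNIV \<times> T) \<rightarrow>\<^sub>E {..<Q}. \<forall>\<beta>\<in>({..<N} \<times> {..<L}) \<rightarrow>\<^sub>E {..<Q}.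
         norm (X \<alpha> \<beta>) \<le> B * (real N + 1) \<and>
         (\<forall>\<alpha>'\<in>({..<N} \<times> UNIV \<times> T) \<rightarrow>\<^sub>E {..<Q}. \<forall>\<beta>'\<in>({..<N} \<times> {..<L}) \<rightarrow>\<^sub>E {..<Q}.
           (\<alpha> \<noteq> \<alpha>' \<longrightarrow> (\<forall>j\<in>{1..J a}. \<kappa> / W ^ (N * \<nu>) \<le> \<bar>h (a, j) \<bullet> X \<alpha> \<beta> - h (a, j) \<bullet> X \<alpha>' \<beta>'\<bar>)) \<and>
           (\<beta> \<noteq> \<beta>' \<longrightarrow> (\<forall>j\<in>{1..J b}. \<kappa> / W ^ (N * \<nu>) \<le> \<bar>h (b, j) \<bullet> X \<alpha> \<beta> - h (b, j) \<bullet> X \<alpha>' \<beta>'\<bar>)))"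
  proof (rule aligned_constellation[of T T' "J b" sh "\<lambda>j. h (b, j)" mon "J a" "\<lambda>j. h (a, j)" v0 Q L, unfolded \<nu>, folded W_def])
    show "finite T" "finite T'" by (fact finT)+
    show "inj_on (sh j i) T" if "j \<in> {1..J b}" for j i
    proof (rule inj_onI, rule ext)
      fix e e' p assume "sh j i e = sh j i e'"
      from fun_cong[OF this, of p] show "e p = e' p" by (cases "p = (j, i)") (auto simp: sh_def)
    qed
    show "sh j i ` T \<subseteq> T'" if "j \<in> {1..J b}" for j i
    proof (rule image_subsetI, unfold T'_def, rule PiE_I)
      fix e p assume e: "e \<in> T"
      show "sh j i e p \<in> {..<n + 1}" if p: "p \<in> ?I"
      proof -
        have "e p < n" using e p by (auto simp: T_def PiE_iff)
        then show ?thesis by (auto simp: sh_def)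
      qed
      show "sh j i e p = undefined" if p: "p \<notin> ?I"
      proof -
        have "p \<noteq> (j, i)" using p \<open>j \<in> {1..J b}\<close> by auto
        then show ?thesis using PiE_arb[OF e[unfolded T_def] p] by (simp add: sh_def)
      qed
    qed
    show "h (b, j) $ i * mon e = mon (sh j i e)" if j: "j \<in> {1..J b}" for j i e
    proof -
      have ji: "finite ?I" "(j, i) \<in> ?I" using j by auto
      show ?thesis unfolding mon_def prod.remove[OF ji]
        by (simp add: sh_def) (intro disjI2 prod.cong, auto split: if_splits)
    qed
    show "(\<Sum>(i, e)\<in>UNIV \<times> T. real_of_int (c (i, e)) * (h (a, j) $ i * mon e)) \<noteq> 0"
      if "j \<in> {1..J a}" "\<exists>p\<in>UNIV \<times> T. c p \<noteq> 0" for j c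
      using monomials_rationally_independent[OF gen ab that(1), of n c] that(2) unfolding T_def mon_def by blast
    have "?m * n ^ V = (?m - 1) * n ^ V + n ^ V" using m1 by (cases ?m) auto
    moreover have "n ^ V \<le> (n + 1) ^ V" by (rule power_mono) auto
    ultimately show "?m * card T \<le> \<nu>" by (simp add: cT \<nu>_def)
  qed (erule v0(1), erule v0(2), rule Q, (rule that; assumption))
  have W2: "W \<ge> 2"
  proof -
    have "1 * 1 \<le> ?m * Q" using m1 Q by (intro mult_le_mono) auto
    then have "2 \<le> 3 * ?m * Q" by linarith
    then show ?thesis unfolding W_def by (metis of_nat_le_iff of_nat_numeral)
  qed
  have lW: "log 2 W \<ge> 1" using W2 by simp
  have "1 \<le> (n + 1) ^ V" by simp
  then have "1 \<le> \<nu>" unfolding \<nu>_def by linarith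
  then have \<nu>1: "real \<nu> \<ge> 1" by simp
  have \<nu>W: "real \<nu> * log 2 W \<ge> 1" using mult_mono[OF \<nu>1 lW] by simp
  have "filterlim (\<lambda>P. P powr (\<epsilon> / 2) / (1 / 2 * log 2 P + 1)) at_top at_top"
    using \<epsilon>(1) by real_asymp
  then have ev: "\<forall>\<^sub>F P in at_top. d * B / \<kappa> \<le> P powr (\<epsilon> / 2) / (1 / 2 * log 2 P + 1)"
    by (simp add: filterlim_at_top)
  show ?thesis
    using ev eventually_ge_at_top[of 1]
  proof eventually_elim
    case (elim P)
    \<comment> \<open>The largest \<open>N\<close> with
      \<open>W ^ (N * \<nu>) <= P powr ((1 - \<epsilon>) / 2)\<close>. Rounding down causes the
      \<open>- 1\<close> in the claim; the \<open>- 2\<close> is the bit that each user loses in the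
      concatenation.\<close>
    define N where "N = nat \<lfloor>(1 - \<epsilon>) * (1 / 2 * log 2 P) / (real \<nu> * log 2 W)\<rfloor>"
    let ?A = "({..<N} \<times> (UNIV :: 'm set) \<times> T) \<rightarrow>\<^sub>E {..<Q}" and ?B = "({..<N} \<times> {..<L}) \<rightarrow>\<^sub>E {..<Q}"
    have lP: "log 2 P \<ge> 0" using elim by simp
    have x0: "0 \<le> (1 - \<epsilon>) * (1 / 2 * log 2 P) / (real \<nu> * log 2 W)"
      using \<epsilon> lP lW by (intro divide_nonneg_nonneg mult_nonneg_nonneg) auto
    have N_le: "real N \<le> (1 - \<epsilon>) * (1 / 2 * log 2 P) / (real \<nu> * log 2 W)"
      using x0 by (simp add: N_def)
    have N_ge: "(1 - \<epsilon>) * (1 / 2 * log 2 P) / (real \<nu> * log 2 W) - 1 \<le> real N"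
      using x0 unfolding N_def by linarith
    have N1: "real N + 1 \<le> 1 / 2 * log 2 P + 1"
    proof -
      have "(1 - \<epsilon>) * (1 / 2 * log 2 P) / (real \<nu> * log 2 W) \<le> 1 * (1 / 2 * log 2 P) / 1"
        using \<epsilon> lP \<nu>W by (intro frac_le mult_right_mono) auto
      from order.trans[OF N_le this] show ?thesis by simp
    qed
    have pW: "W ^ (N * \<nu>) \<le> P powr ((1 - \<epsilon>) / 2)"
    proof -
      have "real N * (real \<nu> * log 2 W) \<le> (1 - \<epsilon>) * (1 / 2 * log 2 P)"
        using N_le \<nu>W by (simp add: pos_le_divide_eq)
      then have "log 2 (W ^ (N * \<nu>)) \<le> log 2 (P powr ((1 - \<epsilon>) / 2))"
        using W2 elim by (simp add: log_nat_power log_powr mult_ac)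
      then show ?thesis using W2 elim by (subst (asm) log_le_cancel_iff) auto
    qed
    have Wpos: "W ^ (N * \<nu>) > 0" using W2 by simp
    obtain X :: "(nat \<times> 'm \<times> (nat \<times> 'm \<Rightarrow> nat) \<Rightarrow> nat) \<Rightarrow> (nat \<times> nat \<Rightarrow> nat) \<Rightarrow> real ^ 'm" where X:
      "\<forall>\<alpha>\<in>?A. \<forall>\<beta>\<in>?B. norm (X \<alpha> \<beta>) \<le> B * (real N + 1) \<and>
         (\<forall>\<alpha>'\<in>?A. \<forall>\<beta>'\<in>?B.
           (\<alpha> \<noteq> \<alpha>' \<longrightarrow> (\<forall>j\<in>{1..J a}. \<kappa> / W ^ (N * \<nu>) \<le> \<bar>h (a, j) \<bullet> X \<alpha> \<beta> - h (a, j) \<bullet> X \<alpha>' \<beta>'\<bar>)) \<and>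
           (\<beta> \<noteq> \<beta>' \<longrightarrow> (\<forall>j\<in>{1..J b}. \<kappa> / W ^ (N * \<nu>) \<le> \<bar>h (b, j) \<bullet> X \<alpha> \<beta> - h (b, j) \<bullet> X \<alpha>' \<beta>'\<bar>)))"
      using const[of N] by (elim exE)
    have cA: "finite ?A" "card ?A = Q ^ (N * (?m * n ^ V))" "finite ?B" "card ?B = Q ^ (N * L)"
      using finT by (auto intro!: finite_PiE simp: card_PiE cT)
    obtain fa where fa: "bij_betw fa {..<Q ^ (N * (?m * n ^ V))} ?A"
      using ex_bij_betw_nat_finite[OF cA(1)] cA(2) by (auto simp: atLeast0LessThan)
    obtain fb where fb: "bij_betw fb {..<Q ^ (N * L)} ?B"
      using ex_bij_betw_nat_finite[OF cA(3)] cA(4) by (auto simp: atLeast0LessThan)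
    define q where "q k = (if k = a then Q ^ (N * (?m * n ^ V)) else Q ^ (N * L))" for k
    \<comment> \<open>Scales the constellation, of norm at most \<open>B * (real N + 1)\<close>, to
      the power \<open>P\<close>.\<close>
    define \<mu> where "\<mu> = sqrt P / (B * (real N + 1))"
    define Y where "Y s = \<mu> *\<^sub>R X (fa (s a)) (fb (s b))" for s
    define R where "R k = max 0 ((1 - 2 * \<eta>) * log 2 (q k) - 1)" for k
    have BN: "B * (real N + 1) > 0" using B by simp
    have \<mu>0: "\<mu> > 0" using BN elim by (simp add: \<mu>_def)
    have memA: "fa (s a) \<in> ?A" "fb (s b) \<in> ?B" if "s \<in> (\<Pi>\<^sub>E k\<in>{1..2}. {..<q k})" for s
      using that ab' bij_betwE[OF fa] bij_betwE[OF fb] by (auto simp: q_def PiE_iff)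
    have sep: "d \<le> \<mu> * (\<kappa> / W ^ (N * \<nu>))"
    proof -
      have "d * B / \<kappa> * (real N + 1) \<le> d * B / \<kappa> * (1 / 2 * log 2 P + 1)"
        using d B \<kappa> by (intro mult_left_mono N1) auto
      also have "\<dots> \<le> P powr (\<epsilon> / 2)"
        using elim(1) lP by (subst (asm) pos_le_divide_eq) auto
      finally have 1: "d * (B * (real N + 1)) \<le> \<kappa> * P powr (\<epsilon> / 2)"
        using \<kappa> by (simp add: field_simps)
      have "\<kappa> * P powr (\<epsilon> / 2) * W ^ (N * \<nu>) \<le> \<kappa> * P powr (\<epsilon> / 2) * P powr ((1 - \<epsilon>) / 2)"
        using \<kappa> by (intro mult_left_mono pW) auto
      also have "\<dots> = \<kappa> * P powr (1 / 2)"
        by (simp add: mult.assoc powr_add[symmetric] add_divide_distrib[symmetric])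
      also have "\<dots> = \<kappa> * sqrt P" using elim by (simp add: powr_half_sqrt)
      finally have 2: "\<kappa> * P powr (\<epsilon> / 2) * W ^ (N * \<nu>) \<le> \<kappa> * sqrt P" .
      have "d * (B * (real N + 1)) * W ^ (N * \<nu>) \<le> \<kappa> * sqrt P"
        using mult_right_mono[OF 1, of "W ^ (N * \<nu>)"] 2 Wpos by linarith
      then have "d \<le> \<kappa> * sqrt P / (B * (real N + 1) * W ^ (N * \<nu>))"
        by (subst pos_le_divide_eq[OF mult_pos_pos[OF BN Wpos]]) (simp only: mult_ac)
      then show ?thesis by (simp add: \<mu>_def mult_ac)
    qed
    have ach: "achievable 2 J h P R"
      unfolding R_def
    proof (rule concat[where X = Y])
      show "q k \<ge> 1" for k using Q by (simp add: q_def)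
    next
      fix s assume s: "s \<in> (\<Pi>\<^sub>E k\<in>{1..2}. {..<q k})"
      have "norm (X (fa (s a)) (fb (s b))) \<le> B * (real N + 1)" using X memA[OF s] by blast
      then have "norm (Y s) \<le> \<mu> * (B * (real N + 1))"
        using \<mu>0 by (simp add: Y_def)
      also have "\<dots> = sqrt P" using BN unfolding \<mu>_def by (metis less_irrefl nonzero_eq_divide_eq)
      finally have "(norm (Y s))\<^sup>2 \<le> (sqrt P)\<^sup>2" by (rule power_mono) simp
      then show "(norm (Y s))\<^sup>2 \<le> P" using elim by simp
    next
      fix k j s s'
      assume kj: "(k, j) \<in> states 2 J" and s: "s \<in> (\<Pi>\<^sub>E k\<in>{1..2}. {..<q k})" and s': "s' \<in> (\<Pi>\<^sub>E k\<in>{1..2}. {..<q k})"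
        and ne: "s k \<noteq> s' k"
      have "\<kappa> / W ^ (N * \<nu>) \<le> \<bar>h (k, j) \<bullet> X (fa (s a)) (fb (s b)) - h (k, j) \<bullet> X (fa (s' a)) (fb (s' b))\<bar>"
      proof (cases "k = a")
        case True
        have "s a < q a" "s' a < q a" using s s' ab' by (auto simp: PiE_iff)
        then have "fa (s a) \<noteq> fa (s' a)"
          using ne True fa by (auto simp: bij_betw_def inj_on_def q_def)
        moreover have "j \<in> {1..J a}" using kj True by (auto simp: states_def)
        ultimately show ?thesis using X memA[OF s] memA[OF s'] True by blast
      next
        case False
        then have k: "k = b" using kj ab' by (auto simp: states_def)
        have "s b < q b" "s' b < q b" using s s' ab' by (auto simp: PiE_iff)
        then have "fb (s b) \<noteq> fb (s' b)"
          using ne k fb ab' by (auto simp: bij_betw_def inj_on_def q_def)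
        moreover have "j \<in> {1..J b}" using kj k by (auto simp: states_def)
        ultimately show ?thesis using X memA[OF s] memA[OF s'] k by blast
      qed
      then have "\<mu> * (\<kappa> / W ^ (N * \<nu>)) \<le> \<mu> * \<bar>h (k, j) \<bullet> X (fa (s a)) (fb (s b)) - h (k, j) \<bullet> X (fa (s' a)) (fb (s' b))\<bar>"
        using \<mu>0 by (intro mult_left_mono) auto
      also have "\<dots> = \<bar>h (k, j) \<bullet> Y s - h (k, j) \<bullet> Y s'\<bar>"
        using \<mu>0 by (simp add: Y_def right_diff_distrib[symmetric] abs_mult)
      finally show "d \<le> \<bar>h (k, j) \<bullet> Y s - h (k, j) \<bullet> Y s'\<bar>" using sep by linarith
    qed
    have R_sum: "R 1 + R 2 = R a + R b" using ab by (auto simp: doubleton_eq_iff)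
    have R_ge: "(1 - 2 * \<eta>) * log 2 (q a) - 1 \<le> R a" "(1 - 2 * \<eta>) * log 2 (q b) - 1 \<le> R b" by (auto simp: R_def)
    have lq: "log 2 (q a) = real (N * (?m * n ^ V)) * log 2 Q" "log 2 (q b) = real (N * L) * log 2 Q"
      using Q ab' by (simp_all add: q_def log_nat_power)
    have dims: "real (N * (?m * n ^ V)) + real (N * L) = real ((2 * ?m - 1) * n ^ V) * real N"
    proof -
      have "2 * ?m - 1 = ?m + (?m - 1)" using m1 by simp
      then have "N * (?m * n ^ V) + N * L = (2 * ?m - 1) * n ^ V * N" by (simp add: L_def algebra_simps)
      then show ?thesis by (simp only: flip: of_nat_add of_nat_mult)
    qed
    have "c * x - 1 \<le> r \<Longrightarrow> c * y - 1 \<le> s \<Longrightarrow> x = u * l \<Longrightarrow> y = v * l \<Longrightarrow> u + v = z \<Longrightarrow> c * (z * l) - 2 \<le> r + s"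
      for c x y r s u v z l :: real by (auto simp: algebra_simps)
    from this[OF R_ge lq dims]
    have "R 1 + R 2 \<ge> (1 - 2 * \<eta>) * (real ((2 * ?m - 1) * n ^ V) * real N * log 2 Q) - 2"
      by (simp only: R_sum)
    moreover have "(1 - 2 * \<eta>) * real ((2 * ?m - 1) * n ^ V) * log 2 Q *
        ((1 - \<epsilon>) * (1 / 2 * log 2 P) / (real \<nu> * log 2 W) - 1)
      \<le> (1 - 2 * \<eta>) * real ((2 * ?m - 1) * n ^ V) * log 2 Q * real N"
      using \<eta> Q by (intro mult_left_mono N_ge mult_nonneg_nonneg of_nat_0_le_iff) auto
    ultimately show "\<exists>R. achievable 2 J h P R \<and>
        (1 - 2 * \<eta>) * real ((2 * ?m - 1) * n ^ V) * log 2 Q *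
          ((1 - \<epsilon>) * (1 / 2 * log 2 P) / (real \<nu> * log 2 W) - 1) - 2 \<le> R 1 + R 2"
      using ach by (intro exI[of _ R]) (simp add: mult_ac)
  qed
qed

section \<open>The limit of the normalized sum rate\<close>

text \<open>All parameters are tied to one \<open>k\<close>, with \<open>n = Q = k\<close> and
  \<open>\<eta> = \<epsilon> = 1 / k\<close>. The factors \<open>1 - 2 * \<eta>\<close> and
  \<open>1 - \<epsilon>\<close>, the quotient of log k by log (3 m k) and the alignment overhead
  \<open>(1 + 1 / k) ^ V\<close> all tend to 1, which leaves (2 m - 1) / m.\<close>

lemma dof_factor_tendsto:
  fixes m V :: nat
  assumes "m \<ge> 1"
  shows "(\<lambda>k. (1 - 2 * (1 / real k)) * real ((2 * m - 1) * k ^ V) * log 2 (real k) * (1 - 1 / real k) /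
      (real ((k + 1) ^ V + (m - 1) * k ^ V) * log 2 (real (3 * m * k)))) \<longlonglongrightarrow> 1 + (real m - 1) / real m"
proof -
  have m: "real m > 0" using assms by simp
  have "(\<lambda>k. (1 - 2 * (1 / real k)) * (1 - 1 / real k)) \<longlonglongrightarrow> 1" by real_asymp
  moreover have "(\<lambda>k. log 2 (real k) / log 2 (3 * real m * real k)) \<longlonglongrightarrow> 1"
    using m by real_asymp
  moreover have "(\<lambda>k. (2 * real m - 1) / ((1 + 1 / real k) ^ V + (real m - 1))) \<longlonglongrightarrow> (2 * real m - 1) / ((1 + 0) ^ V + (real m - 1))"
    by (intro tendsto_intros lim_1_over_n) (use m in auto)
  ultimately have "(\<lambda>k. ((1 - 2 * (1 / real k)) * (1 - 1 / real k)) * (log 2 (real k) / log 2 (3 * real m * real k)) *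
      ((2 * real m - 1) / ((1 + 1 / real k) ^ V + (real m - 1)))) \<longlonglongrightarrow> 1 * 1 * ((2 * real m - 1) / ((1 + 0) ^ V + (real m - 1)))"
    by (intro tendsto_mult)
  also have "1 * 1 * ((2 * real m - 1) / ((1 + 0) ^ V + (real m - 1))) = 1 + (real m - 1) / real m"
    using m by (simp add: field_simps)
  finally show ?thesis
  proof (rule Lim_transform_eventually)
    show "\<forall>\<^sub>F k in sequentially. ((1 - 2 * (1 / real k)) * (1 - 1 / real k)) * (log 2 (real k) / log 2 (3 * real m * real k)) *
      ((2 * real m - 1) / ((1 + 1 / real k) ^ V + (real m - 1))) =
      (1 - 2 * (1 / real k)) * real ((2 * m - 1) * k ^ V) * log 2 (real k) * (1 - 1 / real k) /
      (real ((k + 1) ^ V + (m - 1) * k ^ V) * log 2 (real (3 * m * k)))"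
      using eventually_gt_at_top[of "0 :: nat"]
    proof eventually_elim
      case (elim k)
      have "real ((k + 1) ^ V + (m - 1) * k ^ V) = real k ^ V * ((1 + 1 / real k) ^ V + (real m - 1))"
      proof -
        have "real k + 1 = real k * (1 + 1 / real k)" using elim by (simp add: field_simps)
        then have "(real k + 1) ^ V = real k ^ V * (1 + 1 / real k) ^ V" by (simp only: power_mult_distrib)
        then show ?thesis using assms by (simp add: of_nat_diff add.commute[of 1] distrib_left mult.commute)
      qed
      moreover have "real ((2 * m - 1) * k ^ V) = real k ^ V * (2 * real m - 1)"
        using assms by (simp add: of_nat_diff)
      moreover have "real (3 * m * k) = 3 * real m * real k" by simp
      moreover have "real k ^ V \<noteq> 0" using elim by simp
      moreover have "z \<noteq> 0 \<Longrightarrow> u * w * (l / l') * (x / y) = u * (z * x) * l * w / (z * y * l')"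
        for u w l l' x y z :: real by (simp add: mult_ac)
      ultimately show ?case by (simp only:)
    qed
  qed
qed

text \<open>\<open>P\<close> tends to infinity with \<open>k\<close> fixed: the gap
  \<open>\<gamma> k - r\<close>, multiplied by (1/2) log P, eventually exceeds the additive loss
  \<open>A + 2\<close>.\<close>

lemma sum_capacity_ge:
  fixes h :: "nat \<times> nat \<Rightarrow> real ^ 'm::finite"
  assumes gen: "algebraically_generic (states 2 J) h" and ab: "{a, b} = {1, 2 :: nat}"
    and J: "J a < CARD('m)" "CARD('m) \<le> J b" and r: "r < 1 + (real CARD('m) - 1) / real CARD('m)"
  shows "\<forall>\<^sub>F P in at_top. ereal (r * (1 / 2 * log 2 P)) \<le> sum_capacity 2 J h P"
proof -
  let ?m = "CARD('m)"
  define V where "V = J b * ?m"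
  define \<gamma> where "\<gamma> k = (1 - 2 * (1 / real k)) * real ((2 * ?m - 1) * k ^ V) * log 2 (real k) * (1 - 1 / real k) /
      (real ((k + 1) ^ V + (?m - 1) * k ^ V) * log 2 (real (3 * ?m * k)))" for k
  have "\<gamma> \<longlonglongrightarrow> 1 + (real ?m - 1) / real ?m"
    unfolding \<gamma>_def by (rule dof_factor_tendsto) (simp add: Suc_le_eq)
  then have "\<forall>\<^sub>F k in sequentially. r < \<gamma> k" using r by (rule order_tendstoD)
  \<comment> \<open>The bound 2 makes \<open>\<eta> = \<epsilon> = 1 / k\<close> satisfy
    \<open>2 * \<eta> <= 1\<close> and \<open>\<epsilon> < 1\<close>.\<close>
  then obtain k where k: "k \<ge> 2" "r < \<gamma> k"
    using eventually_happens[OF eventually_conj[OF _ eventually_ge_at_top[of "2 :: nat"]]] by auto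
  define A where "A = (1 - 2 * (1 / real k)) * real ((2 * ?m - 1) * k ^ V) * log 2 (real k)"
  define D where "D = real ((k + 1) ^ V + (?m - 1) * k ^ V) * log 2 (real (3 * ?m * k))"
  have "\<forall>\<^sub>F P in at_top. \<exists>R. achievable 2 J h P R \<and>
      A * ((1 - 1 / real k) * (1 / 2 * log 2 P) / D - 1) - 2 \<le> R 1 + R 2"
    unfolding A_def D_def V_def
    by (rule achievable_sum_rate[OF gen ab J]) (use k in auto)
  moreover have "filterlim (\<lambda>P. (\<gamma> k - r) * (1 / 2 * log 2 P)) at_top at_top"
  proof -
    have "\<gamma> k - r > 0" using k by simp
    then show ?thesis by real_asymp
  qed
  then have "\<forall>\<^sub>F P in at_top. A + 2 \<le> (\<gamma> k - r) * (1 / 2 * log 2 P)"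
    by (rule filterlim_at_top[THEN iffD1, THEN spec])
  ultimately show ?thesis
  proof eventually_elim
    case (elim P)
    then obtain R where R: "achievable 2 J h P R"
      "A * ((1 - 1 / real k) * (1 / 2 * log 2 P) / D - 1) - 2 \<le> R 1 + R 2" by blast
    have "\<gamma> k = A * (1 - 1 / real k) / D" by (simp add: \<gamma>_def A_def D_def)
    then have "r * (1 / 2 * log 2 P) \<le> A * ((1 - 1 / real k) * (1 / 2 * log 2 P) / D - 1) - 2"
      using elim(2) by (simp add: algebra_simps)
    also have "\<dots> \<le> (\<Sum>k = 1..2. R k)" using R by (simp add: numeral_2_eq_2)
    finally have "ereal (r * (1 / 2 * log 2 P)) \<le> ereal (\<Sum>k = 1..2. R k)" by simp
    also have "\<dots> \<le> sum_capacity 2 J h P"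
      unfolding sum_capacity_def using R by (intro SUP_upper) simp
    finally show ?case .
  qed
qed

lemma has_dof_of_generic:
  fixes h :: "nat \<times> nat \<Rightarrow> real ^ 'm::finite"
  assumes gen: "algebraically_generic (states 2 J) h" and ab: "{a, b} = {1, 2 :: nat}" and m: "CARD('m) \<ge> 2"
    and J: "1 \<le> J a" "J a < CARD('m)" "CARD('m) \<le> J b"
  shows "has_dof 2 J h (1 + (real CARD('m) - 1) / real CARD('m))"
proof -
  let ?d = "1 + (real CARD('m) - 1) / real CARD('m)"
  have ab': "a \<in> {1..2}" "b \<in> {1..2}" using ab by (auto simp: doubleton_eq_iff)
  have fin: "finite (states 2 J)" by (auto simp: states_def)
  obtain g :: "'m \<Rightarrow> nat" where g: "inj g" "range g \<subseteq> {1..J b}"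
    using card_le_inj[of "UNIV :: 'm set" "{1..J b}"] J(3) by auto
  have gi: "g i \<in> {1..J b}" for i using g(2) by blast
  then have g': "inj (\<lambda>i. (b, g i))" "range (\<lambda>i. (b, g i)) \<subseteq> states 2 J"
    using ab' g(1) by (auto simp: states_def inj_def)
  obtain \<alpha> where \<alpha>: "h (a, 1) = (\<Sum>i\<in>UNIV. \<alpha> i *\<^sub>R h (b, g i))"
    by (rule algebraically_generic_combination[OF gen fin g'])
  obtain C where C: "\<And>P R. P \<ge> 1 \<Longrightarrow> achievable 2 J h P R \<Longrightarrow> R 1 + R 2 \<le> ?d * (1 / 2 * log 2 P) + C"
    using rate_sum_bound[where h = h, OF ab m J(1) g(1) gi \<alpha>] by blast
  have ratio: "\<forall>\<^sub>F P in at_top. 1 / 2 * log 2 P > (0 :: real)"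
    by real_asymp
  show ?thesis
    unfolding has_dof_def
  proof (rule order_tendstoI)
    fix x assume "x < ereal ?d"
    then obtain r where r: "x < ereal r" "ereal r < ereal ?d" using ereal_dense2 by blast
    have "r < ?d" using r(2) by simp
    show "\<forall>\<^sub>F P in at_top. x < sum_capacity 2 J h P / ereal (1 / 2 * log 2 P)"
      using sum_capacity_ge[OF gen ab J(2,3) \<open>r < ?d\<close>] ratio
    proof eventually_elim
      case (elim P)
      then have "ereal r \<le> sum_capacity 2 J h P / ereal (1 / 2 * log 2 P)"
        by (subst ereal_le_divide_pos) (auto simp: mult.commute)
      then show ?case using r(1) by (rule less_le_trans[rotated])
    qed
  next
    fix x assume "ereal ?d < x"
    then obtain r where r: "ereal ?d < ereal r" "ereal r < x" using ereal_dense2 by blast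
    have "r - ?d > 0" using r(1) by simp
    then have "filterlim (\<lambda>P. (r - ?d) * (1 / 2 * log 2 P)) at_top at_top" by real_asymp
    then have ev: "\<forall>\<^sub>F P in at_top. C \<le> (r - ?d) * (1 / 2 * log 2 P)"
      by (rule filterlim_at_top[THEN iffD1, THEN spec])
    show "\<forall>\<^sub>F P in at_top. sum_capacity 2 J h P / ereal (1 / 2 * log 2 P) < x"
      using ev ratio eventually_ge_at_top[of 1]
    proof eventually_elim
      case (elim P)
      have "sum_capacity 2 J h P \<le> ereal (1 / 2 * log 2 P) * ereal r"
        unfolding sum_capacity_def
      proof (rule SUP_least)
        fix R assume "R \<in> {R. achievable 2 J h P R}"
        then have "R 1 + R 2 \<le> ?d * (1 / 2 * log 2 P) + C" using C elim(3) by blast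
        also have "\<dots> \<le> 1 / 2 * log 2 P * r" using elim(1) by (simp add: algebra_simps)
        finally show "ereal (\<Sum>k = 1..2. R k) \<le> ereal (1 / 2 * log 2 P) * ereal r"
          by (simp add: numeral_2_eq_2)
      qed
      then have "sum_capacity 2 J h P / ereal (1 / 2 * log 2 P) \<le> ereal r"
        using elim(2) by (subst ereal_divide_le_pos) auto
      then show ?case using r(2) by (rule le_less_trans)
    qed
  qed
qed

theorem theorem3:
  fixes J :: "nat \<Rightarrow> nat"
    and \<mu> :: "(nat \<times> nat \<Rightarrow> real ^ 'm::finite) measure"
  assumes "CARD('m) \<ge> 2"
    and "J 1 \<ge> 1" and "J 2 \<ge> 1"
    and "(J 1 < CARD('m) \<and> J 2 \<ge> CARD('m)) \<or> (J 2 < CARD('m) \<and> J 1 \<ge> CARD('m))"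
    and "continuous_distribution 2 J \<mu>"
  shows "AE h in \<mu>. has_dof 2 J h (1 + (real CARD('m) - 1) / real CARD('m))"
proof -
  have "finite (states 2 J)" by (auto simp: states_def)
  then have "AE h in lebesgue_states 2 J. algebraically_generic (states 2 J) (h :: nat \<times> nat \<Rightarrow> real ^ 'm)"
    unfolding lebesgue_states_def by (rule AE_algebraically_generic)
  moreover have "sets \<mu> = sets (lebesgue_states 2 J)" "absolutely_continuous (lebesgue_states 2 J) \<mu>"
    using assms(5) unfolding continuous_distribution_def by blast+
  ultimately have "AE h in \<mu>. algebraically_generic (states 2 J) h"
    by (blast intro: absolutely_continuous_AE)
  then show ?thesis
  proof eventually_elim
    case (elim h)
    from assms(4) show ?case
    proof
      assume "J 1 < CARD('m) \<and> J 2 \<ge> CARD('m)"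
      then show ?thesis using assms by (intro has_dof_of_generic[OF elim, of 1 2]) auto
    next
      assume "J 2 < CARD('m) \<and> J 1 \<ge> CARD('m)"
      then show ?thesis using assms by (intro has_dof_of_generic[OF elim, of 2 1]) auto
    qed
  qed
qed

end
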